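(* Let $\frac{14}{5}\le\mu<3$ and $\frac53<p\le 1+\frac2\mu$. Let $u_0,u_1\in C_0^\infty(\mathbb R^3)$ be radially symmetric with $\operatorname{supp}(u_0,u_1)\subset B(0,1)$. Then there exists a constant $\varepsilon_0>0$ such that for every $0<\varepsilon\le\varepsilon_0$ the problem $$\partial_t^2u-\Delta u+\frac{\mu}{t}\partial_tu=|u|^p\quad (t\ge1,\ x\in\mathbb R^3),\qquad (u,\partial_tu)(1,x)=\varepsilon(u_0,u_1)(x),$$ admits a unique global radial solution $$u\in C\bigl([1,\infty)\times\mathbb R^3\bigr)\cap C^2\bigl([1,\infty)\times(\mathbb R^3\setminus\{0\})\bigr).$$
   Context: $\Delta=\partial_{x_1}^2+\partial_{x_2}^2+\partial_{x_3}^2$. $B(0,1)$ is the unit ball of $\mathbb R^3$ centred at the origin. "Radial" means that $u(t,x)$ depends only on $t$ and $|x|$. "Global" means defined for all $t\ge1$. Given the stated regularity, the equation is understood pointwise for $x\neq0$. *)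

theory Defs
  imports "HOL-Analysis.Analysis"
begin

text \<open>
  \<open>Ck_on k S f\<close>: \<open>f\<close> is of class \<open>C\<^sup>k\<close> on \<open>S\<close>. Derivatives are taken within \<open>S\<close>, so that at the
  boundary \<open>t = 1\<close> of \<open>[1,\<infinity>) \<times> (\<real>\<^sup>3 - {0})\<close> the derivative in \<open>t\<close> is one-sided. For this set, as for
  open sets, the derivative within \<open>S\<close> is unique, and only the values of \<open>f\<close> on \<open>S\<close> matter.
\<close>

primrec Ck_on :: "nat \<Rightarrow> 'a::euclidean_space set \<Rightarrow> ('a \<Rightarrow> real) \<Rightarrow> bool" where
  "Ck_on 0 S f \<longleftrightarrow> continuous_on S f"
| "Ck_on (Suc k) S f \<longleftrightarrow>
     (\<exists>f'. (\<forall>x\<in>S. (f has_derivative f' x) (at x within S)) \<and>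
           (\<forall>b\<in>Basis. Ck_on k S (\<lambda>x. f' x b)))"

definition supp :: "('a::topological_space \<Rightarrow> real) \<Rightarrow> 'a set" where
  "supp f = closure {x. f x \<noteq> 0}"

definition Cinf_compact_support :: "('a::euclidean_space \<Rightarrow> real) \<Rightarrow> bool" where
  "Cinf_compact_support f \<longleftrightarrow> (\<forall>k. Ck_on k UNIV f) \<and> compact (supp f)"

definition radial :: "('a::real_normed_vector \<Rightarrow> real) \<Rightarrow> bool" where
  "radial f \<longleftrightarrow> (\<forall>x y. norm x = norm y \<longrightarrow> f x = f y)"

definition partial_x :: "3 \<Rightarrow> (real^3 \<Rightarrow> real) \<Rightarrow> real^3 \<Rightarrow> real" where
  "partial_x i f x = deriv (\<lambda>h. f (x + h *\<^sub>R axis i 1)) 0"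

definition laplacian :: "(real^3 \<Rightarrow> real) \<Rightarrow> real^3 \<Rightarrow> real" where
  "laplacian f x = (\<Sum>i\<in>UNIV. partial_x i (partial_x i f) x)"

text \<open>The time derivative is taken within \<open>[1,\<infinity>)\<close>: one-sided at \<open>t = 1\<close>, two-sided for \<open>t > 1\<close>.\<close>

definition partial_t :: "(real \<Rightarrow> real^3 \<Rightarrow> real) \<Rightarrow> real \<Rightarrow> real^3 \<Rightarrow> real" where
  "partial_t u t x = vector_derivative (\<lambda>s. u s x) (at t within {1..})"

text \<open>
  Global radial solutions with data \<open>(u, \<partial>\<^sub>t u)(1, x) = (f, g)(x)\<close>. The values of \<open>u\<close> at times
  \<open>t < 1\<close> are irrelevant. As \<open>u\<close> is only assumed continuous on the axis \<open>x = 0\<close>, the equation and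
  the condition on \<open>\<partial>\<^sub>t u\<close> are imposed for \<open>x \<noteq> 0\<close>, whereas \<open>u(1, x) = f(x)\<close> is imposed for all \<open>x\<close>.
\<close>

definition global_radial_solution ::
  "real \<Rightarrow> real \<Rightarrow> (real^3 \<Rightarrow> real) \<Rightarrow> (real^3 \<Rightarrow> real) \<Rightarrow> (real \<Rightarrow> real^3 \<Rightarrow> real) \<Rightarrow> bool" where
  "global_radial_solution \<mu> p f g u \<longleftrightarrow>
     continuous_on ({1..} \<times> UNIV) (\<lambda>(t, x). u t x) \<and>
     Ck_on 2 ({1..} \<times> (UNIV - {0})) (\<lambda>(t, x). u t x) \<and>
     (\<forall>t\<ge>1. radial (u t)) \<and>
     (\<forall>t\<ge>1. \<forall>x. x \<noteq> 0 \<longrightarrow>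
        partial_t (partial_t u) t x - laplacian (u t) x + \<mu> / t * partial_t u t x
          = \<bar>u t x\<bar> powr p) \<and>
     (\<forall>x. u 1 x = f x) \<and>
     (\<forall>x. x \<noteq> 0 \<longrightarrow> partial_t u 1 x = g x)"

end

theory Submission
  imports Defs
begin

text \<open>
  Put \<open>m = \<mu> / 2\<close> and \<open>V(t, r) = t\<^sup>m r u(t, r)\<close>. For radial \<open>u\<close> the problem becomes
  \<open>V\<^sub>t\<^sub>t - V\<^sub>r\<^sub>r = F = m (m - 1) V / t\<^sup>2 + t\<^bsup>m - m p\<^esup> r \<bar>V / r\<bar>\<^sup>p\<close> with \<open>V\<close> odd in \<open>r\<close>.
  As \<open>m > 1\<close>, the linear term has the same sign as the source, so the Duhamel operator is monotone
  for \<open>r > 0\<close>, and a nonnegative supersolution \<open>\<Phi>\<close> bounds the solution. With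
  \<open>q = t\<^sup>2 - r\<^sup>2\<close> the function \<open>r t\<^bsup>1-m\<^esup> q\<^bsup>m-2\<^esup>\<close> solves the linear equation exactly, and \<open>\<Phi>\<close> is a
  large multiple of it minus two lower order terms \<open>r t\<^sup>c q\<^bsup>-l\<^esup>\<close>, which produce the room needed for
  the nonlinearity inside \<open>r \<le> t - \<eta>\<close>; this is possible because \<open>p > 5/3\<close> and \<open>m \<ge> 7/5\<close>.

  The unknown of the fixed point argument is \<open>P = V\<^sub>t + V\<^sub>r\<close> as a function of \<open>(t, y)\<close>, \<open>y = t + r\<close>.
  Then \<open>V(t, r) = (\<integral>\<^bsub>t-r\<^esub>\<^bsup>t+r\<^esup> P(t, y) dy) / 2\<close>, so \<open>V / r\<close> is a mean value of \<open>P\<close>, which takes care of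
  the axis, and \<open>P(t, y) = P(1, y) + \<integral>\<^sub>1\<^sup>t F(s, y - s) ds\<close>. Comparison and uniqueness both
  integrate first along the incoming and then along the outgoing characteristic.
\<close>

section \<open>Signed integrals and mean values\<close>

text \<open>An exact solution of the linear equation leaves no slack for the nonlinearity. With
  \<open>q = t\<^sup>2 - r\<^sup>2\<close>, subtracting \<open>r * w1\<close> creates a gain of
  order \<open>r * w1 / q\<close>, singular at the light cone like the nonlinearity itself. Its
  price is a loss of order \<open>r * w1 / t\<^sup>2\<close>, felt only where \<open>q\<close> is
  comparable to \<open>t\<^sup>2\<close>; \<open>w2\<close> is there to pay it.

  The obstacle is that a bound on \<open>V\<close> alone does not reproduce itself, since
  \<open>V\<close> is recovered from \<open>P\<close>: the outgoing derivative of the supersolution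
  has to dominate \<open>P\<close> as well. That derivative degenerates at the light cone, so those
  of the corrections must be controlled by the same factor \<open>t - r\<close>, and the data must
  keep the distance \<open>\<eta>\<close>.

  The barrier and the metric have separate tasks. The barrier yields the uniform bound
  \<open>\<bar>V / r\<bar> \<le> 1\<close>, hence one Lipschitz constant for all times; the
  contraction is measured with a weight that ignores decay. So a single fixed point covers all
  times, and no local solution is ever continued.\<close>

lemma abs_le_along:
  fixes \<phi> \<psi> :: "real \<Rightarrow> real"
  assumes "a \<le> b" and "continuous_on {a..b} \<phi>" and "continuous_on {a..b} \<psi>"
    and "\<And>s. a < s \<Longrightarrow> s < b \<Longrightarrow> (\<phi> has_real_derivative \<phi>' s) (at s)"
    and "\<And>s. a < s \<Longrightarrow> s < b \<Longrightarrow> (\<psi> has_real_derivative \<psi>' s) (at s)"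
    and bound: "\<And>s. a < s \<Longrightarrow> s < b \<Longrightarrow> \<bar>\<phi>' s\<bar> \<le> \<psi>' s"
    and "\<bar>\<phi> a\<bar> \<le> \<psi> a"
  shows "\<bar>\<phi> b\<bar> \<le> \<psi> b"
proof -
  have "\<psi> a - \<phi> a \<le> \<psi> b - \<phi> b"
  proof (rule DERIV_nonneg_imp_increasing_open[OF \<open>a \<le> b\<close>])
    show "\<exists>y. ((\<lambda>s. \<psi> s - \<phi> s) has_real_derivative y) (at s) \<and> 0 \<le> y" if "a < s" "s < b" for s
      using that assms(4,5)[OF that] bound[OF that]
      by (intro exI[of _ "\<psi>' s - \<phi>' s"]) (auto intro!: derivative_eq_intros)
  qed (use assms in \<open>auto intro!: continuous_intros\<close>)
  moreover have "\<psi> a + \<phi> a \<le> \<psi> b + \<phi> b"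
  proof (rule DERIV_nonneg_imp_increasing_open[OF \<open>a \<le> b\<close>])
    show "\<exists>y. ((\<lambda>s. \<psi> s + \<phi> s) has_real_derivative y) (at s) \<and> 0 \<le> y" if "a < s" "s < b" for s
      using that assms(4,5)[OF that] bound[OF that]
      by (intro exI[of _ "\<psi>' s + \<phi>' s"]) (auto intro!: derivative_eq_intros)
  qed (use assms in \<open>auto intro!: continuous_intros\<close>)
  ultimately show ?thesis using assms(7) by linarith
qed

text \<open>The integral of \<open>f\<close> from \<open>a\<close> to \<open>t\<close>, with the usual sign convention for \<open>t < a\<close> (whereas
  \<open>integral {a..t} f = 0\<close> in that case).\<close>

definition sint :: "real \<Rightarrow> real \<Rightarrow> (real \<Rightarrow> real) \<Rightarrow> real" where
  "sint a t f = (t - a) * integral {0..1} (\<lambda>\<theta>. f (a + \<theta> * (t - a)))"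

lemma sint_same [simp]: "sint a a f = 0"
  by (simp add: sint_def)

text \<open>The sign of \<open>d\<close> is free: for \<open>d < 0\<close> the segment is run
  through backwards and the factor \<open>d\<close> in the integrand supplies the orientation. This
  serves signed integrals and mean values alike.\<close>

lemma has_integral_segment:
  fixes f G :: "real \<Rightarrow> real"
  assumes G: "\<And>x. x \<in> closed_segment (a + u * d) (a + v * d) \<Longrightarrow> (G has_real_derivative f x) (at x within X)"
    and X: "closed_segment (a + u * d) (a + v * d) \<subseteq> X" and uv: "u \<le> v"
  shows "((\<lambda>\<theta>. d * f (a + \<theta> * d)) has_integral (G (a + v * d) - G (a + u * d))) {u..v}"
proof (rule fundamental_theorem_of_calculus[OF uv])
  fix \<theta> assume \<theta>: "\<theta> \<in> {u..v}"
  have seg: "a + \<theta>' * d \<in> closed_segment (a + u * d) (a + v * d)" if "\<theta>' \<in> {u..v}" for \<theta>'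
  proof (cases "0 \<le> d")
    case True
    then have "u * d \<le> \<theta>' * d" "\<theta>' * d \<le> v * d" using that by (auto intro: mult_right_mono)
    then show ?thesis by (simp add: closed_segment_eq_real_ivl)
  next
    case False
    then have "v * d \<le> \<theta>' * d" "\<theta>' * d \<le> u * d" using that by (auto intro: mult_right_mono_neg)
    then show ?thesis by (simp add: closed_segment_eq_real_ivl)
  qed
  have "(G has_real_derivative f (a + \<theta> * d)) (at (a + \<theta> * d) within (\<lambda>\<theta>. a + \<theta> * d) ` {u..v})"
    by (rule DERIV_subset[OF G[OF seg[OF \<theta>]]]) (use seg X in auto)
  then have "((G \<circ> (\<lambda>\<theta>. a + \<theta> * d)) has_real_derivative f (a + \<theta> * d) * d) (at \<theta> within {u..v})"
    by (rule DERIV_image_chain) (auto intro!: derivative_eq_intros)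
  then show "((\<lambda>\<theta>. G (a + \<theta> * d)) has_vector_derivative d * f (a + \<theta> * d)) (at \<theta> within {u..v})"
    by (simp add: has_real_derivative_iff_has_vector_derivative o_def mult.commute)
qed

lemma sint_eq_diff_within:
  assumes "\<And>x. x \<in> closed_segment a t \<Longrightarrow> (G has_real_derivative f x) (at x within X)"
    and "closed_segment a t \<subseteq> X"
  shows "sint a t f = G t - G a"
proof -
  have "((\<lambda>\<theta>. (t - a) * f (a + \<theta> * (t - a))) has_integral (G t - G a)) {0..1}"
    using has_integral_segment[of a 0 "t - a" 1 G f X] assms by simp
  then show ?thesis
    unfolding sint_def by (metis integral_mult_right integral_unique)
qed

lemma sint_eq_diff:
  assumes "\<And>x. (G has_real_derivative f x) (at x)"
  shows "sint a t f = G t - G a"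
  by (rule sint_eq_diff_within[of _ _ _ _ UNIV]) (use assms in auto)

lemma sint_has_real_derivative:
  assumes f: "continuous_on UNIV f"
  shows "((\<lambda>t. sint a t f) has_real_derivative f t) (at t)"
proof -
  \<comment> \<open>The margin of one on both sides puts \<open>t\<close> in the interior, so that a
    derivative within \<open>{c..d}\<close> becomes an unrestricted one, even for
    \<open>t = a\<close>.\<close>
  define c d where "c = min a t - 1" and "d = max a t + 1"
  define G where "G x = integral {c..x} f" for x
  have G: "(G has_real_derivative f x) (at x within {c..d})" if "x \<in> {c..d}" for x
    unfolding G_def by (rule integral_has_real_derivative[OF continuous_on_subset[OF f] that]) auto
  have "sint a x f = G x - G a" if "x \<in> {c<..<d}" for x
    by (rule sint_eq_diff_within[of _ _ _ _ "{c..d}"])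
      (use that G in \<open>auto simp: closed_segment_eq_real_ivl c_def d_def split: if_splits\<close>)
  then have eq: "G x - G a = sint a x f" if "x \<in> {c<..<d}" for x
    using that by simp
  have "((\<lambda>x. G x - G a) has_real_derivative f t) (at t)"
  proof -
    have "(G has_real_derivative f t) (at t within {c<..<d})"
      by (rule DERIV_subset[OF G]) (auto simp: c_def d_def)
    then have "(G has_real_derivative f t) (at t)"
      by (subst (asm) at_within_open) (auto simp: c_def d_def)
    then show ?thesis by (auto intro!: derivative_eq_intros)
  qed
  then show ?thesis
    by (rule has_field_derivative_transform_within_open[of _ _ _ "{c<..<d}"])
      (use eq in \<open>auto simp: c_def d_def\<close>)
qed

lemma abs_sint_le:
  assumes f: "continuous_on UNIV f" and "a \<le> t"
    and H: "\<And>s. (H has_real_derivative h s) (at s)"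
    and "\<And>s. a \<le> s \<Longrightarrow> s \<le> t \<Longrightarrow> \<bar>f s\<bar> \<le> h s"
  shows "\<bar>sint a t f\<bar> \<le> H t - H a"
proof (rule abs_le_along[of a t "\<lambda>s. sint a s f" "\<lambda>s. H s - H a" f h])
  show "continuous_on {a..t} (\<lambda>s. sint a s f)"
    by (rule DERIV_continuous_on[OF DERIV_subset[OF sint_has_real_derivative[OF f]]]) auto
  show "continuous_on {a..t} (\<lambda>s. H s - H a)"
    by (intro continuous_intros DERIV_continuous_on[OF DERIV_subset[OF H]]) auto
qed (use assms in \<open>auto intro!: derivative_eq_intros sint_has_real_derivative[OF f]\<close>)

lemma sint_diff:
  assumes "continuous_on UNIV f" "continuous_on UNIV g"
  shows "sint a t (\<lambda>s. f s - g s) = sint a t f - sint a t g"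
proof -
  have "((\<lambda>t. sint a t f - sint a t g) has_real_derivative f x - g x) (at x)" for x
    by (intro derivative_intros sint_has_real_derivative assms)
  from sint_eq_diff[OF this, of a t] show ?thesis by simp
qed

section \<open>Parameter integrals as functions of two variables\<close>

lemma continuous_on_case_prod_compose:
  "continuous_on UNIV (\<lambda>(s, y). h s y) \<Longrightarrow> continuous_on A a \<Longrightarrow> continuous_on A b
    \<Longrightarrow> continuous_on A (\<lambda>x. h (a x) (b x))"
  using continuous_on_compose2[of UNIV "\<lambda>(s, y). h s y" A "\<lambda>x. (a x, b x)"]
  by (auto intro!: continuous_intros)

lemma continuous_on_section:
  "continuous_on UNIV (\<lambda>(s, y). h s y) \<Longrightarrow> continuous_on UNIV (h s)"
  by (rule continuous_on_case_prod_compose) (auto intro!: continuous_intros)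

lemma continuous_on_integral_param:
  fixes g :: "'a::topological_space \<Rightarrow> real \<Rightarrow> real"
  assumes "continuous_on UNIV (\<lambda>(x, \<theta>). g x \<theta>)"
  shows "continuous_on UNIV (\<lambda>x. integral {u..v} (g x))"
  using integral_continuous_on_param[of UNIV u v g] continuous_on_subset[OF assms, of "UNIV \<times> {u..v}"]
  by simp

lemma continuous_on_sint:
  assumes "continuous_on UNIV (\<lambda>(s, y). h s y)"
  shows "continuous_on UNIV (\<lambda>(t, y). sint a t (\<lambda>s. h s y))"
proof -
  have "continuous_on UNIV (\<lambda>x. integral {0..1} (\<lambda>\<theta>. h (a + \<theta> * (fst x - a)) (snd x)))"
    by (rule continuous_on_integral_param)
      (auto simp: case_prod_unfold intro!: continuous_on_case_prod_compose[OF assms] continuous_intros)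
  then have "continuous_on UNIV (\<lambda>x. (fst x - a) * integral {0..1} (\<lambda>\<theta>. h (a + \<theta> * (fst x - a)) (snd x)))"
    by (intro continuous_intros)
  then show ?thesis by (simp add: sint_def case_prod_unfold)
qed

text \<open>Total differentiability follows once a single partial is continuous. Here it is the one
  in \<open>y\<close>, which for Duhamel integrals is again an integral and so continuous in both
  variables.\<close>

lemma has_derivative_of_partials:
  fixes f :: "real \<Rightarrow> real \<Rightarrow> real"
  assumes "(( \<lambda>t. f t y) has_real_derivative ft) (at t)"
    and "\<And>t y. ((f t) has_real_derivative fy t y) (at y)"
    and "continuous_on UNIV (\<lambda>(t, y). fy t y)"
  shows "((\<lambda>(t, y). f t y) has_derivative (\<lambda>(dt, dy). ft * dt + fy t y * dy)) (at (t, y))"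
proof -
  have "((\<lambda>(t, y). f t y) has_derivative (\<lambda>(tx, ty). ft * tx + blinfun_mult_right (fy t y) ty)) (at (t, y) within UNIV \<times> UNIV)"
  proof (rule has_derivative_partialsI[where fx = "\<lambda>tx. ft * tx"])
    show "((\<lambda>t. f t y) has_derivative (*) ft) (at t within UNIV)"
      using assms(1) by (simp add: has_field_derivative_def)
    show "(f t has_derivative blinfun_apply (blinfun_mult_right (fy t y))) (at y within UNIV)" for t y
      using assms(2)[of t y] by (simp add: has_field_derivative_eq_has_derivative_blinfun)
    have "continuous_on UNIV (\<lambda>x. blinfun_mult_right ((\<lambda>(t, y). fy t y) x))"
      by (rule bounded_linear.continuous_on[OF bounded_linear_blinfun_mult_right assms(3)])
    then show "continuous (at (t, y) within UNIV \<times> UNIV) (\<lambda>(t, y). blinfun_mult_right (fy t y))"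
      by (simp add: case_prod_unfold continuous_on_eq_continuous_at)
  qed auto
  then show ?thesis by simp
qed

text \<open>The slope in \<open>t\<close> is the integrand at the endpoint; the slope in
  \<open>y\<close> comes from differentiating under the integral, for which the fixed domain
  \<open>{0..1}\<close> in \<open>sint\<close> is convenient.\<close>

lemma sint_has_derivative:
  assumes h: "continuous_on UNIV (\<lambda>(s, y). h s y)" and hy: "continuous_on UNIV (\<lambda>(s, y). hy s y)"
    and d: "\<And>s y. ((h s) has_real_derivative hy s y) (at y)"
  shows "((\<lambda>(t, y). sint a t (\<lambda>s. h s y)) has_derivative
     (\<lambda>(dt, dy). h t y * dt + sint a t (\<lambda>s. hy s y) * dy)) (at (t, y))"
proof (rule has_derivative_of_partials)
  show "((\<lambda>t. sint a t (\<lambda>s. h s y)) has_real_derivative h t y) (at t)"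
    by (rule sint_has_real_derivative) (auto intro!: continuous_on_case_prod_compose[OF h] continuous_intros)
  show "continuous_on UNIV (\<lambda>(t, y). sint a t (\<lambda>s. hy s y))" by (rule continuous_on_sint[OF hy])
  show "((\<lambda>y. sint a t (\<lambda>s. h s y)) has_real_derivative sint a t (\<lambda>s. hy s y)) (at y)" for t y
  proof -
    have "((\<lambda>y. integral (cbox 0 1) (\<lambda>\<theta>. h (a + \<theta> * (t - a)) y)) has_real_derivative
        integral (cbox 0 1) (\<lambda>\<theta>. hy (a + \<theta> * (t - a)) y)) (at y within UNIV)"
      by (rule leibniz_rule_field_derivative)
        (auto simp: case_prod_unfold intro!: d integrable_continuous_interval continuous_on_case_prod_compose[OF h] continuous_on_case_prod_compose[OF hy] continuous_intros)
    then show ?thesis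
      unfolding sint_def by (auto intro!: derivative_eq_intros)
  qed
qed

text \<open>Scaling to the fixed interval \<open>{-1..1}\<close> makes the value at
  \<open>r = 0\<close> equal to \<open>h t\<close>. Thus \<open>V / r\<close> is defined and
  continuous across the axis without a case distinction.\<close>

definition mean :: "real \<Rightarrow> real \<Rightarrow> (real \<Rightarrow> real) \<Rightarrow> real" where
  "mean t r h = integral {-1..1} (\<lambda>\<theta>. h (t + \<theta> * r)) / 2"

lemma mean_eq_sint:
  assumes h: "continuous_on UNIV h"
  shows "r * mean t r h = (sint 0 (t + r) h - sint 0 (t - r) h) / 2"
proof -
  have "((\<lambda>\<theta>. r * h (t + \<theta> * r)) has_integral (sint 0 (t + 1 * r) h - sint 0 (t + (-1) * r) h)) {-1..1}"
    by (rule has_integral_segment[where X = UNIV]) (auto intro!: sint_has_real_derivative h)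
  then have "integral {-1..1} (\<lambda>\<theta>. r * h (t + \<theta> * r)) = sint 0 (t + r) h - sint 0 (t - r) h"
    by (intro integral_unique) simp
  then show ?thesis by (simp add: mean_def)
qed

lemma continuous_on_mean:
  assumes "continuous_on UNIV (\<lambda>(t, y). h t y)"
  shows "continuous_on UNIV (\<lambda>(t, r). mean t r (h t))"
proof -
  have "continuous_on UNIV (\<lambda>x. integral {-1..1} (\<lambda>\<theta>. h (fst x) (fst x + \<theta> * snd x)))"
    by (rule continuous_on_integral_param)
      (auto simp: case_prod_unfold intro!: continuous_on_case_prod_compose[OF assms] continuous_intros)
  then show ?thesis by (simp add: mean_def case_prod_unfold continuous_intros)
qed

lemma mean_minus:
  assumes h: "continuous_on UNIV h"
  shows "mean t (- r) h = mean t r h"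
proof (cases "r = 0")
  case False
  then show ?thesis using mean_eq_sint[OF h, of r t] mean_eq_sint[OF h, of "-r" t] by (simp add: field_simps)
qed simp

lemma mean_diff:
  assumes "continuous_on UNIV h" "continuous_on UNIV k"
  shows "mean t r h - mean t r k = mean t r (\<lambda>y. h y - k y)"
  unfolding mean_def
  by (subst integral_diff)
     (auto simp: diff_divide_distrib intro!: integrable_continuous_interval continuous_on_compose2[OF assms(1)] continuous_on_compose2[OF assms(2)] continuous_intros)

lemma abs_mean_le:
  assumes "continuous_on UNIV h" and "\<And>y. \<bar>h y\<bar> \<le> B"
  shows "\<bar>mean t r h\<bar> \<le> B"
proof -
  have "norm (integral {-1..1} (\<lambda>\<theta>. h (t + \<theta> * r))) \<le> B * (1 - (-1))"
    by (rule integral_bound)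
       (use assms(2) in \<open>auto intro!: continuous_on_compose2[OF assms(1)] continuous_intros\<close>)
  then show ?thesis by (simp add: mean_def)
qed

lemma sint_odd:
  assumes h: "continuous_on UNIV h" and odd: "\<And>y. h (- y) = - h y"
  shows "sint 0 (- t) h = sint 0 t h"
proof -
  have "((\<lambda>t. sint 0 (- t) h) has_real_derivative h x) (at x)" for x
    using sint_has_real_derivative[OF h, of 0 "- x"] by (simp add: DERIV_mirror odd)
  from sint_eq_diff[OF this, of 0 t] show ?thesis by simp
qed

section \<open>A supersolution\<close>

definition wt :: "real \<Rightarrow> real \<Rightarrow> real \<Rightarrow> real \<Rightarrow> real" where
  "wt c l t r = t powr c * (t\<^sup>2 - r\<^sup>2) powr (- l)"

text \<open>For \<open>\<Phi> = r * wt c l\<close>, these are \<open>\<Phi>\<^sub>t + \<Phi>\<^sub>r\<close> and \<open>\<Phi>\<^sub>t\<^sub>t - \<Phi>\<^sub>r\<^sub>r\<close>.\<close>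

definition wt_out :: "real \<Rightarrow> real \<Rightarrow> real \<Rightarrow> real \<Rightarrow> real" where
  "wt_out c l t r = wt c l t r * (1 + c * r / t - 2 * l * r / (t + r))"

definition wt_box :: "real \<Rightarrow> real \<Rightarrow> real \<Rightarrow> real \<Rightarrow> real" where
  "wt_box c l t r = r * wt c l t r * (4 * l * (l - 1 - c) / (t\<^sup>2 - r\<^sup>2) + c * (c - 1) / t\<^sup>2)"

lemma wt_pos: "0 < t \<Longrightarrow> 0 < t\<^sup>2 - r\<^sup>2 \<Longrightarrow> 0 < wt c l t r"
  by (simp add: wt_def)

lemma sq_diff_pos: "0 \<le> r \<Longrightarrow> r < t \<Longrightarrow> 0 < t\<^sup>2 - (r::real)\<^sup>2"
  by (simp add: power2_eq_square square_diff_square_factored)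

text \<open>The line \<open>r = s - b\<close> is an outgoing characteristic, so the derivative along
  it is \<open>\<Phi>\<^sub>t + \<Phi>\<^sub>r\<close>. On it \<open>t\<^sup>2 - r\<^sup>2\<close>
  factors as \<open>b * (2 * s - b)\<close> with \<open>b\<close> constant.\<close>

lemma wt_forward_deriv:
  assumes t: "0 < t" and r: "0 \<le> t - b" and b: "0 < b"
  shows "((\<lambda>s. (s - b) * wt c l s (s - b)) has_real_derivative wt_out c l t (t - b)) (at t)"
proof -
  have q: "0 < t\<^sup>2 - (t - b)\<^sup>2" using sq_diff_pos[OF r] b by simp
  have qf: "t\<^sup>2 - (t - b)\<^sup>2 = b * (2 * t - b)" by (simp add: power2_eq_square algebra_simps)
  have "2 * t - b > 0" using t r by simp
  show ?thesis unfolding wt_def wt_out_def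
    apply (rule derivative_eq_intros refl | (use t q in simp; fail))+
    using t q b \<open>2 * t - b > 0\<close> unfolding qf
    by (simp add: powr_diff field_simps power2_eq_square)
qed

text \<open>Along an incoming characteristic the derivative is
  \<open>\<partial>\<^sub>t - \<partial>\<^sub>r\<close>; applied to
  \<open>\<Phi>\<^sub>t + \<Phi>\<^sub>r\<close> it gives the wave operator. Now
  \<open>t\<^sup>2 - r\<^sup>2\<close> factors as \<open>a * (2 * s - a)\<close>.\<close>

lemma wt_backward_deriv:
  assumes t: "0 < t" and r: "0 \<le> a - t" and b: "0 < 2 * t - a"
  shows "((\<lambda>s. wt_out c l s (a - s)) has_real_derivative wt_box c l t (a - t)) (at t)"
proof -
  have q: "0 < t\<^sup>2 - (a - t)\<^sup>2" using sq_diff_pos[OF r] b by simp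
  have a: "0 < a" using t r by simp
  define X where "X = wt c l t (a - t)"
  have d1: "((\<lambda>s. wt c l s (a - s)) has_real_derivative X * (c / t - 2 * l / (2 * t - a))) (at t)"
  proof -
    have qf: "t\<^sup>2 - (a - t)\<^sup>2 = a * (2 * t - a)" by (simp add: power2_eq_square algebra_simps)
    show ?thesis unfolding X_def wt_def
      apply (rule derivative_eq_intros refl | (use t q in simp; fail))+
      using t b a unfolding qf
      by (simp add: powr_diff powr_minus field_simps power2_eq_square)
  qed
  have d2: "((\<lambda>s. 1 + c * (a - s) / s - 2 * l * (a - s) / (s + (a - s))) has_real_derivative
     (- c * a / t\<^sup>2 + 2 * l / a)) (at t)"
    using t a by (auto intro!: derivative_eq_intros simp: field_simps power2_eq_square)
  have "X * (c / t - 2 * l / (2 * t - a)) * (1 + c * (a - t) / t - 2 * l * (a - t) / (t + (a - t)))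
      + X * (- c * a / t\<^sup>2 + 2 * l / a) =
    (a - t) * X * (4 * l * (l - 1 - c) / (a * (2 * t - a)) + c * (c - 1) / t\<^sup>2)"
    using t a b by (simp add: divide_simps) (simp add: power2_eq_square algebra_simps)
  moreover have "t\<^sup>2 - (a - t)\<^sup>2 = a * (2 * t - a)" by (simp add: power2_eq_square algebra_simps)
  ultimately show ?thesis
    unfolding wt_out_def wt_box_def
    using DERIV_mult'[OF d1 d2] by (simp add: X_def[symmetric] ac_simps)
qed

text \<open>The bounds are those of the theorem with \<open>\<mu> = 2 * m\<close>. Data living in
  radius at most \<open>1 - \<eta>\<close> stay in \<open>r \<le> t - \<eta>\<close>, so the weights
  are only used where \<open>t\<^sup>2 - r\<^sup>2 \<ge> \<eta> * t\<close>.\<close>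

locale damping =
  fixes m p \<eta> :: real
  assumes m_ge: "7 / 5 \<le> m" and m_less: "m < 3 / 2" and p_gt: "5 / 3 < p" and p_le: "p \<le> 1 + 1 / m"
    and eta: "0 < \<eta>" "\<eta> < 1"
begin

text \<open>Near \<open>t = r\<close> the nonlinearity is of size \<open>t\<^bsup>-\<kappa>-1\<^esup> (t - r)\<^bsup>-(2-m)p\<^esup>\<close>, which dictates \<open>\<kappa>\<close> and the lower
  bound on \<open>\<nu>\<close>; positivity of \<open>\<gamma>\<close> is where \<open>p > 5/3\<close> enters. \<open>K\<close> makes the gain from \<open>w2\<close> absorb the
  term of the wrong sign in \<open>w1\<close>, and \<open>A\<close> keeps the supersolution and its outgoing derivative positive.\<close>

definition "\<kappa> = (p - 1) * (m + 1) - 1"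
definition "\<nu> = max (1 - (2 - m) * p) ((\<kappa> - (2 - m)) / 2)"
definition "\<gamma> = \<kappa> - (2 - m) - \<nu>"
definition "K = (1 + \<kappa> + \<nu>) * (2 + \<kappa> + \<nu>) / (\<gamma> * (2 * m - 1 - \<gamma>))"
definition "A = 1 + 2 * \<eta> powr (- \<gamma>) * (2 + \<kappa> + \<nu> + K)"

text \<open>From \<open>p > 5/3\<close> one gets \<open>\<kappa> > (2 * m - 1) / 3\<close>, and
  \<open>(2 * m - 1) / 3 \<ge> 2 - m\<close> says precisely \<open>m \<ge> 7/5\<close>: the lower
  bound on \<open>\<mu>\<close> is exhausted here.\<close>

lemma kappa_gt: "2 - m < \<kappa>"
proof -
  have "2 / 3 * (m + 1) < (p - 1) * (m + 1)"
    using p_gt m_ge by (intro mult_strict_right_mono) auto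
  then show ?thesis using m_ge unfolding \<kappa>_def by (simp add: field_simps)
qed

lemma nu_pos: "0 < \<nu>" and nu_ge: "1 - (2 - m) * p \<le> \<nu>"
proof -
  have "0 < (\<kappa> - (2 - m)) / 2" using kappa_gt by simp
  then show "0 < \<nu>" unfolding \<nu>_def by (rule less_max_iff_disj[THEN iffD2, OF disjI2])
qed (simp add: \<nu>_def)

text \<open>By the choice of \<open>\<nu>\<close>, \<open>\<gamma>\<close> is the smaller of
  \<open>3 * p - 5\<close> and half of \<open>\<kappa> - (2 - m)\<close>.\<close>

lemma gamma_pos: "0 < \<gamma>"
proof -
  have "\<kappa> - (2 - m) - (1 - (2 - m) * p) = 3 * p - 5" by (simp add: \<kappa>_def algebra_simps)
  then have "1 - (2 - m) * p < \<kappa> - (2 - m)" using p_gt by simp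
  then show ?thesis using kappa_gt by (auto simp: \<gamma>_def \<nu>_def max_def)
qed

text \<open>The upper bound on \<open>p\<close> enters here:
  \<open>3 * p - 5 \<le> 3 / m - 2 \<le> 1/7\<close>, while \<open>m - 1 \<ge> 2/5\<close>. This
  keeps the exponent \<open>1 - m + \<gamma>\<close> of \<open>t\<close> in \<open>w2\<close>
  negative and the denominator of \<open>K\<close> positive.\<close>

lemma gamma_less: "\<gamma> < m - 1"
proof -
  have "\<kappa> - (2 - m) - (1 - (2 - m) * p) = 3 * p - 5" by (simp add: \<kappa>_def algebra_simps)
  then have "\<gamma> \<le> 3 * p - 5" using nu_ge unfolding \<gamma>_def by linarith
  moreover have "1 / m \<le> 5 / 7" using m_ge by (simp add: field_simps)
  ultimately show ?thesis using p_le m_ge by linarith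
qed

lemma kappa_pos: "0 < \<kappa>" using kappa_gt m_less by linarith

lemma K_pos: "0 < K"
  using kappa_pos nu_pos gamma_pos gamma_less m_ge unfolding K_def
  by (intro divide_pos_pos mult_pos_pos) auto

lemma A_pos: "1 < A"
  using kappa_pos nu_pos K_pos eta unfolding A_def by (simp add: add_pos_pos)

text \<open>In \<open>wt_box\<close> the coefficient of \<open>1 / (t\<^sup>2 - r\<^sup>2)\<close>
  vanishes for \<open>c = l - 1\<close>, which is the case for \<open>w0\<close> and
  \<open>w2\<close>; the remaining \<open>c * (c - 1)\<close> is \<open>m * (m - 1)\<close> for
  \<open>w0\<close> and smaller for \<open>w2\<close>. For \<open>w1\<close> the first coefficient
  is \<open>- 4 * \<kappa> * \<nu>\<close>, so \<open>- w1\<close> gains at the light cone.\<close>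

abbreviation "w0 \<equiv> wt (1 - m) (2 - m)"
abbreviation "w1 \<equiv> wt (- 1 - \<kappa> - \<nu>) (- \<nu>)"
abbreviation "w2 \<equiv> wt (1 - m + \<gamma>) (2 - m + \<gamma>)"

definition "in_cone t r \<longleftrightarrow> 1 \<le> t \<and> 0 \<le> r \<and> r \<le> t - \<eta>"

section \<open>The weights inside the cone\<close>

context
  fixes t r :: real
  assumes cone: "in_cone t r"
begin

lemma t_ge: "1 \<le> t" and r_ge: "0 \<le> r" and r_le: "r \<le> t - \<eta>"
  using cone by (auto simp: in_cone_def)

lemma q_ge: "\<eta> * t \<le> t\<^sup>2 - r\<^sup>2"
proof -
  have "\<eta> * t \<le> (t - r) * (t + r)"
    using t_ge r_ge r_le eta by (intro mult_mono) auto
  then show ?thesis by (simp add: power2_eq_square algebra_simps)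
qed

lemma q_pos: "0 < t\<^sup>2 - r\<^sup>2"
  using q_ge t_ge eta by (meson less_le_trans mult_pos_pos zero_less_one)

lemma w_pos: "0 < wt c l t r"
  using wt_pos q_pos t_ge by simp

lemma w2_eq: "w2 t r = w0 t r * (t / (t\<^sup>2 - r\<^sup>2)) powr \<gamma>"
proof -
  define q where "q = t\<^sup>2 - r\<^sup>2"
  have q: "0 < q" and t: "0 < t" using q_pos t_ge by (auto simp: q_def)
  have "(t / q) powr \<gamma> = t powr \<gamma> * q powr (- \<gamma>)"
    using q t by (simp add: powr_divide powr_minus_divide)
  then have "w0 t r * (t / q) powr \<gamma> =
      (t powr (1 - m) * t powr \<gamma>) * (q powr (- (2 - m)) * q powr (- \<gamma>))"
    by (simp add: wt_def q_def[symmetric])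
  also have "\<dots> = t powr (1 - m + \<gamma>) * q powr (- (2 - m) + - \<gamma>)"
    by (simp only: powr_add)
  also have "- (2 - m) + - \<gamma> = - (2 - m + \<gamma>)" by simp
  finally show ?thesis by (simp add: wt_def q_def)
qed

text \<open>The relation \<open>\<gamma> + \<nu> + (2 - m) = \<kappa>\<close> makes the powers of
  \<open>t\<close> and \<open>q\<close> match. So \<open>w1\<close> is far below \<open>w2\<close>
  near the light cone and comparable to it deep inside, the region where the
  \<open>1 / t\<^sup>2\<close> loss from \<open>w1\<close> has to be compensated.\<close>

lemma w1_eq: "w1 t r = w2 t r * ((t\<^sup>2 - r\<^sup>2) / t\<^sup>2) powr \<kappa>"
proof -
  define q where "q = t\<^sup>2 - r\<^sup>2"
  have q: "0 < q" and t: "0 < t" using q_pos t_ge by (auto simp: q_def)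
  have "(q / t\<^sup>2) powr \<kappa> = q powr \<kappa> * t powr (- 2 * \<kappa>)"
    using q t by (simp add: powr_divide powr_minus_divide powr_powr flip: powr_numeral)
  then have "w2 t r * (q / t\<^sup>2) powr \<kappa> =
      (t powr (1 - m + \<gamma>) * t powr (- 2 * \<kappa>)) * (q powr \<kappa> * q powr (- (2 - m + \<gamma>)))"
    by (simp add: wt_def q_def[symmetric])
  also have "\<dots> = t powr (1 - m + \<gamma> + - 2 * \<kappa>) * q powr (\<kappa> + - (2 - m + \<gamma>))"
    by (simp only: powr_add)
  also have "1 - m + \<gamma> + - 2 * \<kappa> = - 1 - \<kappa> - \<nu>" by (simp add: \<gamma>_def)
  also have "\<kappa> + - (2 - m + \<gamma>) = \<nu>" by (simp add: \<gamma>_def)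
  finally show ?thesis by (simp add: wt_def q_def)
qed

lemma w1_le_w2: "w1 t r \<le> w2 t r"
proof -
  have "((t\<^sup>2 - r\<^sup>2) / t\<^sup>2) powr \<kappa> \<le> 1 powr \<kappa>"
    using q_pos t_ge kappa_pos by (intro powr_mono2) auto
  then show ?thesis unfolding w1_eq using w_pos[of "1 - m + \<gamma>" "2 - m + \<gamma>"]
    by (simp add: mult_left_le)
qed

lemma w2_le_w0: "w2 t r \<le> \<eta> powr (- \<gamma>) * w0 t r"
proof -
  have "(t / (t\<^sup>2 - r\<^sup>2)) \<le> 1 / \<eta>" using q_ge q_pos eta by (simp add: field_simps)
  then have "(t / (t\<^sup>2 - r\<^sup>2)) powr \<gamma> \<le> (1 / \<eta>) powr \<gamma>"
    using q_pos t_ge gamma_pos by (intro powr_mono2) auto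
  also have "\<dots> = \<eta> powr (- \<gamma>)" using eta by (simp add: powr_divide powr_minus_divide)
  finally show ?thesis unfolding w2_eq using w_pos[of "1 - m" "2 - m"] by simp
qed

lemma w0_le: "w0 t r \<le> \<eta> powr (m - 2)"
proof -
  have "t powr (1 - m) \<le> t powr 0" using t_ge m_ge by (intro powr_mono) auto
  moreover have "(t\<^sup>2 - r\<^sup>2) powr (m - 2) \<le> \<eta> powr (m - 2)"
    using q_ge eta t_ge m_less by (intro powr_mono2') (auto intro: order_trans[OF _ q_ge])
  ultimately have "w0 t r \<le> 1 * \<eta> powr (m - 2)"
    unfolding wt_def using t_ge by (intro mult_mono) auto
  then show ?thesis by simp
qed

text \<open>On \<open>w0\<close> the nonlinearity equals \<open>t powr (- e) * q powr e\<close>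
  times \<open>w1 / q\<close>, where \<open>e = 1 - \<nu> - (2 - m) * p\<close>. Since
  \<open>\<nu>\<close> was chosen with \<open>e \<le> 0\<close>, inserting
  \<open>q \<ge> \<eta> * t\<close> costs only a constant.\<close>

lemma nonlinearity_le:
  "t powr (m - m * p) * w0 t r powr p \<le> \<eta> powr (1 - \<nu> - (2 - m) * p) * (w1 t r / (t\<^sup>2 - r\<^sup>2))"
proof -
  define q e where "q = t\<^sup>2 - r\<^sup>2" and "e = 1 - \<nu> - (2 - m) * p"
  have q: "0 < q" and t: "0 < t" using q_pos t_ge by (auto simp: q_def)
  have "t powr (m - m * p) * w0 t r powr p = t powr (m - m * p + (1 - m) * p) * q powr (- (2 - m) * p)"
    using q t unfolding wt_def q_def[symmetric] by (simp add: powr_mult powr_powr powr_add)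
  also have "m - m * p + (1 - m) * p = - e + (- 1 - \<kappa> - \<nu>)"
    by (simp add: e_def \<kappa>_def algebra_simps)
  also have "- (2 - m) * p = e + (\<nu> - 1)" by (simp add: e_def algebra_simps)
  also have "t powr (- e + (- 1 - \<kappa> - \<nu>)) * q powr (e + (\<nu> - 1)) =
      t powr (- e) * q powr e * (w1 t r / q)"
    using q t unfolding wt_def q_def[symmetric] powr_add by (simp add: powr_diff)
  also have "\<dots> \<le> t powr (- e) * (\<eta> * t) powr e * (w1 t r / q)"
    using q t w_pos q_ge nu_ge eta
    by (intro mult_right_mono mult_left_mono powr_mono2') (auto simp: e_def q_def less_imp_le)
  also have "\<dots> = \<eta> powr e * (w1 t r / q)"
    using t eta by (simp add: powr_mult powr_minus field_simps)
  finally show ?thesis by (simp add: e_def q_def)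
qed

text \<open>The bracket in \<open>wt_out\<close> is here the convex combination of
  \<open>(t - r) / t\<close> and \<open>(t - r) / (t + r)\<close> with coefficients
  \<open>m - 1\<close> and \<open>2 - m\<close>; both quotients are at least
  \<open>(t - r) / (2 * t)\<close>.\<close>

lemma wt_out0_ge: "w0 t r * ((t - r) / (2 * t)) \<le> wt_out (1 - m) (2 - m) t r"
  and wt_out0_pos: "0 \<le> wt_out (1 - m) (2 - m) t r"
proof -
  have t: "0 < t" "0 < t - r" "0 \<le> r" using t_ge r_ge r_le eta by auto
  have "(t - r) / (2 * t) \<le> (t - r) / (t + r)" using t by (intro divide_left_mono) auto
  moreover have "(t - r) / (2 * t) \<le> (t - r) / t" using t by (intro divide_left_mono) auto
  ultimately have "(m - 1) * ((t - r) / (2 * t)) + (2 - m) * ((t - r) / (2 * t)) \<le>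
      (m - 1) * ((t - r) / t) + (2 - m) * ((t - r) / (t + r))"
    using m_ge m_less by (intro add_mono mult_left_mono) auto
  moreover have "(m - 1) * ((t - r) / t) + (2 - m) * ((t - r) / (t + r)) =
      1 + (1 - m) * r / t - 2 * (2 - m) * r / (t + r)"
    using t by (simp add: field_simps)
  moreover have "(m - 1) * ((t - r) / (2 * t)) + (2 - m) * ((t - r) / (2 * t)) = (t - r) / (2 * t)"
    by (simp only: distrib_right[symmetric]) simp
  ultimately have "(t - r) / (2 * t) \<le> 1 + (1 - m) * r / t - 2 * (2 - m) * r / (t + r)" by simp
  then show *: "w0 t r * ((t - r) / (2 * t)) \<le> wt_out (1 - m) (2 - m) t r"
    unfolding wt_out_def using w_pos by (intro mult_left_mono) (auto intro: less_imp_le)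
  have "0 \<le> w0 t r * ((t - r) / (2 * t))" using t w_pos[of "1 - m" "2 - m"] by simp
  with * show "0 \<le> wt_out (1 - m) (2 - m) t r" by simp
qed

text \<open>Common to both corrections. The outgoing derivative of \<open>w0\<close> has only the
  lower bound with the factor \<open>t - r\<close>, so to be dominated by it a correction needs that
  factor in its bracket, beyond a bound on its weight.\<close>

lemma wt_out_le:
  assumes "c \<le> 0" and br: "1 + c * r / t - 2 * l * r / (t + r) \<le> C * ((t - r) / t)"
    and "0 \<le> C" and w: "wt c l t r \<le> D * w0 t r"
  shows "wt_out c l t r \<le> 2 * D * C * wt_out (1 - m) (2 - m) t r"
proof -
  have t: "0 < t" "0 < t - r" "0 \<le> r" using t_ge r_ge r_le eta by auto
  have "0 < D * w0 t r" using w w_pos[of c l] by linarith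
  then have D: "0 < D" using w_pos[of "1 - m" "2 - m"] by (simp add: zero_less_mult_iff)
  have "wt_out c l t r \<le> wt c l t r * (C * ((t - r) / t))"
    unfolding wt_out_def using br w_pos by (intro mult_left_mono) (auto intro: less_imp_le)
  also have "\<dots> \<le> D * w0 t r * (C * ((t - r) / t))"
    using w \<open>0 \<le> C\<close> t by (intro mult_right_mono) auto
  also have "\<dots> = 2 * D * C * (w0 t r * ((t - r) / (2 * t)))" by simp
  also have "\<dots> \<le> 2 * D * C * wt_out (1 - m) (2 - m) t r"
    using wt_out0_ge D \<open>0 \<le> C\<close> by (intro mult_left_mono) auto
  finally show ?thesis .
qed

lemma wt_out2_le:
  "wt_out (1 - m + \<gamma>) (2 - m + \<gamma>) t r \<le> 2 * \<eta> powr (- \<gamma>) * wt_out (1 - m) (2 - m) t r"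
proof -
  have t: "0 < t" "0 < t - r" "0 \<le> r" using t_ge r_ge r_le eta by auto
  have "(t - r) / (t + r) \<le> (t - r) / t" using t by (intro divide_left_mono) auto
  then have "(m - 1 - \<gamma>) * ((t - r) / t) + (2 - m + \<gamma>) * ((t - r) / (t + r)) \<le>
      (m - 1 - \<gamma>) * ((t - r) / t) + (2 - m + \<gamma>) * ((t - r) / t)"
    using m_less gamma_pos by (intro add_left_mono mult_left_mono) auto
  moreover have "(m - 1 - \<gamma>) * ((t - r) / t) + (2 - m + \<gamma>) * ((t - r) / (t + r)) =
      1 + (1 - m + \<gamma>) * r / t - 2 * (2 - m + \<gamma>) * r / (t + r)"
    using t by (simp add: field_simps)
  moreover have "(m - 1 - \<gamma>) * ((t - r) / t) + (2 - m + \<gamma>) * ((t - r) / t) = 1 * ((t - r) / t)"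
    by (simp only: distrib_right[symmetric]) simp
  ultimately have "1 + (1 - m + \<gamma>) * r / t - 2 * (2 - m + \<gamma>) * r / (t + r) \<le> 1 * ((t - r) / t)"
    by simp
  from wt_out_le[OF _ this _ w2_le_w0] show ?thesis using gamma_less by simp
qed

lemma wt_out1_le:
  "wt_out (- 1 - \<kappa> - \<nu>) (- \<nu>) t r \<le> 2 * \<eta> powr (- \<gamma>) * (1 + \<kappa> + \<nu>) * wt_out (1 - m) (2 - m) t r"
proof -
  have t: "0 < t" "0 < t - r" "0 \<le> r" using t_ge r_ge r_le eta by auto
  \<comment> \<open>In this form the only term without a factor \<open>t - r\<close> is
    \<open>- \<kappa>\<close>, and it has the good sign.\<close>
  have "1 + (- 1 - \<kappa> - \<nu>) * r / t - 2 * (- \<nu>) * r / (t + r) =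
      - \<kappa> + (1 + \<kappa> + \<nu>) * ((t - r) / t) - \<nu> * ((t - r) / (t + r))"
    using t by (simp add: divide_simps) (simp add: algebra_simps)
  moreover have "0 \<le> \<nu> * ((t - r) / (t + r))" using nu_pos t by simp
  ultimately have "1 + (- 1 - \<kappa> - \<nu>) * r / t - 2 * (- \<nu>) * r / (t + r) \<le> (1 + \<kappa> + \<nu>) * ((t - r) / t)"
    using kappa_pos by linarith
  from wt_out_le[OF _ this _ order_trans[OF w1_le_w2 w2_le_w0]] show ?thesis
    using kappa_pos nu_pos by simp
qed

text \<open>This sets the size of \<open>A\<close>: beyond one copy of the outgoing derivative of
  \<open>w0\<close>, it pays \<open>2 * \<eta> powr (- \<gamma>) * (1 + \<kappa> + \<nu>)\<close>
  copies for \<open>w1\<close> and \<open>2 * \<eta> powr (- \<gamma>) * K\<close> for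
  \<open>w2\<close>.\<close>

lemma profile_out_ge:
  "w0 t r * ((t - r) / (2 * t)) \<le> A * wt_out (1 - m) (2 - m) t r
     - wt_out (- 1 - \<kappa> - \<nu>) (- \<nu>) t r - K * wt_out (1 - m + \<gamma>) (2 - m + \<gamma>) t r"
proof -
  define W where "W = wt_out (1 - m) (2 - m) t r"
  have "K * wt_out (1 - m + \<gamma>) (2 - m + \<gamma>) t r \<le> K * (2 * \<eta> powr (- \<gamma>) * W)"
    using wt_out2_le K_pos by (simp add: W_def)
  moreover have "0 \<le> \<eta> powr (- \<gamma>) * W" using wt_out0_pos by (simp add: W_def)
  ultimately show ?thesis
    using wt_out1_le wt_out0_ge unfolding A_def W_def[symmetric] by (simp add: algebra_simps)
qed

lemma profile_ge: "w0 t r \<le> A * w0 t r - w1 t r - K * w2 t r"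
proof -
  have "K * w2 t r \<le> K * (\<eta> powr (- \<gamma>) * w0 t r)" using w2_le_w0 K_pos by simp
  moreover have "0 < \<eta> powr (- \<gamma>) * w0 t r * K" "0 < \<eta> powr (- \<gamma>) * w0 t r * (2 + \<kappa> + \<nu>)"
    "0 < \<eta> powr (- \<gamma>) * w0 t r * (1 + \<kappa> + \<nu>)"
    using w_pos eta K_pos kappa_pos nu_pos by (auto intro!: mult_pos_pos)
  ultimately show ?thesis
    using w1_le_w2 w2_le_w0 unfolding A_def by (simp add: algebra_simps)
qed

lemma profile_le: "A * w0 t r - w1 t r - K * w2 t r \<le> A * w0 t r"
  using w_pos[of "- 1 - \<kappa> - \<nu>" "- \<nu>"] w_pos[of "1 - m + \<gamma>" "2 - m + \<gamma>"] K_pos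
  by (smt (verit) mult_pos_pos)

text \<open>\<open>w0\<close> reproduces the linear term exactly. The loss \<open>(1 + \<kappa> +
  \<nu>) * (2 + \<kappa> + \<nu>) * r * w1 / t\<^sup>2\<close> is covered by \<open>K\<close> times
  the defect \<open>\<gamma> * (2 * m - 1 - \<gamma>)\<close> of \<open>w2\<close>, so the gain at
  the light cone survives in full for the nonlinearity.\<close>

lemma profile_box_ge:
  "m * (m - 1) * r * (A * w0 t r - w1 t r - K * w2 t r) / t\<^sup>2 + 4 * \<kappa> * \<nu> * r * (w1 t r / (t\<^sup>2 - r\<^sup>2))
    \<le> A * wt_box (1 - m) (2 - m) t r - wt_box (- 1 - \<kappa> - \<nu>) (- \<nu>) t r
      - K * wt_box (1 - m + \<gamma>) (2 - m + \<gamma>) t r"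
proof -
  define q where "q = t\<^sup>2 - r\<^sup>2"
  have b0: "wt_box (1 - m) (2 - m) t r = m * (m - 1) * r * w0 t r / t\<^sup>2"
    by (simp add: wt_box_def algebra_simps)
  have "(1 - m + \<gamma>) * (1 - m + \<gamma> - 1) = m * (m - 1) - \<gamma> * (2 * m - 1 - \<gamma>)"
    by (simp add: algebra_simps)
  then have b2: "wt_box (1 - m + \<gamma>) (2 - m + \<gamma>) t r =
      (m * (m - 1) - \<gamma> * (2 * m - 1 - \<gamma>)) * (r * w2 t r / t\<^sup>2)"
    by (simp add: wt_box_def)
  have b1: "wt_box (- 1 - \<kappa> - \<nu>) (- \<nu>) t r =
      - (4 * \<kappa> * \<nu> * r * (w1 t r / q)) + (1 + \<kappa> + \<nu>) * (2 + \<kappa> + \<nu>) * (r * w1 t r / t\<^sup>2)"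
    using q_pos t_ge unfolding wt_box_def q_def[symmetric] by (simp add: divide_simps) (simp add: algebra_simps)
  have g: "0 < \<gamma> * (2 * m - 1 - \<gamma>)" using gamma_pos gamma_less m_ge by simp
  have "(1 + \<kappa> + \<nu>) * (2 + \<kappa> + \<nu>) * (r * w1 t r / t\<^sup>2) \<le> (1 + \<kappa> + \<nu>) * (2 + \<kappa> + \<nu>) * (r * w2 t r / t\<^sup>2)"
    using w1_le_w2 r_ge kappa_pos nu_pos t_ge by (intro mult_left_mono divide_right_mono) auto
  also have "\<dots> = K * (\<gamma> * (2 * m - 1 - \<gamma>)) * (r * w2 t r / t\<^sup>2)"
    unfolding K_def using g by (simp only: nonzero_eq_divide_eq[OF less_imp_neq[OF g, symmetric], THEN iffD1, OF refl])
  finally have "(1 + \<kappa> + \<nu>) * (2 + \<kappa> + \<nu>) * (r * w1 t r / t\<^sup>2) \<le> K * (\<gamma> * (2 * m - 1 - \<gamma>)) * (r * w2 t r / t\<^sup>2)" .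
  moreover have "0 \<le> m * (m - 1) * (r * w1 t r / t\<^sup>2)"
    using m_ge r_ge w_pos[of "- 1 - \<kappa> - \<nu>" "- \<nu>"] by simp
  \<comment> \<open>The large expressions are abstracted into letters: \<open>S\<close> is
    \<open>m * (m - 1)\<close>, \<open>C\<close> the coefficient of the loss, \<open>G\<close> the
    defect of \<open>w2\<close>, \<open>X\<close> the gain, and \<open>a\<close>, \<open>x\<close>,
    \<open>y\<close> are the weights times \<open>r / t\<^sup>2\<close>, with \<open>A\<close>
    included in \<open>a\<close>.\<close>
  moreover have "S * (a - x - K * y) + X \<le> A * (S * (a / A)) - (- X + C * x) - K * ((S - G) * y)"
    if "C * x \<le> K * G * y" "0 \<le> S * x" for S G C X a x y
    using that A_pos by (simp add: algebra_simps)
  ultimately have "m * (m - 1) * (A * (r * w0 t r / t\<^sup>2) - r * w1 t r / t\<^sup>2 - K * (r * w2 t r / t\<^sup>2))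
      + 4 * \<kappa> * \<nu> * r * (w1 t r / q)
    \<le> A * (m * (m - 1) * (A * (r * w0 t r / t\<^sup>2) / A)) - wt_box (- 1 - \<kappa> - \<nu>) (- \<nu>) t r
      - K * wt_box (1 - m + \<gamma>) (2 - m + \<gamma>) t r"
    unfolding b1 b2 by blast
  then show ?thesis
    using A_pos unfolding b0 q_def[symmetric] by (simp add: algebra_simps diff_divide_distrib add_divide_distrib)
qed

end

end

section \<open>The Duhamel operator\<close>

lemma abs_powr_has_real_derivative:
  assumes p: "1 < p"
  shows "((\<lambda>x. \<bar>x\<bar> powr p) has_real_derivative p * \<bar>x\<bar> powr (p - 1) * sgn x) (at x)"
proof -
  consider "x > 0" | "x < 0" | "x = 0" by linarith
  then show ?thesis
  proof cases
    case 1
    have "((\<lambda>x. x powr p) has_real_derivative p * x powr (p - 1) * sgn x) (at x)"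
      using 1 by (auto intro!: derivative_eq_intros simp: powr_diff)
    then have "((\<lambda>x. \<bar>x\<bar> powr p) has_real_derivative p * x powr (p - 1) * sgn x) (at x)"
      by (rule has_field_derivative_transform_within_open[of _ _ _ "{0<..}"]) (use 1 in auto)
    then show ?thesis using 1 by simp
  next
    case 2
    have "((\<lambda>x. (- x) powr p) has_real_derivative p * (- x) powr (p - 1) * sgn x) (at x)"
      using 2 by (auto intro!: derivative_eq_intros simp: powr_diff)
    then have "((\<lambda>x. \<bar>x\<bar> powr p) has_real_derivative p * (- x) powr (p - 1) * sgn x) (at x)"
      by (rule has_field_derivative_transform_within_open[of _ _ _ "{..<0}"]) (use 2 in auto)
    then show ?thesis using 2 by simp
  next
    case 3
    have "(\<lambda>h. \<bar>h\<bar> powr (p - 1)) \<midarrow>0\<rightarrow> \<bar>0\<bar> powr (p - 1)"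
      using p by (intro tendsto_intros) auto
    then have "(\<lambda>h. \<bar>h\<bar> powr (p - 1)) \<midarrow>0\<rightarrow> 0" by simp
    then have "(\<lambda>h. \<bar>h\<bar> powr p / h) \<midarrow>0\<rightarrow> 0"
      by (rule Lim_null_comparison[rotated])
         (auto simp: eventually_at powr_diff intro!: exI[of _ 1])
    then show ?thesis using 3 by (simp add: DERIV_def)
  qed
qed

lemma abs_powr_lipschitz:
  fixes a b M p :: real
  assumes p: "1 < p" and "\<bar>a\<bar> \<le> M" "\<bar>b\<bar> \<le> M"
  shows "\<bar>\<bar>a\<bar> powr p - \<bar>b\<bar> powr p\<bar> \<le> p * M powr (p - 1) * \<bar>a - b\<bar>"
proof -
  have "norm (\<bar>a\<bar> powr p - \<bar>b\<bar> powr p) \<le> p * M powr (p - 1) * norm (a - b)"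
  proof (rule field_differentiable_bound[of "{-M..M}"])
    show "((\<lambda>x. \<bar>x\<bar> powr p) has_field_derivative p * \<bar>x\<bar> powr (p - 1) * sgn x) (at x within {-M..M})" for x
      by (rule DERIV_subset[OF abs_powr_has_real_derivative[OF p]]) auto
    show "norm (p * \<bar>x\<bar> powr (p - 1) * sgn x) \<le> p * M powr (p - 1)" if "x \<in> {-M..M}" for x
    proof -
      have "\<bar>x\<bar> powr (p - 1) \<le> M powr (p - 1)" using that p by (intro powr_mono2) auto
      then show ?thesis using p by (auto simp: abs_mult sgn_if)
    qed
  qed (use assms in auto)
  then show ?thesis by simp
qed

lemma mean_odd:
  assumes odd: "\<And>y. h (- y) = - h y"
  shows "mean t r (\<lambda>y. h (y - t)) = 0"
proof -
  have "integral {- 1..1} (\<lambda>\<theta>. h (- \<theta> * r)) = integral {-1..1} (\<lambda>\<theta>. h (\<theta> * r))"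
    using Henstock_Kurzweil_Integration.integral_reflect_real[of 1 "-1" "\<lambda>\<theta>. h (\<theta> * r)"] by simp
  then show ?thesis by (simp add: mean_def odd)
qed

text \<open>The moving endpoints give the two boundary terms. The change of \<open>Q\<close> in
  \<open>t\<close> contributes the integral of \<open>G t (y - t)\<close> over an interval symmetric
  about \<open>t\<close>, which vanishes by oddness. In particular
  \<open>V\<^sub>t + V\<^sub>r = Q t (t + r)\<close>, as the interpretation of \<open>P\<close>
  demands.\<close>

lemma spherical_mean_has_derivative:
  assumes Q: "continuous_on UNIV (\<lambda>(t, y). Q t y)" and G: "continuous_on UNIV (\<lambda>(t, y). G t y)"
    and odd: "\<And>t y. G t (- y) = - G t y"
    and dQ: "\<And>t y. ((\<lambda>t. Q t y) has_real_derivative G t (y - t)) (at t)"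
  shows "((\<lambda>(t, r). r * mean t r (Q t)) has_derivative
     (\<lambda>(dt, dr). (Q t (t + r) - Q t (t - r)) / 2 * dt + (Q t (t + r) + Q t (t - r)) / 2 * dr)) (at (t, r))"
proof -
  have Qc: "continuous_on UNIV (Q t)" for t
    by (rule continuous_on_section[OF Q])
  have Gc: "continuous_on UNIV (\<lambda>y. G t (y - t))" for t
    by (rule continuous_on_case_prod_compose[OF G]) (auto intro!: continuous_intros)
  have J: "((\<lambda>(x, t). sint 0 x (\<lambda>y. Q t y)) has_derivative
     (\<lambda>(dx, dt). Q t x * dx + sint 0 x (\<lambda>y. G t (y - t)) * dt)) (at (x, t))" for x t
    by (rule sint_has_derivative)
       (auto simp: case_prod_unfold intro!: dQ continuous_on_case_prod_compose[OF Q]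
          continuous_on_case_prod_compose[OF G] continuous_intros)
  have J1: "((\<lambda>z. sint 0 (fst z + c * snd z) (Q (fst z))) has_derivative
     (\<lambda>(dt, dr). Q t (t + c * r) * (dt + c * dr) + sint 0 (t + c * r) (\<lambda>y. G t (y - t)) * dt)) (at (t, r))" for c
  proof -
    have "((\<lambda>z. (fst z + c * snd z, fst z)) has_derivative (\<lambda>z. (fst z + c * snd z, fst z))) (at (t, r))"
      by (auto intro!: derivative_eq_intros)
    from has_derivative_compose[OF this, of "\<lambda>(x, t). sint 0 x (\<lambda>y. Q t y)"
        "\<lambda>(dx, dt). Q t (t + c * r) * dx + sint 0 (t + c * r) (\<lambda>y. G t (y - t)) * dt"] J
    show ?thesis by (simp add: case_prod_unfold)
  qed
  have zero: "sint 0 (t + r) (\<lambda>y. G t (y - t)) - sint 0 (t - r) (\<lambda>y. G t (y - t)) = 0"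
    using mean_eq_sint[OF Gc, of r t t] mean_odd[of "G t" t r] odd by simp
  have "((\<lambda>z. (sint 0 (fst z + snd z) (Q (fst z)) - sint 0 (fst z - snd z) (Q (fst z))) / 2) has_derivative
     (\<lambda>(dt, dr). (Q t (t + r) * (dt + dr) + sint 0 (t + r) (\<lambda>y. G t (y - t)) * dt
        - (Q t (t - r) * (dt - dr) + sint 0 (t - r) (\<lambda>y. G t (y - t)) * dt)) / 2)) (at (t, r))"
    using bounded_linear.has_derivative[OF bounded_linear_divide[of 2] has_derivative_diff[OF J1[of 1] J1[of "-1"]]]
    by (simp add: case_prod_unfold)
  moreover have "(Q t (t + r) * (dt + dr) + sint 0 (t + r) (\<lambda>y. G t (y - t)) * dt
        - (Q t (t - r) * (dt - dr) + sint 0 (t - r) (\<lambda>y. G t (y - t)) * dt)) / 2 =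
      (Q t (t + r) - Q t (t - r)) / 2 * dt + (Q t (t + r) + Q t (t - r)) / 2 * dr" for dt dr
  proof -
    have "sint 0 (t + r) (\<lambda>y. G t (y - t)) = sint 0 (t - r) (\<lambda>y. G t (y - t))" using zero by simp
    then show ?thesis by (simp add: field_simps)
  qed
  ultimately show ?thesis
    by (simp add: mean_eq_sint[OF Qc] case_prod_unfold)
qed

text \<open>\<open>P0\<close> is \<open>P\<close> at time one, as a function of
  \<open>y = 1 + r\<close>; the condition on its mean says that \<open>V\<close> vanishes initially
  from radius \<open>1 - \<eta>\<close> on. \<open>delta_powr\<close> lets the gain of the barrier
  absorb the nonlinearity, and \<open>delta_le\<close> keeps the barrier below one.\<close>

locale cauchy_problem = damping +
  fixes \<delta> :: real and P0 P0' :: "real \<Rightarrow> real"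
  assumes delta_pos: "0 < \<delta>"
    and delta_powr: "(\<delta> * A) powr p * \<eta> powr (1 - \<nu> - (2 - m) * p) \<le> 4 * \<kappa> * \<nu> * \<delta>"
    and delta_le: "\<delta> * A * \<eta> powr (m - 2) \<le> 1"
    and P0_deriv: "\<And>y. (P0 has_real_derivative P0' y) (at y)"
    and P0'_cont: "continuous_on UNIV P0'"
    and P0_supp: "\<And>y. 1 - \<eta> \<le> \<bar>y - 1\<bar> \<Longrightarrow> P0 y = 0"
    and P0_bound: "\<And>y. \<bar>P0 y\<bar> \<le> \<delta> * \<eta> / 2"
    and mean_P0_supp: "\<And>r. 1 - \<eta> \<le> r \<Longrightarrow> mean 1 r P0 = 0"
begin

lemma P0_cont: "continuous_on UNIV P0"
  by (rule DERIV_continuous_on[OF DERIV_subset[OF P0_deriv]]) auto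

text \<open>Freezing the coefficients and the unknown at \<open>t = 1\<close> for earlier times makes all functions
  differentiable on the whole plane, so that no one-sided derivatives are needed.\<close>

definition "clock s = max 1 (s::real)"

lemma clock_ge: "1 \<le> clock s" and clock_eq: "1 \<le> s \<Longrightarrow> clock s = s"
  by (auto simp: clock_def)

lemma continuous_on_clock [continuous_intros]: "continuous_on X f \<Longrightarrow> continuous_on X (\<lambda>x. clock (f x))"
  unfolding clock_def by (intro continuous_intros)

text \<open>With \<open>V = r * W\<close> the source is \<open>r\<close> times a function of
  \<open>t\<close> and \<open>W\<close> alone, namely \<open>N\<close>. The last argument of
  \<open>F\<close> is the radius, that of \<open>duhamel\<close> the characteristic coordinate
  \<open>t + r\<close>; hence \<open>F P s (y - s)\<close>.\<close>

definition "N s w = m * (m - 1) * w / (clock s)\<^sup>2 + clock s powr (m - m * p) * \<bar>w\<bar> powr p"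
definition "F P s y = y * N s (mean (clock s) y (P (clock s)))"
definition "duhamel P t y = P0 y + sint 1 t (\<lambda>s. F P s (y - s))"
text \<open>A bound for \<open>V / r\<close>, so \<open>\<Phi> / r\<close> inside the cone. The
  value zero beyond \<open>r = t - \<eta>\<close> builds finite propagation speed into the invariant
  set.\<close>

definition "barrier t r = (if r \<le> t - \<eta> then \<delta> * (A * w0 t r - w1 t r - K * w2 t r) else 0)"
definition "barrier_out t r = \<delta> * (A * wt_out (1 - m) (2 - m) t r
     - wt_out (- 1 - \<kappa> - \<nu>) (- \<nu>) t r - K * wt_out (1 - m + \<gamma>) (2 - m + \<gamma>) t r)"
definition "barrier_box t r = \<delta> * (A * wt_box (1 - m) (2 - m) t r
     - wt_box (- 1 - \<kappa> - \<nu>) (- \<nu>) t r - K * wt_box (1 - m + \<gamma>) (2 - m + \<gamma>) t r)"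
definition "subbarrier P \<longleftrightarrow> continuous_on UNIV (\<lambda>(t, y). P t y) \<and>
   (\<forall>t\<ge>1. \<forall>r>0. \<bar>mean t r (P t)\<bar> \<le> barrier t r)"

lemma continuous_on_N:
  assumes "continuous_on X a" "continuous_on X b"
  shows "continuous_on X (\<lambda>x. N (a x) (b x))"
proof -
  have c: "clock s \<noteq> 0" for s using clock_ge[of s] by auto
  show ?thesis unfolding N_def
    by (intro continuous_intros continuous_on_powr' assms ballI) (use c p_gt in \<open>auto simp: less_imp_le[OF less_le_trans[OF zero_less_one clock_ge]]\<close>)
qed

lemma continuous_on_F:
  assumes P: "continuous_on UNIV (\<lambda>(t, y). P t y)" and "continuous_on X a" "continuous_on X b"
  shows "continuous_on X (\<lambda>x. F P (a x) (b x))"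
  unfolding F_def
  by (intro continuous_intros continuous_on_N assms
      continuous_on_case_prod_compose[OF continuous_on_mean[OF P]])

lemma F_odd: "continuous_on UNIV (\<lambda>(t, y). P t y) \<Longrightarrow> F P s (- y) = - F P s y"
  unfolding F_def by (simp add: mean_minus[OF continuous_on_section])

section \<open>Size and supersolution property of the barrier\<close>

lemma barrier_nonneg: "1 \<le> t \<Longrightarrow> 0 \<le> r \<Longrightarrow> 0 \<le> barrier t r"
  using profile_ge[of t r] w_pos[of t r "1 - m" "2 - m"] delta_pos
  by (auto simp: barrier_def in_cone_def)

lemma barrier_ge: "in_cone t r \<Longrightarrow> \<delta> * w0 t r \<le> barrier t r"
  using profile_ge[of t r] delta_pos by (auto simp: barrier_def in_cone_def)

lemma barrier_le: "in_cone t r \<Longrightarrow> barrier t r \<le> \<delta> * A * w0 t r"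
  using profile_le[of t r] delta_pos by (auto simp: barrier_def in_cone_def mult.assoc)

lemma barrier_le_1:
  assumes "1 \<le> t" "0 \<le> r" shows "barrier t r \<le> 1"
proof (cases "in_cone t r")
  case True
  have "barrier t r \<le> \<delta> * A * \<eta> powr (m - 2)"
    using barrier_le[OF True] w0_le[OF True] delta_pos A_pos
    by (smt (verit) mult_left_mono mult_pos_pos)
  then show ?thesis using delta_le by linarith
next
  case False
  then show ?thesis using assms by (auto simp: barrier_def in_cone_def)
qed

text \<open>The supersolution inequality. The linear part of \<open>N\<close> is the first term in
  \<open>profile_box_ge\<close>. The nonlinear part carries the factor
  \<open>(\<delta> * A) powr p\<close>, which \<open>delta_powr\<close> makes smaller than the gain,
  linear in \<open>\<delta>\<close>.\<close>

lemma barrier_box_ge: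
  assumes c: "in_cone t r"
  shows "r * N t (barrier t r) \<le> barrier_box t r"
proof -
  define q w where "q = t\<^sup>2 - r\<^sup>2" and "w = barrier t r"
  have t: "1 \<le> t" "0 \<le> r" using c by (auto simp: in_cone_def)
  have w: "0 \<le> w" unfolding w_def by (rule barrier_nonneg[OF t])
  have "w powr p \<le> (\<delta> * A * w0 t r) powr p"
    using barrier_le[OF c] w p_gt by (intro powr_mono2) (auto simp: w_def)
  also have "\<dots> = (\<delta> * A) powr p * w0 t r powr p"
    using delta_pos A_pos w_pos[OF c, of "1 - m" "2 - m"] by (simp add: powr_mult)
  finally have "t powr (m - m * p) * w powr p \<le> (\<delta> * A) powr p * (t powr (m - m * p) * w0 t r powr p)"
    using t by (simp add: mult.left_commute mult_left_mono)
  also have "\<dots> \<le> (\<delta> * A) powr p * (\<eta> powr (1 - \<nu> - (2 - m) * p) * (w1 t r / q))"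
    using nonlinearity_le[OF c] by (intro mult_left_mono) (auto simp: q_def)
  also have "\<dots> = ((\<delta> * A) powr p * \<eta> powr (1 - \<nu> - (2 - m) * p)) * (w1 t r / q)" by simp
  also have "\<dots> \<le> (4 * \<kappa> * \<nu> * \<delta>) * (w1 t r / q)"
    using delta_powr w_pos[OF c] q_pos[OF c] by (intro mult_right_mono) (auto simp: q_def less_imp_le)
  finally have "r * (t powr (m - m * p) * w powr p) \<le> r * (4 * \<kappa> * \<nu> * \<delta> * (w1 t r / q))"
    using t by (intro mult_left_mono)
  moreover have "m * (m - 1) * r * w / t\<^sup>2 + \<delta> * (4 * \<kappa> * \<nu> * r * (w1 t r / q)) \<le> barrier_box t r"
    using mult_left_mono[OF profile_box_ge[OF c], of \<delta>] delta_pos c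
    unfolding barrier_box_def w_def barrier_def q_def
    by (simp add: distrib_left in_cone_def ac_simps)
  ultimately show ?thesis
    using t w unfolding N_def w_def[symmetric] clock_eq[OF t(1)] by (simp add: distrib_left ac_simps)
qed

lemma barrier_out_ge:
  assumes c: "in_cone t r"
  shows "\<delta> * (w0 t r * ((t - r) / (2 * t))) \<le> barrier_out t r"
  unfolding barrier_out_def using profile_out_ge[OF c] delta_pos by (intro mult_left_mono) auto

lemma barrier_out_nonneg:
  assumes c: "in_cone t r"
  shows "0 \<le> barrier_out t r"
  using barrier_out_ge[OF c] w_pos[OF c, of "1 - m" "2 - m"] delta_pos c eta
  by (intro order_trans[OF _ barrier_out_ge[OF c]] mult_nonneg_nonneg divide_nonneg_pos) (auto simp: in_cone_def)

lemma w0_initial: assumes "in_cone 1 r" shows "1 \<le> w0 1 r"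
proof -
  have q: "0 < 1 - r\<^sup>2" "1 - r\<^sup>2 \<le> 1" using q_pos[OF assms] by auto
  have "1 powr (m - 2) \<le> (1 - r\<^sup>2) powr (m - 2)"
    by (rule powr_mono2') (use q m_less in auto)
  then show ?thesis by (simp add: wt_def)
qed

lemma N_mono:
  assumes "\<bar>w\<bar> \<le> v"
  shows "\<bar>N s w\<bar> \<le> N s v"
proof -
  have 1: "\<bar>w\<bar> powr p \<le> \<bar>v\<bar> powr p" using assms p_gt by (intro powr_mono2) auto
  have "\<bar>m * (m - 1) * w / (clock s)\<^sup>2\<bar> = m * (m - 1) * \<bar>w\<bar> / (clock s)\<^sup>2"
    using m_ge by (simp add: abs_mult)
  also have "\<dots> \<le> m * (m - 1) * v / (clock s)\<^sup>2"
    using assms m_ge by (intro divide_right_mono mult_left_mono) auto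
  finally have 2: "\<bar>m * (m - 1) * w / (clock s)\<^sup>2\<bar> \<le> m * (m - 1) * v / (clock s)\<^sup>2" .
  have "\<bar>clock s powr (m - m * p) * \<bar>w\<bar> powr p\<bar> \<le> clock s powr (m - m * p) * \<bar>v\<bar> powr p"
    using 1 by (simp add: abs_mult mult_left_mono)
  with 2 show ?thesis unfolding N_def by linarith
qed

section \<open>Invariance of the barrier under the Duhamel operator\<close>

lemma F_bound:
  assumes P: "subbarrier P" and s: "1 \<le> s" and y: "0 < y"
  shows F_le: "in_cone s y \<Longrightarrow> \<bar>F P s y\<bar> \<le> barrier_box s y"
    and F_zero: "s - \<eta> < y \<Longrightarrow> F P s y = 0"
proof -
  have b: "\<bar>mean s y (P s)\<bar> \<le> barrier s y" using assms by (auto simp: subbarrier_def)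
  have "\<bar>F P s y\<bar> = y * \<bar>N s (mean s y (P s))\<bar>" using y by (simp add: F_def abs_mult clock_eq[OF s])
  also have "\<dots> \<le> y * N s (barrier s y)" using N_mono[OF b] y by simp
  finally have *: "\<bar>F P s y\<bar> \<le> y * N s (barrier s y)" .
  show "\<bar>F P s y\<bar> \<le> barrier_box s y" if "in_cone s y"
    using * barrier_box_ge[OF that] by linarith
  show "F P s y = 0" if "s - \<eta> < y"
  proof -
    have "barrier s y = 0" using that by (simp add: barrier_def)
    then show ?thesis using * p_gt by (simp add: N_def)
  qed
qed

lemma duhamel_props:
  assumes P: "continuous_on UNIV (\<lambda>(t, y). P t y)"
  shows duhamel_deriv: "((\<lambda>t. duhamel P t y) has_real_derivative F P t (y - t)) (at t)"
    and duhamel_cont: "continuous_on UNIV (\<lambda>(t, y). duhamel P t y)"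
    and duhamel_1: "duhamel P 1 = P0"
proof -
  show "((\<lambda>t. duhamel P t y) has_real_derivative F P t (y - t)) (at t)"
    unfolding duhamel_def
    by (auto intro!: derivative_eq_intros sint_has_real_derivative continuous_on_F[OF P] continuous_intros)
  have "continuous_on UNIV (\<lambda>(t, y). sint 1 t (\<lambda>s. F P s (y - s)))"
    by (rule continuous_on_sint) (auto simp: case_prod_unfold intro!: continuous_on_F[OF P] continuous_intros)
  then show "continuous_on UNIV (\<lambda>(t, y). duhamel P t y)"
    unfolding duhamel_def case_prod_unfold
    by (intro continuous_intros continuous_on_compose2[OF P0_cont]) auto
  show "duhamel P 1 = P0" by (simp add: duhamel_def fun_eq_iff)
qed

lemma wave_has_derivative:
  assumes P: "continuous_on UNIV (\<lambda>(t, y). P t y)"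
  shows "((\<lambda>(t, r). r * mean t r (duhamel P t)) has_derivative
     (\<lambda>(dt, dr). (duhamel P t (t + r) - duhamel P t (t - r)) / 2 * dt
        + (duhamel P t (t + r) + duhamel P t (t - r)) / 2 * dr)) (at (t, r))"
  by (rule spherical_mean_has_derivative[where G = "F P"])
     (auto simp: case_prod_unfold F_odd[OF P] intro!: duhamel_cont[OF P, unfolded case_prod_unfold]
        duhamel_deriv[OF P] continuous_on_F[OF P] continuous_intros)

text \<open>On the incoming line ending at \<open>(s, a - s)\<close> every earlier time
  \<open>s'\<close> has \<open>a - s' > s' - \<eta>\<close>, so the line is still beyond the cone
  and the source vanishes on it.\<close>

lemma duhamel_outside:
  assumes P: "subbarrier P" and s: "1 \<le> s" "2 * s \<le> a + \<eta>"
  shows "duhamel P s a = P0 a"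
proof -
  have Pc: "continuous_on UNIV (\<lambda>(t, y). P t y)" using P by (simp add: subbarrier_def)
  have "\<bar>duhamel P s a - P0 a\<bar> \<le> 0"
  proof (rule abs_le_along[of 1 s "\<lambda>s. duhamel P s a - P0 a" "\<lambda>_. 0" "\<lambda>s. F P s (a - s)" "\<lambda>_. 0"])
    show "continuous_on {1..s} (\<lambda>s. duhamel P s a - P0 a)"
      by (intro continuous_intros continuous_on_case_prod_compose[OF duhamel_cont[OF Pc]])
    show "((\<lambda>s. duhamel P s a - P0 a) has_real_derivative F P s (a - s)) (at s)" for s
      using duhamel_deriv[OF Pc] by (auto intro!: derivative_eq_intros)
    show "\<bar>F P s' (a - s')\<bar> \<le> 0" if "1 < s'" "s' < s" for s'
      using F_zero[OF P, of s' "a - s'"] that s eta by simp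
  qed (use s duhamel_1[OF Pc] in auto)
  then show ?thesis by simp
qed

lemma duhamel_zero:
  assumes P: "subbarrier P" and "1 \<le> t" and "t - \<eta> < r"
  shows "duhamel P t (t + r) = 0"
proof -
  have "duhamel P t (t + r) = P0 (t + r)" by (rule duhamel_outside[OF P]) (use assms in auto)
  then show ?thesis using P0_supp[of "t + r"] assms by simp
qed

lemma barrier_out_deriv:
  assumes "in_cone t (a - t)"
  shows "((\<lambda>s. barrier_out s (a - s)) has_real_derivative barrier_box t (a - t)) (at t)"
proof -
  have "0 < t" "0 \<le> a - t" "0 < 2 * t - a" using assms eta by (auto simp: in_cone_def)
  then show ?thesis
    unfolding barrier_out_def barrier_box_def
    by (intro DERIV_cmult DERIV_diff wt_backward_deriv)
qed

lemma duhamel_le_barrier_out: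
  assumes P: "subbarrier P" and c: "in_cone t r" and r: "0 < r"
  shows "\<bar>duhamel P t (t + r)\<bar> \<le> barrier_out t r"
proof -
  have Pc: "continuous_on UNIV (\<lambda>(t, y). P t y)" using P by (simp add: subbarrier_def)
  \<comment> \<open>\<open>b\<close> is the time at which the incoming line enters
    \<open>r \<le> t - \<eta>\<close>, or one if it starts inside.\<close>
  define a b where "a = t + r" and "b = max 1 ((a + \<eta>) / 2)"
  have b: "1 \<le> b" "b \<le> t" "a + \<eta> \<le> 2 * b" using c by (auto simp: in_cone_def a_def b_def max_def)
  have cone: "in_cone s (a - s)" if "b \<le> s" "s \<le> t" for s
    using that b r by (auto simp: in_cone_def a_def)
  have "\<bar>duhamel P t a\<bar> \<le> barrier_out t (a - t)"
  proof (rule abs_le_along[of b t "\<lambda>s. duhamel P s a" "\<lambda>s. barrier_out s (a - s)" "\<lambda>s. F P s (a - s)"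
        "\<lambda>s. barrier_box s (a - s)"])
    show "b \<le> t" by fact
    show "continuous_on {b..t} (\<lambda>s. duhamel P s a)"
      by (intro continuous_intros continuous_on_case_prod_compose[OF duhamel_cont[OF Pc]])
    show "continuous_on {b..t} (\<lambda>s. barrier_out s (a - s))"
      by (rule DERIV_continuous_on[OF DERIV_subset[OF barrier_out_deriv[OF cone]]]) auto
    fix s assume s: "b < s" "s < t"
    show "((\<lambda>s. duhamel P s a) has_real_derivative F P s (a - s)) (at s)"
      by (rule duhamel_deriv[OF Pc])
    show "((\<lambda>s. barrier_out s (a - s)) has_real_derivative barrier_box s (a - s)) (at s)"
      by (rule barrier_out_deriv[OF cone]) (use s in auto)
    show "\<bar>F P s (a - s)\<bar> \<le> barrier_box s (a - s)"
      by (rule F_le[OF P]) (use s b r cone in \<open>auto simp: a_def\<close>)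
  next
    show "\<bar>duhamel P b a\<bar> \<le> barrier_out b (a - b)"
    proof (cases "2 < a + \<eta>")
      case True
      then have "2 * b = a + \<eta>" by (simp add: b_def)
      then have "duhamel P b a = P0 a" using duhamel_outside[OF P b(1)] by simp
      also have "P0 a = 0" using True by (intro P0_supp) auto
      finally show ?thesis using barrier_out_nonneg[OF cone] b by simp
    next
      case False
      then have b1: "b = 1" by (simp add: b_def)
      have ci: "in_cone 1 (a - 1)" using cone[of 1] b b1 by simp
      \<comment> \<open>At time one inside the cone, \<open>1 - r \<ge> \<eta>\<close> and
        \<open>w0 \<ge> 1\<close>, so the outgoing barrier is at least
        \<open>\<delta> * \<eta> / 2\<close>. This is the origin of the bound imposed on
        \<open>P0\<close>.\<close>
      have "1 * \<eta> \<le> w0 1 (a - 1) * (1 - (a - 1))"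
        using w0_initial[OF ci] False eta by (intro mult_mono) auto
      then have "\<delta> * \<eta> / 2 \<le> \<delta> * (w0 1 (a - 1) * ((1 - (a - 1)) / (2 * 1)))" using delta_pos by simp
      then show ?thesis
        using P0_bound[of a] barrier_out_ge[OF ci] duhamel_1[OF Pc] unfolding b1 by simp
    qed
  qed
  then show ?thesis by (simp add: a_def)
qed

lemma mean_P0_le:
  assumes "0 \<le> r" shows "\<bar>mean 1 r P0\<bar> \<le> \<delta>"
proof -
  have "\<bar>mean 1 r P0\<bar> \<le> \<delta> * \<eta> / 2" by (rule abs_mean_le[OF P0_cont P0_bound])
  also have "\<dots> \<le> \<delta>" using delta_pos eta by (simp add: field_simps)
  finally show ?thesis .
qed

text \<open>Along an outgoing line the derivative of \<open>V\<close> is \<open>P\<close>, so the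
  bound for \<open>P\<close> obtained on incoming lines integrates to one for
  \<open>V\<close>.\<close>

lemma subbarrier_duhamel:
  assumes P: "subbarrier P"
  shows "subbarrier (duhamel P)"
proof -
  have Pc: "continuous_on UNIV (\<lambda>(t, y). P t y)" using P by (simp add: subbarrier_def)
  define V where "V t r = r * mean t r (duhamel P t)" for t r
  have V: "((\<lambda>s. V s (s - b)) has_real_derivative duhamel P t (t + (t - b))) (at t)" for t b
  proof -
    have "((\<lambda>s. (s, s - b)) has_derivative (\<lambda>h. (h, h))) (at t)"
      by (auto intro!: derivative_eq_intros)
    from has_derivative_compose[OF this wave_has_derivative[OF Pc]]
    show ?thesis by (auto simp: V_def has_field_derivative_def field_simps fun_eq_iff elim!: has_derivative_eq_rhs)
  qed
  have "\<bar>V t r\<bar> \<le> r * barrier t r" if t: "1 \<le> t" and r: "0 < r" for t r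
  proof -
    \<comment> \<open>The outgoing line is \<open>r = s - b\<close>. At \<open>s1\<close> it starts
      either on the axis, where \<open>V = 0\<close>, or on the initial line.\<close>
    define b s1 where "b = t - r" and "s1 = max 1 b"
    have s1: "1 \<le> s1" "b \<le> s1" "s1 \<le> t" using t r by (auto simp: s1_def b_def)
    have cont: "continuous_on {s1..t} (\<lambda>s. V s (s - b))"
      by (rule DERIV_continuous_on[OF DERIV_subset[OF V]]) auto
    have init: "V 1 r' = r' * mean 1 r' P0" for r' by (simp add: V_def duhamel_1[OF Pc])
    show ?thesis
    proof (cases "\<eta> \<le> b")
      case True
      have cone: "in_cone s (s - b)" if "s1 \<le> s" for s
        using that s1 True by (auto simp: in_cone_def)
      define \<Phi> where "\<Phi> s = \<delta> * (A * ((s - b) * w0 s (s - b)) - (s - b) * w1 s (s - b) - K * ((s - b) * w2 s (s - b)))" for s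
      have \<Phi>: "\<Phi> s = (s - b) * barrier s (s - b)" for s
        using True by (simp add: \<Phi>_def barrier_def algebra_simps)
      have d\<Phi>: "(\<Phi> has_real_derivative barrier_out s (s - b)) (at s)" if "s1 \<le> s" for s
        unfolding \<Phi>_def barrier_out_def using cone[OF that] True eta
        by (intro DERIV_cmult DERIV_diff wt_forward_deriv) (auto simp: in_cone_def)
      have "\<bar>V t (t - b)\<bar> \<le> \<Phi> t"
      proof (rule abs_le_along[OF s1(3) cont _ V d\<Phi>])
        show "continuous_on {s1..t} \<Phi>"
          by (rule DERIV_continuous_on[OF DERIV_subset[OF d\<Phi>]]) auto
        show "\<bar>duhamel P s (s + (s - b))\<bar> \<le> barrier_out s (s - b)" if "s1 < s" "s < t" for s
          by (rule duhamel_le_barrier_out[OF P cone]) (use that s1 in auto)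
        show "\<bar>V s1 (s1 - b)\<bar> \<le> \<Phi> s1"
        proof (cases "1 < b")
          case True
          then have "s1 = b" by (simp add: s1_def)
          then show ?thesis by (simp add: V_def \<Phi>)
        next
          case False
          then have s1: "s1 = 1" by (simp add: s1_def)
          have c: "in_cone 1 (1 - b)" using cone[of 1] s1 by simp
          have "\<bar>mean 1 (1 - b) P0\<bar> \<le> \<delta> * 1" using mean_P0_le False by simp
          also have "\<dots> \<le> \<delta> * w0 1 (1 - b)" using w0_initial[OF c] delta_pos by simp
          also have "\<dots> \<le> barrier 1 (1 - b)" by (rule barrier_ge[OF c])
          finally show ?thesis using False by (simp add: s1 init \<Phi> abs_mult mult_left_mono)
        qed
      qed auto
      then show ?thesis by (simp add: \<Phi> b_def)
    next
      case False
      then have s1e: "s1 = 1" using eta by (simp add: s1_def)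
      \<comment> \<open>For \<open>b < \<eta>\<close> the whole line lies in
        \<open>r > t - \<eta>\<close>, where both \<open>P\<close> and the initial value of
        \<open>V\<close> vanish.\<close>
      have "\<bar>V t (t - b)\<bar> \<le> 0"
      proof (rule abs_le_along[OF s1(3) cont _ V, where \<psi> = "\<lambda>_. 0" and \<psi>' = "\<lambda>_. 0"])
        show "\<bar>duhamel P s (s + (s - b))\<bar> \<le> 0" if "s1 < s" "s < t" for s
          using duhamel_zero[OF P, of s "s - b"] that s1 False by simp
        show "\<bar>V s1 (s1 - b)\<bar> \<le> 0" using mean_P0_supp[of "1 - b"] False by (simp add: s1e init)
      qed auto
      then show ?thesis using False by (simp add: barrier_def b_def)
    qed
  qed
  then have "\<bar>mean t r (duhamel P t)\<bar> \<le> barrier t r" if "1 \<le> t" "0 < r" for t r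
    using that by (simp add: V_def abs_mult)
  then show ?thesis using duhamel_cont[OF Pc] by (simp add: subbarrier_def)
qed

text \<open>Since \<open>F\<close> vanishes for \<open>r > s\<close>, the factor \<open>r\<close> in it costs a factor \<open>s\<close>; the weight \<open>exp (\<Lambda> t\<^sup>2)\<close>
  turns this into a contraction.\<close>

definition "\<Lambda> = m * (m - 1) + p"

lemma Lambda_pos: "0 < \<Lambda>" using m_ge p_gt by (simp add: \<Lambda>_def add_pos_pos)

lemma N_lipschitz:
  assumes "\<bar>v\<bar> \<le> 1" "\<bar>w\<bar> \<le> 1"
  shows "\<bar>N s v - N s w\<bar> \<le> \<Lambda> * \<bar>v - w\<bar>"
proof -
  have "\<bar>m * (m - 1) * v / (clock s)\<^sup>2 - m * (m - 1) * w / (clock s)\<^sup>2\<bar> = m * (m - 1) * \<bar>v - w\<bar> / (clock s)\<^sup>2"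
    using m_ge by (simp flip: diff_divide_distrib right_diff_distrib add: abs_mult)
  also have "\<dots> \<le> m * (m - 1) * \<bar>v - w\<bar> / 1"
    using m_ge clock_ge[of s] by (intro divide_left_mono) (auto simp: one_le_power)
  finally have 1: "\<bar>m * (m - 1) * v / (clock s)\<^sup>2 - m * (m - 1) * w / (clock s)\<^sup>2\<bar> \<le> m * (m - 1) * \<bar>v - w\<bar>" by simp
  have "clock s powr (m - m * p) \<le> clock s powr 0"
    using clock_ge m_ge p_gt by (intro powr_mono) auto
  also have "\<dots> \<le> 1" by simp
  finally have c: "clock s powr (m - m * p) \<le> 1" .
  have "\<bar>clock s powr (m - m * p) * \<bar>v\<bar> powr p - clock s powr (m - m * p) * \<bar>w\<bar> powr p\<bar>
    = clock s powr (m - m * p) * \<bar>\<bar>v\<bar> powr p - \<bar>w\<bar> powr p\<bar>"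
    by (simp flip: right_diff_distrib add: abs_mult)
  also have "\<dots> \<le> 1 * (p * 1 powr (p - 1) * \<bar>v - w\<bar>)"
    using c abs_powr_lipschitz[of p v 1 w] assms p_gt by (intro mult_mono) auto
  finally have "\<bar>clock s powr (m - m * p) * \<bar>v\<bar> powr p - clock s powr (m - m * p) * \<bar>w\<bar> powr p\<bar>
    \<le> p * \<bar>v - w\<bar>" by simp
  with 1 show ?thesis unfolding N_def \<Lambda>_def distrib_right by linarith
qed

lemma duhamel_contraction:
  assumes P: "subbarrier P" "subbarrier P'" and t: "1 \<le> t"
    and D: "\<And>s y. 1 \<le> s \<Longrightarrow> \<bar>P s y - P' s y\<bar> \<le> D * exp (\<Lambda> * s\<^sup>2)"
  shows "\<bar>duhamel P t y - duhamel P' t y\<bar> \<le> D * exp (\<Lambda> * t\<^sup>2) / 2"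
proof -
  have Pc: "continuous_on UNIV (\<lambda>(t, y). P t y)" "continuous_on UNIV (\<lambda>(t, y). P' t y)"
    using P by (auto simp: subbarrier_def)
  have Pt: "continuous_on UNIV (P t)" "continuous_on UNIV (P' t)" for t
    by (rule continuous_on_section[OF Pc(1)], rule continuous_on_section[OF Pc(2)])
  have D0: "0 \<le> D" using D[of 1 0] by (auto simp: zero_le_mult_iff dest: order_trans[OF abs_ge_zero])
  have pos: "\<bar>F P s x - F P' s x\<bar> \<le> s * (\<Lambda> * (D * exp (\<Lambda> * s\<^sup>2)))" if s: "1 \<le> s" and x: "0 < x" for s x
  proof (cases "s - \<eta> < x")
    case True
    then show ?thesis using F_zero[OF P(1) s x] F_zero[OF P(2) s x] s Lambda_pos D0 by simp
  next
    case False
    have b: "\<bar>mean s x (P s)\<bar> \<le> 1" "\<bar>mean s x (P' s)\<bar> \<le> 1"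
      using P s x barrier_le_1[of s x] unfolding subbarrier_def by (meson order_trans less_imp_le)+
    have "\<bar>mean s x (P s) - mean s x (P' s)\<bar> \<le> D * exp (\<Lambda> * s\<^sup>2)"
      unfolding mean_diff[OF Pt] by (rule abs_mean_le) (use D[OF s] Pt in \<open>auto intro!: continuous_intros\<close>)
    then have "\<Lambda> * \<bar>mean s x (P s) - mean s x (P' s)\<bar> \<le> \<Lambda> * (D * exp (\<Lambda> * s\<^sup>2))"
      using Lambda_pos by simp
    then have N: "\<bar>N s (mean s x (P s)) - N s (mean s x (P' s))\<bar> \<le> \<Lambda> * (D * exp (\<Lambda> * s\<^sup>2))"
      using N_lipschitz[OF b, of s] by linarith
    have "\<bar>F P s x - F P' s x\<bar> = x * \<bar>N s (mean s x (P s)) - N s (mean s x (P' s))\<bar>"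
      using x by (simp add: F_def clock_eq[OF s] flip: right_diff_distrib) (simp add: abs_mult)
    also have "\<dots> \<le> s * (\<Lambda> * (D * exp (\<Lambda> * s\<^sup>2)))"
      using N False eta x s by (intro mult_mono) auto
    finally show ?thesis .
  qed
  \<comment> \<open>The source is odd in the radius, so positive radii decide.\<close>
  have all: "\<bar>F P s x - F P' s x\<bar> \<le> s * (\<Lambda> * (D * exp (\<Lambda> * s\<^sup>2)))" if s: "1 \<le> s" for s x
  proof -
    consider "0 < x" | "x = 0" | "0 < - x" by linarith
    then show ?thesis
    proof cases
      case 2
      then show ?thesis using s Lambda_pos D0 by (simp add: F_def)
    next
      case 3
      then show ?thesis using pos[OF s 3] by (simp add: F_odd Pc)
    qed (use pos[OF s] in simp)
  qed
  have cF: "continuous_on UNIV (\<lambda>s. F P s (y - s))" "continuous_on UNIV (\<lambda>s. F P' s (y - s))"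
    by (intro continuous_on_F Pc continuous_intros)+
  \<comment> \<open>The majorant \<open>s * (\<Lambda> * (D * exp (\<Lambda> * s\<^sup>2)))\<close>
    is the derivative of \<open>D * exp (\<Lambda> * s\<^sup>2) / 2\<close>. Having the Lipschitz
    constant \<open>\<Lambda>\<close> in the exponent thus produces the contraction factor one
    half.\<close>
  have "\<bar>sint 1 t (\<lambda>s. F P s (y - s) - F P' s (y - s))\<bar> \<le>
      D * exp (\<Lambda> * t\<^sup>2) / 2 - D * exp (\<Lambda> * 1\<^sup>2) / 2"
  proof (rule abs_sint_le[where h = "\<lambda>s. s * (\<Lambda> * (D * exp (\<Lambda> * s\<^sup>2)))"])
    show "((\<lambda>s. D * exp (\<Lambda> * s\<^sup>2) / 2) has_real_derivative s * (\<Lambda> * (D * exp (\<Lambda> * s\<^sup>2)))) (at s)" for s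
      by (auto intro!: derivative_eq_intros)
  qed (use t all in \<open>auto intro!: continuous_intros cF\<close>)
  moreover have "0 \<le> D * exp (\<Lambda> * 1\<^sup>2) / 2" using D0 by simp
  ultimately show ?thesis
    unfolding duhamel_def using sint_diff[OF cF, of 1 t] by simp
qed

end

section \<open>The fixed point and its regularity\<close>

text \<open>\<open>sgn\<close> jumps at zero, so the product is rewritten as the difference of the
  powers of the positive and the negative part, each continuous because
  \<open>0 < q\<close>.\<close>

lemma continuous_on_abs_powr_sgn:
  fixes f :: "'a::topological_space \<Rightarrow> real"
  assumes "0 < q" and f: "continuous_on X f"
  shows "continuous_on X (\<lambda>x. \<bar>f x\<bar> powr q * sgn (f x))"
proof -
  have "continuous_on X (\<lambda>x. max (f x) 0 powr q - max (- f x) 0 powr q)"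
    using assms by (intro continuous_intros continuous_on_powr') auto
  moreover have "max (f x) 0 powr q - max (- f x) 0 powr q = \<bar>f x\<bar> powr q * sgn (f x)" for x
    using assms(1) by (cases "f x" "0::real" rule: linorder_cases) (auto simp: max_def)
  ultimately show ?thesis by simp
qed

context cauchy_problem
begin

text \<open>The iteration runs on bounded continuous functions
  \<open>h = exp (- \<Lambda> * t\<^sup>2) * P\<close>, a complete space. Since
  \<open>weighted\<close> reads \<open>Q\<close> only at times \<open>clock t\<close>, going back
  and forth reproduces \<open>Q\<close> for \<open>t \<ge> 1\<close> only.\<close>

definition unweight :: "((real \<times> real) \<Rightarrow>\<^sub>C real) \<Rightarrow> real \<Rightarrow> real \<Rightarrow> real" where
  "unweight h t y = exp (\<Lambda> * (clock t)\<^sup>2) * apply_bcontfun h (t, y)"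

definition weighted :: "(real \<Rightarrow> real \<Rightarrow> real) \<Rightarrow> real \<times> real \<Rightarrow> real" where
  "weighted Q = (\<lambda>(t, y). exp (- (\<Lambda> * (clock t)\<^sup>2)) * Q (clock t) y)"

lemma unweight_cont: "continuous_on UNIV (\<lambda>(t, y). unweight h t y)"
  unfolding unweight_def case_prod_unfold by (intro continuous_intros) auto

lemma subbarrier_zero: "subbarrier (\<lambda>_ _. 0)"
  using barrier_nonneg by (auto simp: subbarrier_def mean_def case_prod_unfold)

lemma duhamel_zero_input: "duhamel (\<lambda>_ _. 0) t y = P0 y"
  by (simp add: duhamel_def F_def mean_def N_def sint_def)

text \<open>For fixed \<open>t\<close> and \<open>r\<close> the mean is Lipschitz in
  \<open>h\<close>, with the weight at time \<open>t\<close> as constant. Each barrier condition is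
  therefore closed, and the set is an intersection of such conditions.\<close>

lemma complete_subbarrier: "complete {h. subbarrier (unweight h)}"
proof -
  have "closed {h. \<bar>mean t r (unweight h t)\<bar> \<le> barrier t r}" for t r
  proof -
    have "(exp (\<Lambda> * (clock t)\<^sup>2))-lipschitz_on UNIV (\<lambda>h. mean t r (unweight h t))"
    proof (rule lipschitz_onI)
      fix h k :: "(real \<times> real) \<Rightarrow>\<^sub>C real"
      have c: "continuous_on UNIV (unweight h t)" "continuous_on UNIV (unweight k t)"
        by (rule continuous_on_section[OF unweight_cont])+
      have "\<bar>mean t r (\<lambda>y. unweight h t y - unweight k t y)\<bar> \<le> exp (\<Lambda> * (clock t)\<^sup>2) * dist h k"
      proof (rule abs_mean_le)
        show "\<bar>unweight h t y - unweight k t y\<bar> \<le> exp (\<Lambda> * (clock t)\<^sup>2) * dist h k" for y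
          using dist_bounded[of h "(t, y)" k]
          by (simp add: unweight_def dist_real_def abs_mult flip: right_diff_distrib)
      qed (intro continuous_intros c)
      then show "dist (mean t r (unweight h t)) (mean t r (unweight k t)) \<le> exp (\<Lambda> * (clock t)\<^sup>2) * dist h k"
        using mean_diff[OF c, of t r] by (simp add: dist_real_def)
    qed simp
    then show ?thesis
      by (intro closed_Collect_le continuous_intros lipschitz_on_continuous_on)
  qed
  then have "closed (\<Inter>t\<in>{1..}. \<Inter>r\<in>{0<..}. {h. \<bar>mean t r (unweight h t)\<bar> \<le> barrier t r})"
    by (intro closed_INT ballI)
  also have "(\<Inter>t\<in>{1..}. \<Inter>r\<in>{0<..}. {h. \<bar>mean t r (unweight h t)\<bar> \<le> barrier t r}) = {h. subbarrier (unweight h)}"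
    using unweight_cont by (auto simp: subbarrier_def)
  finally show ?thesis by (simp add: complete_eq_closed)
qed

text \<open>Boundedness comes from the contraction estimate against the zero input, whose image is
  the bounded function \<open>P0\<close>.\<close>

lemma weighted_duhamel_bcontfun:
  assumes "subbarrier (unweight h)"
  shows "weighted (duhamel (unweight h)) \<in> bcontfun"
proof (rule bcontfun_normI)
  show "continuous_on UNIV (weighted (duhamel (unweight h)))"
    unfolding weighted_def case_prod_unfold
    by (intro continuous_intros continuous_on_case_prod_compose[OF duhamel_cont[OF unweight_cont]])
  fix z :: "real \<times> real"
  obtain t y where z: "z = (t, y)" by (cases z)
  define E where "E = exp (\<Lambda> * (clock t)\<^sup>2)"
  have E: "1 \<le> E" "E * exp (- (\<Lambda> * (clock t)\<^sup>2)) = 1"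
    using Lambda_pos by (auto simp: E_def simp flip: exp_add)
  have "\<bar>duhamel (unweight h) (clock t) y - duhamel (\<lambda>_ _. 0) (clock t) y\<bar> \<le> norm h * exp (\<Lambda> * (clock t)\<^sup>2) / 2"
  proof (rule duhamel_contraction[OF assms subbarrier_zero clock_ge])
    show "\<bar>unweight h s x - 0\<bar> \<le> norm h * exp (\<Lambda> * s\<^sup>2)" if "1 \<le> s" for s x
      using norm_bounded[of h "(s, x)"] by (simp add: unweight_def clock_eq[OF that] abs_mult mult.commute)
  qed
  then have "\<bar>duhamel (unweight h) (clock t) y\<bar> \<le> norm h * E / 2 + \<delta> * \<eta> / 2"
    using P0_bound[of y] unfolding duhamel_zero_input E_def by linarith
  also have "\<dots> \<le> norm h * E / 2 + \<delta> * \<eta> / 2 * E"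
    using delta_pos eta E by (intro add_left_mono) (simp add: field_simps)
  finally have "\<bar>duhamel (unweight h) (clock t) y\<bar> * exp (- (\<Lambda> * (clock t)\<^sup>2)) \<le>
      (norm h * E / 2 + \<delta> * \<eta> / 2 * E) * exp (- (\<Lambda> * (clock t)\<^sup>2))"
    by (rule mult_right_mono) simp
  also have "\<dots> = (norm h / 2 + \<delta> * \<eta> / 2) * (E * exp (- (\<Lambda> * (clock t)\<^sup>2)))"
    by (simp add: algebra_simps)
  finally show "norm (weighted (duhamel (unweight h)) z) \<le> norm h / 2 + \<delta> * \<eta> / 2"
    unfolding E(2) by (simp add: weighted_def z abs_mult mult.commute)
qed

lemma unweight_weighted:
  assumes "weighted Q \<in> bcontfun" and "1 \<le> t"
  shows "unweight (Bcontfun (weighted Q)) t y = Q t y"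
  using assms by (simp add: unweight_def Bcontfun_inverse weighted_def clock_eq exp_minus field_simps)

lemma subbarrier_cong:
  assumes "subbarrier Q" and "continuous_on UNIV (\<lambda>(t, y). P t y)" and "\<And>t. 1 \<le> t \<Longrightarrow> P t = Q t"
  shows "subbarrier P"
  using assms by (auto simp: subbarrier_def)

lemma duhamel_fixed_point: "\<exists>P. subbarrier P \<and> duhamel P = P"
proof -
  define S where "S = {h. subbarrier (unweight h)}"
  define T where "T h = Bcontfun (weighted (duhamel (unweight h)))" for h
  have eq: "unweight (T h) t y = duhamel (unweight h) t y" if "h \<in> S" "1 \<le> t" for h t y
    using that by (simp add: T_def S_def unweight_weighted weighted_duhamel_bcontfun)
  have "\<exists>!h. h \<in> S \<and> T h = h"
  proof (rule Banach_fix[where c = "1/2"])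
    show "complete S" unfolding S_def by (rule complete_subbarrier)
    have "unweight 0 = (\<lambda>_ _. 0)" by (intro ext) (simp add: unweight_def)
    then show "S \<noteq> {}" using subbarrier_zero by (auto simp: S_def intro!: exI[of _ 0])
    show "T ` S \<subseteq> S"
    proof safe
      fix h assume h: "h \<in> S"
      then have "subbarrier (duhamel (unweight h))" by (simp add: S_def subbarrier_duhamel)
      then have "subbarrier (unweight (T h))"
        by (rule subbarrier_cong[OF _ unweight_cont]) (use eq[OF h] in auto)
      then show "T h \<in> S" by (simp add: S_def)
    qed
    show "dist (T h) (T k) \<le> 1 / 2 * dist h k" if hk: "h \<in> S" "k \<in> S" for h k
    proof (rule dist_bound)
      fix z :: "real \<times> real"
      obtain t y where z: "z = (t, y)" by (cases z)
      define E where "E = exp (\<Lambda> * (clock t)\<^sup>2)"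
      have E: "E * exp (- (\<Lambda> * (clock t)\<^sup>2)) = 1"
        by (auto simp: E_def simp flip: exp_add)
      have "\<bar>duhamel (unweight h) (clock t) y - duhamel (unweight k) (clock t) y\<bar> \<le> dist h k * exp (\<Lambda> * (clock t)\<^sup>2) / 2"
      proof (rule duhamel_contraction[OF _ _ clock_ge])
        show "\<bar>unweight h s x - unweight k s x\<bar> \<le> dist h k * exp (\<Lambda> * s\<^sup>2)" if "1 \<le> s" for s x
        proof -
          have "unweight h s x - unweight k s x = exp (\<Lambda> * s\<^sup>2) * (apply_bcontfun h (s, x) - apply_bcontfun k (s, x))"
            by (simp add: unweight_def clock_eq[OF that] right_diff_distrib)
          then show ?thesis
            using dist_bounded[of h "(s, x)" k] by (simp add: abs_mult dist_real_def mult.commute)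
        qed
      qed (use hk in \<open>auto simp: S_def\<close>)
      then have "exp (- (\<Lambda> * (clock t)\<^sup>2)) * \<bar>duhamel (unweight h) (clock t) y - duhamel (unweight k) (clock t) y\<bar>
          \<le> exp (- (\<Lambda> * (clock t)\<^sup>2)) * (dist h k * E / 2)"
        unfolding E_def[symmetric] by (rule mult_left_mono) simp
      also have "\<dots> = dist h k / 2 * (E * exp (- (\<Lambda> * (clock t)\<^sup>2)))" by simp
      finally have "\<bar>exp (- (\<Lambda> * (clock t)\<^sup>2)) * (duhamel (unweight h) (clock t) y - duhamel (unweight k) (clock t) y)\<bar>
          \<le> dist h k / 2" unfolding E by (simp add: abs_mult)
      then show "dist (apply_bcontfun (T h) z) (apply_bcontfun (T k) z) \<le> 1 / 2 * dist h k"
        using hk weighted_duhamel_bcontfun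
        by (simp add: T_def S_def Bcontfun_inverse weighted_def z dist_real_def right_diff_distrib)
    qed
  qed auto
  then obtain h where h: "h \<in> S" "T h = h" by blast
  \<comment> \<open>\<open>unweight h\<close> solves the fixed point equation for
    \<open>t \<ge> 1\<close> only. One more application of \<open>duhamel\<close>, which reads its
    argument at clock times, gives a fixed point on the whole plane.\<close>
  define P where "P = duhamel (unweight h)"
  have P: "P t = unweight h t" if "1 \<le> t" for t
    using eq[OF h(1) that] h(2) by (auto simp: P_def)
  have "F P = F (unweight h)" by (intro ext) (simp add: F_def P clock_ge)
  then have "duhamel P = P" by (intro ext) (simp add: duhamel_def P_def)
  moreover have "subbarrier P" unfolding P_def using h by (simp add: S_def subbarrier_duhamel)
  ultimately show ?thesis by blast
qed

section \<open>Regularity of the fixed point\<close>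

definition "N' s w = m * (m - 1) / (clock s)\<^sup>2 + clock s powr (m - m * p) * (p * (\<bar>w\<bar> powr (p - 1) * sgn w))"

text \<open>The derivative of \<open>y * N s (W y)\<close>, \<open>W\<close> the mean. Since
  \<open>y * W\<close> has as derivative the half sum of the endpoint values of \<open>P\<close>,
  \<open>y * W'\<close> is that half sum minus \<open>W\<close>. In this form nothing is divided by
  \<open>y\<close>, and continuity on the axis is immediate.\<close>

definition "F' P s y = N s (mean (clock s) y (P (clock s))) + N' s (mean (clock s) y (P (clock s)))
   * ((P (clock s) (clock s + y) + P (clock s) (clock s - y)) / 2 - mean (clock s) y (P (clock s)))"

lemma N_deriv: "(N s has_real_derivative N' s w) (at w)"
proof -
  have "((\<lambda>w. N s w) has_real_derivative m * (m - 1) * 1 / (clock s)\<^sup>2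
      + clock s powr (m - m * p) * (p * \<bar>w\<bar> powr (p - 1) * sgn w)) (at w)"
    unfolding N_def
    by (intro DERIV_add DERIV_cmult DERIV_cdivide DERIV_ident abs_powr_has_real_derivative)
       (use p_gt in auto)
  then show ?thesis by (simp add: N'_def mult.assoc)
qed

lemma continuous_on_N':
  assumes "continuous_on X a" "continuous_on X b"
  shows "continuous_on X (\<lambda>x. N' (a x) (b x))"
proof -
  have c: "clock s \<noteq> 0" for s using clock_ge[of s] by auto
  show ?thesis unfolding N'_def
    by (intro continuous_intros continuous_on_powr' continuous_on_abs_powr_sgn assms ballI)
       (use c p_gt in \<open>auto simp: less_imp_le[OF less_le_trans[OF zero_less_one clock_ge]]\<close>)
qed

lemma continuous_on_F':
  assumes P: "continuous_on UNIV (\<lambda>(t, y). P t y)" and "continuous_on X a" "continuous_on X b"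
  shows "continuous_on X (\<lambda>x. F' P (a x) (b x))"
  unfolding F'_def
  by (intro continuous_intros continuous_on_N continuous_on_N' assms
      continuous_on_case_prod_compose[OF continuous_on_mean[OF P]] continuous_on_case_prod_compose[OF P])
    auto

lemma mean_radial_deriv:
  assumes h: "continuous_on UNIV h"
  shows "((\<lambda>y. y * mean t y h) has_real_derivative (h (t + y) + h (t - y)) / 2) (at y)"
proof -
  have "((\<lambda>y. sint 0 (t + c * y) h) has_real_derivative h (t + c * y) * c) (at y)" for c
    by (rule DERIV_chain2[OF sint_has_real_derivative[OF h]]) (auto intro!: derivative_eq_intros)
  from this[of 1] this[of "-1"] show ?thesis
    by (auto simp: mean_eq_sint[OF h] intro!: derivative_eq_intros)
qed

text \<open>At \<open>y = 0\<close> the difference quotient of \<open>F\<close> is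
  \<open>N s (W y)\<close>, so continuity of the mean gives the derivative; the second summand of
  \<open>F'\<close> is zero there because both endpoint values equal \<open>W 0\<close>.\<close>

lemma F_deriv:
  assumes P: "continuous_on UNIV (\<lambda>(t, y). P t y)"
  shows "((F P s) has_real_derivative F' P s y) (at y)"
proof -
  define c h W where "c = clock s" and "h = P c" and "W y = mean c y h" for y
  have h: "continuous_on UNIV h" unfolding h_def by (rule continuous_on_section[OF P])
  have F: "F P s = (\<lambda>y. y * N s (W y))" by (simp add: F_def W_def c_def h_def fun_eq_iff)
  have F': "F' P s y = N s (W y) + N' s (W y) * ((h (c + y) + h (c - y)) / 2 - W y)"
    by (simp add: F'_def W_def c_def h_def)
  show ?thesis
  proof (cases "y = 0")
    case False
    have "((\<lambda>y. y * W y / y) has_real_derivative ((h (c + y) + h (c - y)) / 2 * y - y * W y) / (y * y)) (at y)"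
      using DERIV_divide[OF mean_radial_deriv[OF h, of c y] DERIV_ident False] by (simp only: W_def mult_1_right)
    then have W: "(W has_real_derivative ((h (c + y) + h (c - y)) / 2 * y - y * W y) / (y * y)) (at y)"
      by (rule has_field_derivative_transform_within_open[of _ _ _ "-{0}"]) (use False in auto)
    show ?thesis unfolding F F'
      using False by (auto intro!: derivative_eq_intros DERIV_chain2[OF N_deriv W] simp: field_simps)
  next
    case True
    have "continuous_on UNIV W"
      unfolding W_def by (rule continuous_on_case_prod_compose[OF continuous_on_mean[of "\<lambda>t. h"]])
        (auto simp: case_prod_unfold intro!: continuous_intros continuous_on_compose2[OF h])
    then have "continuous_on UNIV (\<lambda>y. N s (W y))"
      by (intro continuous_on_N continuous_intros)
    then have "(\<lambda>y. N s (W y)) \<midarrow>0\<rightarrow> N s (W 0)"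
      by (simp add: continuous_on_eq_continuous_at isCont_def)
    moreover have "W 0 = h c" by (simp add: W_def mean_def)
    moreover have "(\<lambda>y. y * N s (W y) / y) \<midarrow>0\<rightarrow> N s (W 0) \<longleftrightarrow> (\<lambda>y. N s (W y)) \<midarrow>0\<rightarrow> N s (W 0)"
      by (rule LIM_equal) auto
    moreover have "F' P s 0 = N s (W 0)" using F' True \<open>W 0 = h c\<close> by simp
    ultimately show ?thesis unfolding F True by (simp add: DERIV_def)
  qed
qed

text \<open>\<open>r W\<close> is the solution \<open>V = t\<^sup>m r u\<close> of the one-dimensional equation.\<close>

lemma wave_solution:
  "\<exists>W Vt Vr a b. continuous_on UNIV (\<lambda>(t, r). W t r) \<and> continuous_on UNIV (\<lambda>(t, r). a t r) \<and>
     continuous_on UNIV (\<lambda>(t, r). b t r) \<and>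
     (\<forall>t r. ((\<lambda>(t, r). r * W t r) has_derivative (\<lambda>(dt, dr). Vt t r * dt + Vr t r * dr)) (at (t, r))) \<and>
     (\<forall>t r. ((\<lambda>(t, r). Vt t r) has_derivative (\<lambda>(dt, dr). (r * N t (W (clock t) r) + a t r) * dt + b t r * dr)) (at (t, r))) \<and>
     (\<forall>t r. ((\<lambda>(t, r). Vr t r) has_derivative (\<lambda>(dt, dr). b t r * dt + a t r * dr)) (at (t, r))) \<and>
     (\<forall>r. W 1 r = mean 1 r P0) \<and> (\<forall>r. Vt 1 r = (P0 (1 + r) - P0 (1 - r)) / 2)"
proof -
  obtain P where P: "subbarrier P" "duhamel P = P" using duhamel_fixed_point by blast
  have Pc: "continuous_on UNIV (\<lambda>(t, y). P t y)" using P by (simp add: subbarrier_def)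
  \<comment> \<open>The fixed point equation differentiated in \<open>y\<close>.\<close>
  define Py where "Py t y = P0' y + sint 1 t (\<lambda>s. F' P s (y - s))" for t y
  have "continuous_on UNIV (\<lambda>(t, y). sint 1 t (\<lambda>s. F' P s (y - s)))"
    by (rule continuous_on_sint) (auto simp: case_prod_unfold intro!: continuous_on_F'[OF Pc] continuous_intros)
  then have Py: "continuous_on UNIV (\<lambda>(t, y). Py t y)"
    unfolding Py_def case_prod_unfold
    by (intro continuous_intros continuous_on_compose2[OF P0'_cont]) auto
  have dP: "((\<lambda>(t, y). P t y) has_derivative (\<lambda>(dt, dy). F P t (y - t) * dt + Py t y * dy)) (at (t, y))" for t y
  proof (rule has_derivative_of_partials[OF _ _ Py])
    show "((\<lambda>t. P t y) has_real_derivative F P t (y - t)) (at t)"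
      using duhamel_deriv[OF Pc, of y t] by (simp add: P(2))
    show "(P t has_real_derivative Py t y) (at y)" for t y
    proof -
      have "((\<lambda>(t, y). sint 1 t (\<lambda>s. F P s (y - s))) has_derivative
         (\<lambda>(dt, dy). F P t (y - t) * dt + sint 1 t (\<lambda>s. F' P s (y - s)) * dy)) (at (t, y))"
      proof (rule sint_has_derivative)
        show "((\<lambda>y. F P s (y - s)) has_real_derivative F' P s (y - s)) (at y)" for s y
        proof -
          have "((\<lambda>y. y - s) has_real_derivative 1) (at y)" by (auto intro!: derivative_eq_intros)
          from DERIV_chain2[where f = "F P s", OF F_deriv[OF Pc] this] show ?thesis by simp
        qed
      qed (auto simp: case_prod_unfold intro!: continuous_on_F[OF Pc] continuous_on_F'[OF Pc] continuous_intros)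
      moreover have "((\<lambda>y. (t, y)) has_derivative (\<lambda>h. (0, h))) (at y)"
        by (auto intro!: derivative_eq_intros)
      ultimately have "((\<lambda>y. sint 1 t (\<lambda>s. F P s (y - s))) has_real_derivative sint 1 t (\<lambda>s. F' P s (y - s))) (at y)"
        using has_derivative_compose[of "\<lambda>y. (t, y)" "\<lambda>h. (0, h)" y UNIV "\<lambda>(t, y). sint 1 t (\<lambda>s. F P s (y - s))"]
        by (fastforce simp: has_field_derivative_def elim!: has_derivative_eq_rhs)
      then have "((\<lambda>y. P0 y + sint 1 t (\<lambda>s. F P s (y - s))) has_real_derivative Py t y) (at y)"
        unfolding Py_def by (intro DERIV_add P0_deriv)
      moreover have "P t = (\<lambda>y. P0 y + sint 1 t (\<lambda>s. F P s (y - s)))"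
        using P(2) by (metis duhamel_def)
      ultimately show ?thesis by simp
    qed
  qed
  \<comment> \<open>These are \<open>V\<^sub>r\<^sub>r\<close> and \<open>V\<^sub>t\<^sub>r\<close>.
    Oddness of \<open>F\<close> in the radius makes \<open>V\<^sub>t\<^sub>t\<close> equal to
    \<open>F + a\<close>, which is the wave equation.\<close>
  define a b where "a t r = (Py t (t + r) - Py t (t - r)) / 2" and "b t r = (Py t (t + r) + Py t (t - r)) / 2" for t r
  define W where "W t r = mean t r (P t)" for t r
  have W_even: "W t (- r) = W t r" for t r
    unfolding W_def by (rule mean_minus[OF continuous_on_section[OF Pc]])
  have FW: "F P t r = r * N t (W (clock t) r)" for t r by (simp add: F_def W_def)
  have dPc: "((\<lambda>z. P (fst z) (fst z + c * snd z)) has_derivative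
      (\<lambda>(dt, dr). F P t (c * r) * dt + Py t (t + c * r) * (dt + c * dr))) (at (t, r))" for t r c
  proof -
    have "((\<lambda>z. (fst z, fst z + c * snd z)) has_derivative (\<lambda>z. (fst z, fst z + c * snd z))) (at (t, r))"
      by (auto intro!: derivative_eq_intros)
    from has_derivative_compose[OF this, of "\<lambda>(t, y). P t y"
        "\<lambda>(dt, dy). F P t (c * r) * dt + Py t (t + c * r) * dy"] dP[of t "t + c * r"]
    show ?thesis by (simp add: case_prod_unfold)
  qed
  show ?thesis
  proof (intro exI conjI allI)
    show "continuous_on UNIV (\<lambda>(t, r). W t r)" unfolding W_def by (rule continuous_on_mean[OF Pc])
    show "continuous_on UNIV (\<lambda>(t, r). a t r)" "continuous_on UNIV (\<lambda>(t, r). b t r)"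
      unfolding a_def b_def case_prod_unfold
      by (intro continuous_intros continuous_on_case_prod_compose[OF Py]; simp)+
    show "((\<lambda>(t, r). r * W t r) has_derivative (\<lambda>(dt, dr). (P t (t + r) - P t (t - r)) / 2 * dt
        + (P t (t + r) + P t (t - r)) / 2 * dr)) (at (t, r))" for t r
      using wave_has_derivative[OF Pc, of t r] by (simp add: P(2) W_def)
    show "((\<lambda>(t, r). (P t (t + r) - P t (t - r)) / 2) has_derivative
        (\<lambda>(dt, dr). (r * N t (W (clock t) r) + a t r) * dt + b t r * dr)) (at (t, r))" for t r
      using bounded_linear.has_derivative[OF bounded_linear_divide[of 2] has_derivative_diff[OF dPc[of 1 t r] dPc[of "-1" t r]]]
      by (simp add: case_prod_unfold FW W_even a_def b_def)
         (erule has_derivative_eq_rhs, simp add: fun_eq_iff field_simps)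
    show "((\<lambda>(t, r). (P t (t + r) + P t (t - r)) / 2) has_derivative
        (\<lambda>(dt, dr). b t r * dt + a t r * dr)) (at (t, r))" for t r
      using bounded_linear.has_derivative[OF bounded_linear_divide[of 2] has_derivative_add[OF dPc[of 1 t r] dPc[of "-1" t r]]]
      by (simp add: case_prod_unfold FW W_even a_def b_def)
         (erule has_derivative_eq_rhs, simp add: fun_eq_iff field_simps)
    have "P 1 = P0" using duhamel_1[OF Pc] by (simp add: P(2))
    then show "W 1 r = mean 1 r P0" "(P 1 (1 + r) - P 1 (1 - r)) / 2 = (P0 (1 + r) - P0 (1 - r)) / 2" for r
      by (simp_all add: W_def)
  qed
qed

end

section \<open>Radial functions on three-dimensional space\<close>

lemma Ck_on_imp_continuous_on: "Ck_on k S f \<Longrightarrow> continuous_on S f"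
  by (cases k) (use has_derivative_continuous_on in auto)

lemma Ck_on_SucD: "Ck_on (Suc k) S f \<Longrightarrow> Ck_on k S f"
proof (induction k arbitrary: f)
  case 0
  then show ?case using Ck_on_imp_continuous_on[OF 0] by simp
next
  case (Suc k)
  then show ?case by (metis Ck_on.simps(2))
qed

lemma Ck_on_const [simp]: "Ck_on k S (\<lambda>_. c)"
proof (induction k arbitrary: c)
  case (Suc k)
  show ?case unfolding Ck_on.simps
    by (rule exI[of _ "\<lambda>_ _. 0"]) (use Suc in auto)
qed simp

lemma Ck_on_linear: "bounded_linear f \<Longrightarrow> Ck_on k S f"
proof (cases k)
  case (Suc j)
  assume "bounded_linear f"
  then show ?thesis unfolding Suc Ck_on.simps
    by (intro exI[of _ "\<lambda>_. f"]) (auto intro: bounded_linear_imp_has_derivative)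
qed (auto intro: linear_continuous_on)

lemma Ck_on_add: "Ck_on k S f \<Longrightarrow> Ck_on k S g \<Longrightarrow> Ck_on k S (\<lambda>x. f x + g x)"
proof (induction k arbitrary: f g)
  case 0
  then show ?case by (auto intro: continuous_intros)
next
  case (Suc k)
  obtain f' where f': "\<forall>x\<in>S. (f has_derivative f' x) (at x within S)" "\<forall>b\<in>Basis. Ck_on k S (\<lambda>x. f' x b)"
    using Suc.prems(1) by auto
  obtain g' where g': "\<forall>x\<in>S. (g has_derivative g' x) (at x within S)" "\<forall>b\<in>Basis. Ck_on k S (\<lambda>x. g' x b)"
    using Suc.prems(2) by auto
  show ?case unfolding Ck_on.simps
    by (intro exI[of _ "\<lambda>x h. f' x h + g' x h"] conjI ballI)
      (use f' g' Suc.IH in \<open>auto intro!: derivative_intros\<close>)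
qed

lemma Ck_on_mult: "Ck_on k S f \<Longrightarrow> Ck_on k S g \<Longrightarrow> Ck_on k S (\<lambda>x. f x * g x)"
proof (induction k arbitrary: f g)
  case 0
  then show ?case by (auto intro: continuous_intros)
next
  case (Suc k)
  obtain f' where f': "\<forall>x\<in>S. (f has_derivative f' x) (at x within S)" "\<forall>b\<in>Basis. Ck_on k S (\<lambda>x. f' x b)"
    using Suc.prems(1) by auto
  obtain g' where g': "\<forall>x\<in>S. (g has_derivative g' x) (at x within S)" "\<forall>b\<in>Basis. Ck_on k S (\<lambda>x. g' x b)"
    using Suc.prems(2) by auto
  show ?case unfolding Ck_on.simps
    by (intro exI[of _ "\<lambda>x h. f x * g' x h + f' x h * g x"] conjI ballI)
      (use f' g' Suc.IH Ck_on_SucD[OF Suc.prems(1)] Ck_on_SucD[OF Suc.prems(2)] in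
        \<open>auto intro!: derivative_intros Ck_on_add\<close>)
qed

text \<open>The derivative of \<open>1 / f\<close> contains \<open>1 / f\<close> again, but with one
  order of regularity less to prove; the induction on \<open>k\<close> feeds on this.\<close>

lemma Ck_on_inverse:
  assumes nz: "\<And>x. x \<in> S \<Longrightarrow> f x \<noteq> 0"
  shows "Ck_on k S f \<Longrightarrow> Ck_on k S (\<lambda>x. inverse (f x))"
proof (induction k)
  case 0
  then show ?case using nz by (auto intro: continuous_intros)
next
  case (Suc k)
  obtain f' where f': "\<forall>x\<in>S. (f has_derivative f' x) (at x within S)" "\<forall>b\<in>Basis. Ck_on k S (\<lambda>x. f' x b)"
    using Suc.prems by auto
  have "Ck_on k S (\<lambda>x. (-1) * (inverse (f x) * f' x b * inverse (f x)))" if "b \<in> Basis" for b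
    using Suc.IH[OF Ck_on_SucD[OF Suc.prems]] f' that by (intro Ck_on_mult Ck_on_const) auto
  then show ?case unfolding Ck_on.simps
    by (intro exI[of _ "\<lambda>x h. - (inverse (f x) * f' x h * inverse (f x))"] conjI ballI)
      (use f' nz in \<open>auto intro!: has_derivative_inverse\<close>)
qed

lemma Ck_on_cong_Suc:
  assumes "\<And>x. x \<in> S \<Longrightarrow> (f has_derivative f' x) (at x within S)" "\<And>b. b \<in> Basis \<Longrightarrow> Ck_on k S (\<lambda>x. f' x b)"
  shows "Ck_on (Suc k) S f"
  using assms by auto

lemma Ck_on_cong: "(\<And>x. x \<in> S \<Longrightarrow> f x = g x) \<Longrightarrow> Ck_on k S f \<Longrightarrow> Ck_on k S g"
proof (induction k)
  case 0
  then show ?case using continuous_on_cong[of S S f g] by simp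
next
  case (Suc k)
  then obtain f' where "\<forall>x\<in>S. (f has_derivative f' x) (at x within S)" "\<forall>b\<in>Basis. Ck_on k S (\<lambda>x. f' x b)"
    by auto
  then show ?case
    using has_derivative_transform[of _ S g f] Suc.prems(1) by (auto intro!: exI[of _ f'])
qed

abbreviation "off_axis \<equiv> {1::real..} \<times> (UNIV - {0::real^3})"

lemma norm_snd_has_derivative:
  fixes z :: "real \<times> (real^3)"
  assumes "snd z \<noteq> 0"
  shows "((\<lambda>z. norm (snd z)) has_derivative (\<lambda>h. snd h \<bullet> snd z * inverse (norm (snd z)))) (at z within S)"
proof -
  have "(norm has_derivative (\<lambda>h. h \<bullet> snd z * inverse (norm (snd z)))) (at (snd z))"
    using has_derivative_norm[OF assms] by (simp add: sgn_div_norm inner_commute divide_inverse mult.commute)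
  from has_derivative_compose[OF has_derivative_snd[OF has_derivative_ident] this] show ?thesis .
qed

lemma Ck_on_norm_snd: "Ck_on k off_axis (\<lambda>z. norm (snd z))"
proof (induction k)
  case (Suc k)
  show ?case
  proof (rule Ck_on_cong_Suc)
    show "((\<lambda>z. norm (snd z)) has_derivative (\<lambda>h. snd h \<bullet> snd z * inverse (norm (snd z)))) (at z within off_axis)"
      if "z \<in> off_axis" for z
      by (rule norm_snd_has_derivative) (use that in auto)
    show "Ck_on k off_axis (\<lambda>z. snd b \<bullet> snd z * inverse (norm (snd z)))" for b :: "real \<times> (real^3)"
      by (intro Ck_on_mult Ck_on_inverse Suc Ck_on_linear
           bounded_linear_compose[OF bounded_linear_inner_right bounded_linear_snd]) auto
  qed
qed (auto intro!: continuous_intros)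

lemma Ck_on_powr_fst: "Ck_on k off_axis (\<lambda>z. fst z powr a)"
proof (induction k arbitrary: a)
  case (Suc k)
  show ?case
  proof (rule Ck_on_cong_Suc)
    show "((\<lambda>z. fst z powr a) has_derivative (\<lambda>h. a * fst h * fst z powr (a - 1))) (at z within off_axis)"
      if "z \<in> off_axis" for z
      using that by (auto intro!: derivative_eq_intros simp: powr_diff field_simps)
    show "Ck_on k off_axis (\<lambda>z. a * fst b * fst z powr (a - 1))" for b :: "real \<times> (real^3)"
      by (intro Ck_on_mult Suc Ck_on_const)
  qed
qed (auto intro!: continuous_intros)

text \<open>The chain rule only adds factors \<open>x / \<bar>x\<bar>\<close>, smooth off the axis,
  so regularity in \<open>(t, x)\<close> is read off from the partials in
  \<open>(t, r)\<close>.\<close>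

lemma Ck_on_radial_Suc:
  assumes d: "\<And>t r. ((\<lambda>(t, r). V t r) has_derivative (\<lambda>(dt, dr). Vt t r * dt + Vr t r * dr)) (at (t, r))"
    and "Ck_on k off_axis (\<lambda>z. Vt (fst z) (norm (snd z)))" "Ck_on k off_axis (\<lambda>z. Vr (fst z) (norm (snd z)))"
  shows "Ck_on (Suc k) off_axis (\<lambda>z. V (fst z) (norm (snd z)))"
proof (rule Ck_on_cong_Suc)
  fix z :: "real \<times> (real^3)" assume z: "z \<in> off_axis"
  have n: "((\<lambda>z. (fst z, norm (snd z))) has_derivative (\<lambda>h. (fst h, snd h \<bullet> snd z * inverse (norm (snd z)))))
      (at z within off_axis)"
    using z by (intro has_derivative_Pair has_derivative_fst[OF has_derivative_ident] norm_snd_has_derivative) auto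
  have "((\<lambda>(t, r). V t r) has_derivative
      (\<lambda>(dt, dr). Vt (fst z) (norm (snd z)) * dt + Vr (fst z) (norm (snd z)) * dr)) (at (fst z, norm (snd z)))"
    by (rule d)
  from has_derivative_compose[OF n this]
  show "((\<lambda>z. V (fst z) (norm (snd z))) has_derivative
     (\<lambda>h. Vt (fst z) (norm (snd z)) * fst h
        + Vr (fst z) (norm (snd z)) * (snd h \<bullet> snd z * inverse (norm (snd z))))) (at z within off_axis)"
    by simp
next
  fix b :: "real \<times> (real^3)"
  show "Ck_on k off_axis (\<lambda>z. Vt (fst z) (norm (snd z)) * fst b
        + Vr (fst z) (norm (snd z)) * (snd b \<bullet> snd z * inverse (norm (snd z))))"
    by (intro Ck_on_add Ck_on_mult Ck_on_inverse Ck_on_norm_snd Ck_on_linear Ck_on_const assms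
         bounded_linear_compose[OF bounded_linear_inner_right bounded_linear_snd]) auto
qed

section \<open>The Laplacian of a radial function\<close>

lemma norm_line_deriv:
  fixes y :: "real^3" assumes "y \<noteq> 0"
  shows "((\<lambda>s. norm (y + s *\<^sub>R axis i 1)) has_real_derivative y $ i / norm y) (at 0)"
proof -
  have "((\<lambda>s. y + s *\<^sub>R axis i 1) has_derivative (\<lambda>s. s *\<^sub>R axis i 1)) (at 0)"
    by (auto intro!: derivative_eq_intros)
  moreover have "(norm has_derivative (\<bullet>) (sgn y)) (at (y + 0 *\<^sub>R axis i 1))"
    using has_derivative_norm[of y] assms by (simp add: inner_commute[of _ "sgn y"])
  ultimately have "((\<lambda>s. norm (y + s *\<^sub>R axis i 1)) has_derivative (\<lambda>s. sgn y \<bullet> (s *\<^sub>R axis i 1))) (at 0)"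
    by (rule has_derivative_compose)
  then have "((\<lambda>s. norm (y + s *\<^sub>R axis i 1)) has_derivative (\<lambda>s. y $ i / norm y * s)) (at 0)"
    by (simp add: sgn_div_norm inner_axis field_simps)
  then show ?thesis by (simp only: has_field_derivative_def)
qed

text \<open>The factor \<open>l\<close> is \<open>1\<close> for the first partial derivative and the
  coordinate \<open>y $ i\<close> for the second, so one computation covers both.\<close>

lemma deriv_radial_line:
  fixes y :: "real^3"
  assumes y: "y \<noteq> 0" and h: "(h has_real_derivative h1) (at (norm y))"
    and u: "\<And>y. y \<noteq> 0 \<Longrightarrow> u y = h (norm y) * l y"
    and l: "((\<lambda>s. l (y + s *\<^sub>R axis i 1)) has_real_derivative l') (at 0)"
  shows "deriv (\<lambda>s. u (y + s *\<^sub>R axis i 1)) 0 = h1 * (y $ i / norm y) * l y + h (norm y) * l'"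
proof (rule DERIV_imp_deriv)
  have "((\<lambda>s. h (norm (y + s *\<^sub>R axis i 1))) has_real_derivative h1 * (y $ i / norm y)) (at 0)"
    using DERIV_chain2[where f = h and g = "\<lambda>s. norm (y + s *\<^sub>R axis i 1)" and x = 0 and s = UNIV, OF _ norm_line_deriv[OF y]] h
    by simp
  from DERIV_mult[OF this l]
  have d: "((\<lambda>s. h (norm (y + s *\<^sub>R axis i 1)) * l (y + s *\<^sub>R axis i 1)) has_real_derivative
      h1 * (y $ i / norm y) * l y + h (norm y) * l') (at 0)" by (simp add: mult.commute)
  have "open ((\<lambda>s. y + s *\<^sub>R axis i 1) -` (- {0}))"
    by (intro open_vimage continuous_intros)
  then show "((\<lambda>s. u (y + s *\<^sub>R axis i 1)) has_real_derivative h1 * (y $ i / norm y) * l y + h (norm y) * l') (at 0)"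
    by (rule has_field_derivative_transform_within_open[OF d]) (use y u in auto)
qed

lemma laplacian_radial:
  fixes x :: "real^3"
  assumes x: "x \<noteq> 0" and u: "\<And>y. y \<noteq> 0 \<Longrightarrow> u y = h (norm y)"
    and h: "\<And>r. 0 < r \<Longrightarrow> (h has_real_derivative h1 r) (at r)"
    and h1: "\<And>r. 0 < r \<Longrightarrow> (h1 has_real_derivative h2 r) (at r)"
  shows "laplacian u x = h2 (norm x) + 2 / norm x * h1 (norm x)"
proof -
  have p: "partial_x i u y = h1 (norm y) / norm y * y $ i" if "y \<noteq> 0" for i y
    unfolding partial_x_def
    using deriv_radial_line[OF that h, of u "\<lambda>_. 1" i 0] u that by simp
  define \<rho> where "\<rho> = norm x"
  have \<rho>: "0 < \<rho>" using x by (simp add: \<rho>_def)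
  have "partial_x i (partial_x i u) x = (h2 \<rho> / \<rho>\<^sup>2 - h1 \<rho> / \<rho> ^ 3) * (x $ i)\<^sup>2 + h1 \<rho> / \<rho>" for i
  proof -
    have "((\<lambda>r. h1 r / r) has_real_derivative (h2 \<rho> * \<rho> - h1 \<rho>) / (\<rho> * \<rho>)) (at (norm x))"
      using DERIV_divide[OF h1[OF \<rho>] DERIV_ident] \<rho> by (simp add: \<rho>_def)
    moreover have "((\<lambda>s. (x + s *\<^sub>R axis i 1) $ i) has_real_derivative 1) (at 0)"
      by (auto intro!: derivative_eq_intros simp: axis_def)
    ultimately have "partial_x i (partial_x i u) x = (h2 \<rho> * \<rho> - h1 \<rho>) / (\<rho> * \<rho>) * (x $ i / norm x) * x $ i
        + h1 (norm x) / norm x * 1"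
      unfolding partial_x_def[of i "partial_x i u"] using x p by (intro deriv_radial_line) auto
    then show ?thesis using \<rho> unfolding \<rho>_def[symmetric] by (simp add: field_simps power2_eq_square power3_eq_cube)
  qed
  then have "laplacian u x = (h2 \<rho> / \<rho>\<^sup>2 - h1 \<rho> / \<rho> ^ 3) * (\<Sum>i\<in>UNIV. (x $ i)\<^sup>2) + 3 * (h1 \<rho> / \<rho>)"
    unfolding laplacian_def by (simp add: sum.distrib sum_distrib_left)
  also have "(\<Sum>i\<in>UNIV. (x $ i)\<^sup>2) = \<rho>\<^sup>2"
    by (simp add: \<rho>_def power2_norm_eq_inner inner_vec_def) (simp add: power2_eq_square)
  also have "(h2 \<rho> / \<rho>\<^sup>2 - h1 \<rho> / \<rho> ^ 3) * \<rho>\<^sup>2 = h2 \<rho> - h1 \<rho> / \<rho>"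
    using \<rho> by (simp add: left_diff_distrib power2_eq_square power3_eq_cube)
  finally show ?thesis using \<rho> unfolding \<rho>_def[symmetric] by (simp add: field_simps)
qed

lemma at_within_atLeast_neq_bot: "1 \<le> t \<Longrightarrow> at t within {1::real..} \<noteq> bot"
proof -
  assume "1 \<le> t"
  then have "{t<..<t + 1} \<subseteq> {1..}" by auto
  from islimpt_subset[OF islimpt_greaterThanLessThan1 this] show ?thesis
    by (simp add: trivial_limit_within)
qed

lemma partial_t_eq:
  assumes "1 \<le> t" and "((\<lambda>s. u s x) has_real_derivative d) (at t within {1..})"
  shows "partial_t u t x = d"
  unfolding partial_t_def
  using assms by (intro vector_derivative_within at_within_atLeast_neq_bot)
    (auto simp: has_real_derivative_iff_has_vector_derivative)

lemma has_derivative_partials: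
  assumes "((\<lambda>(t, r). V t r) has_derivative (\<lambda>(dt, dr). a * dt + b * dr)) (at (t, r::real))"
  shows "((\<lambda>t. V t r) has_real_derivative a) (at t)" "(V t has_real_derivative b) (at r)"
proof -
  have "((\<lambda>t. (t, r)) has_derivative (\<lambda>h. (h, 0))) (at t)" "((\<lambda>r. (t, r)) has_derivative (\<lambda>h. (0, h))) (at r)"
    by (auto intro!: derivative_eq_intros)
  from this[THEN has_derivative_compose, OF assms]
  show "((\<lambda>t. V t r) has_real_derivative a) (at t)" "(V t has_real_derivative b) (at r)"
    by (simp_all add: has_field_derivative_def)
qed

context cauchy_problem
begin

text \<open>The hypotheses are the initial conditions \<open>V = r * f\<close> and
  \<open>V\<^sub>t = r * (m * f + g)\<close> for \<open>V = t\<^sup>m * r * u\<close>. Continuity of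
  \<open>u\<close> on the axis is that of the mean \<open>W\<close>; off the axis \<open>u\<close>
  inherits class \<open>C\<^sup>2\<close> from \<open>V / r\<close>.\<close>

lemma radial_solution:
  assumes f: "\<And>x. mean 1 (norm x) P0 = f x"
    and g: "\<And>x. x \<noteq> 0 \<Longrightarrow> (P0 (1 + norm x) - P0 (1 - norm x)) / 2 = norm x * (m * f x + g x)"
  shows "\<exists>u. global_radial_solution (2 * m) p f g u"
proof -
  obtain W Vt Vr a b where W: "continuous_on UNIV (\<lambda>(t, r). W t r)"
    and a: "continuous_on UNIV (\<lambda>(t, r). a t r)" and b: "continuous_on UNIV (\<lambda>(t, r). b t r)"
    and dV: "\<forall>t r. ((\<lambda>(t, r). r * W t r) has_derivative (\<lambda>(dt, dr). Vt t r * dt + Vr t r * dr)) (at (t, r))"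
    and dVt: "\<forall>t r. ((\<lambda>(t, r). Vt t r) has_derivative
        (\<lambda>(dt, dr). (r * N t (W (clock t) r) + a t r) * dt + b t r * dr)) (at (t, r))"
    and dVr: "\<forall>t r. ((\<lambda>(t, r). Vr t r) has_derivative (\<lambda>(dt, dr). b t r * dt + a t r * dr)) (at (t, r))"
    and W1: "\<forall>r. W 1 r = mean 1 r P0" and Vt1: "\<forall>r. Vt 1 r = (P0 (1 + r) - P0 (1 - r)) / 2"
    using wave_solution by (elim exE conjE) (rule that; assumption)
  note dV = dV[rule_format] and dVt = dVt[rule_format] and dVr = dVr[rule_format]
    and W1 = W1[rule_format] and Vt1 = Vt1[rule_format]
  define V where "V t r = r * W t r" for t r
  note dVp = has_derivative_partials[OF dV, folded V_def] and dVtp = has_derivative_partials[OF dVt]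
    and dVrp = has_derivative_partials[OF dVr]
  define u :: "real \<Rightarrow> real^3 \<Rightarrow> real" where "u t x = t powr (- m) * W t (norm x)" for t x
  have cW: "continuous_on X (\<lambda>z. W (fst z) (norm (snd z)))" for X :: "(real \<times> (real^3)) set"
    by (intro continuous_on_case_prod_compose[OF W] continuous_intros)
  have "continuous_on ({1..} \<times> UNIV) (\<lambda>z. fst z powr (- m) * W (fst z) (norm (snd z :: real^3)))"
    by (intro continuous_intros cW) auto
  then have cont: "continuous_on ({1..} \<times> UNIV) (\<lambda>(t, x). u t x)"
    by (simp add: u_def case_prod_unfold)
  have C0: "Ck_on 0 off_axis (\<lambda>z. a (fst z) (norm (snd z)))" "Ck_on 0 off_axis (\<lambda>z. b (fst z) (norm (snd z)))"
    "Ck_on 0 off_axis (\<lambda>z. norm (snd z) * N (fst z) (W (clock (fst z)) (norm (snd z))) + a (fst z) (norm (snd z)))"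
    by (auto intro!: continuous_intros continuous_on_N continuous_on_case_prod_compose[OF W]
        continuous_on_case_prod_compose[OF a] continuous_on_case_prod_compose[OF b])
  have V2: "Ck_on (Suc (Suc 0)) off_axis (\<lambda>z. (\<lambda>t r. r * W t r) (fst z) (norm (snd z)))"
    by (rule Ck_on_radial_Suc[OF dV Ck_on_radial_Suc[OF dVt C0(3,2)] Ck_on_radial_Suc[OF dVr C0(2,1)]])
  have "Ck_on 2 off_axis (\<lambda>z. fst z powr (- m) * (inverse (norm (snd z)) * (norm (snd z) * W (fst z) (norm (snd z)))))"
    unfolding numeral_2_eq_2
    by (rule Ck_on_mult[OF Ck_on_powr_fst Ck_on_mult[OF Ck_on_inverse[OF _ Ck_on_norm_snd] V2]]) auto
  then have C2: "Ck_on 2 off_axis (\<lambda>(t, x). u t x)"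
    by (rule Ck_on_cong[rotated]) (auto simp: u_def field_simps)
  have pt: "partial_t u t x = t powr (- m) * (Vt t (norm x) - m * V t (norm x) / t) / norm x"
    if t: "1 \<le> t" and x: "x \<noteq> 0" for t x
  proof (rule partial_t_eq[OF t])
    have "((\<lambda>s. s powr (- m) * V s (norm x) / norm x) has_real_derivative
        t powr (- m) * (Vt t (norm x) - m * V t (norm x) / t) / norm x) (at t within {1..})"
      using t x by (auto intro!: derivative_eq_intros DERIV_subset[OF dVp(1)] simp: powr_diff field_simps)
    then show "((\<lambda>s. u s x) has_real_derivative
        t powr (- m) * (Vt t (norm x) - m * V t (norm x) / t) / norm x) (at t within {1..})"
      using x by (simp add: u_def V_def)
  qed
  have ptt: "partial_t (partial_t u) t x = t powr (- m) * (norm x * N t (W t (norm x)) + a t (norm x)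
      - 2 * m * Vt t (norm x) / t + m * (m + 1) * V t (norm x) / t\<^sup>2) / norm x"
    if t: "1 \<le> t" and x: "x \<noteq> 0" for t x
  proof (rule partial_t_eq[OF t])
    have "((\<lambda>s. s powr (- m) * (Vt s (norm x) - m * V s (norm x) / s) / norm x) has_real_derivative
        t powr (- m) * (norm x * N t (W t (norm x)) + a t (norm x)
      - 2 * m * Vt t (norm x) / t + m * (m + 1) * V t (norm x) / t\<^sup>2) / norm x) (at t within {1..})"
      using t x by (auto intro!: derivative_eq_intros DERIV_subset[OF dVp(1)] DERIV_subset[OF dVtp(1)]
          simp: clock_eq powr_diff field_simps power2_eq_square)
    then show "((\<lambda>s. partial_t u s x) has_real_derivative t powr (- m) * (norm x * N t (W t (norm x)) + a t (norm x)
      - 2 * m * Vt t (norm x) / t + m * (m + 1) * V t (norm x) / t\<^sup>2) / norm x) (at t within {1..})"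
      by (rule has_field_derivative_transform_within[OF _ zero_less_one]) (use t x pt in auto)
  qed
  have lap: "laplacian (u t) x = t powr (- m) * a t (norm x) / norm x" if x: "x \<noteq> 0" for t x
  proof -
    define h where "h r = t powr (- m) * V t r / r" for r
    define h1 where "h1 r = t powr (- m) * (Vr t r / r - V t r / r\<^sup>2)" for r
    define h2 where "h2 r = t powr (- m) * (a t r / r - 2 * Vr t r / r\<^sup>2 + 2 * V t r / r ^ 3)" for r
    have "laplacian (u t) x = h2 (norm x) + 2 / norm x * h1 (norm x)"
    proof (rule laplacian_radial[OF x])
      show "u t y = h (norm y)" if "y \<noteq> 0" for y using that by (simp add: u_def h_def V_def)
      show "(h has_real_derivative h1 r) (at r)" if "0 < r" for r
        unfolding h_def h1_def using that
        by (auto intro!: derivative_eq_intros dVp(2) simp: field_simps power2_eq_square)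
      show "(h1 has_real_derivative h2 r) (at r)" if "0 < r" for r
        unfolding h1_def h2_def using that
        by (auto intro!: derivative_eq_intros dVp(2) dVrp(2) simp: field_simps power2_eq_square power3_eq_cube)
    qed
    also have "\<dots> = t powr (- m) * a t (norm x) / norm x"
      using x by (simp add: h1_def h2_def field_simps power2_eq_square power3_eq_cube)
    finally show ?thesis .
  qed
  have pde: "partial_t (partial_t u) t x - laplacian (u t) x + 2 * m / t * partial_t u t x = \<bar>u t x\<bar> powr p"
    if t: "1 \<le> t" and x: "x \<noteq> 0" for t x
  proof -
    \<comment> \<open>The terms with \<open>a\<close> cancel against the Laplacian and those with
      \<open>V\<^sub>t\<close> against the damping; \<open>m * (m + 1) - 2 * m\<^sup>2\<close>
      leaves \<open>- m * (m - 1)\<close>, the linear part of \<open>N\<close>.\<close>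
    have "partial_t (partial_t u) t x - laplacian (u t) x + 2 * m / t * partial_t u t x =
        t powr (- m) * (N t (W t (norm x)) - m * (m - 1) * W t (norm x) / t\<^sup>2)"
      unfolding pt[OF that] ptt[OF that] lap[OF x] using t x
      by (simp add: V_def field_simps power2_eq_square)
    also have "\<dots> = t powr (- m) * (t powr (m - m * p) * \<bar>W t (norm x)\<bar> powr p)"
      by (simp add: N_def clock_eq[OF t])
    also have "\<dots> = t powr (- m * p) * \<bar>W t (norm x)\<bar> powr p"
      by (simp flip: powr_add mult.assoc)
    also have "\<dots> = \<bar>u t x\<bar> powr p"
      by (simp add: u_def abs_mult powr_mult powr_powr)
    finally show ?thesis .
  qed
  show ?thesis
    unfolding global_radial_solution_def
  proof (intro exI[of _ u] conjI allI impI cont C2 pde)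
    show "radial (u t)" for t by (simp add: radial_def u_def)
    show "u 1 x = f x" for x by (simp add: u_def W1 f)
    show "partial_t u 1 x = g x" if "x \<noteq> 0" for x
      using that by (simp add: pt V_def Vt1 W1 f g field_simps)
  qed
qed

end

section \<open>Uniqueness\<close>

lemma has_derivative_partials_within:
  assumes d: "((\<lambda>(t, r). V t r) has_derivative (\<lambda>(dt, dr). a * dt + b * dr)) (at (t, r::real) within X \<times> Y)"
    and tr: "t \<in> X" "r \<in> Y"
  shows "((\<lambda>t. V t r) has_real_derivative a) (at t within X)" "(V t has_real_derivative b) (at r within Y)"
proof -
  have "((\<lambda>t. (t, r)) has_derivative (\<lambda>h. (h, 0))) (at t within X)"
    by (auto intro!: derivative_eq_intros)
  from has_derivative_in_compose[OF this has_derivative_subset[OF d]] tr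
  show "((\<lambda>t. V t r) has_real_derivative a) (at t within X)"
    by (force simp: has_field_derivative_def)
  have "((\<lambda>r. (t, r)) has_derivative (\<lambda>h. (0, h))) (at r within Y)"
    by (auto intro!: derivative_eq_intros)
  from has_derivative_in_compose[OF this has_derivative_subset[OF d]] tr
  show "(V t has_real_derivative b) (at r within Y)"
    by (force simp: has_field_derivative_def)
qed

lemma has_derivative_along_line:
  assumes d: "((\<lambda>(t, r). V t r) has_derivative (\<lambda>(dt, dr). a * dt + b * dr)) (at (s, c + e * s))"
  shows "((\<lambda>s. V s (c + e * s)) has_real_derivative a + b * e) (at s)"
proof -
  have "((\<lambda>s. (s, c + e * s)) has_derivative (\<lambda>h. (h, e * h))) (at s)"
    by (auto intro!: derivative_eq_intros)
  from has_derivative_compose[OF this d] show ?thesis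
    by (simp add: has_field_derivative_def) (erule has_derivative_eq_rhs, simp add: fun_eq_iff algebra_simps)
qed

text \<open>At \<open>t = 1\<close> the time derivatives are one-sided. Writing
  \<open>k t s - k t \<rho>\<close> as an integral of \<open>kr\<close> and differentiating in
  \<open>t\<close> under the integral expresses \<open>kt t s - kt t \<rho>\<close> by
  \<open>kx'\<close>; differentiating in \<open>s\<close> gives the claim.\<close>

lemma mixed_partials_eq:
  fixes k kt kr kx kx' :: "real \<Rightarrow> real \<Rightarrow> real"
  assumes kt: "\<And>t r. 1 \<le> t \<Longrightarrow> 0 < r \<Longrightarrow> ((\<lambda>t. k t r) has_real_derivative kt t r) (at t within {1..})"
    and kr: "\<And>t r. 1 \<le> t \<Longrightarrow> 0 < r \<Longrightarrow> (k t has_real_derivative kr t r) (at r)"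
    and kx: "\<And>t r. 1 \<le> t \<Longrightarrow> 0 < r \<Longrightarrow> (kt t has_real_derivative kx t r) (at r)"
    and kx': "\<And>t r. 1 \<le> t \<Longrightarrow> 0 < r \<Longrightarrow> ((\<lambda>t. kr t r) has_real_derivative kx' t r) (at t within {1..})"
    and c: "continuous_on ({1..} \<times> {0<..}) (\<lambda>(t, r). kr t r)" "continuous_on ({1..} \<times> {0<..}) (\<lambda>(t, r). kx' t r)"
    and t: "1 \<le> t" and r: "0 < r"
  shows "kx t r = kx' t r"
proof -
  define \<rho> where "\<rho> = r / 2"
  have \<rho>: "0 < \<rho>" "\<rho> < r" using r by (auto simp: \<rho>_def)
  have eq: "kt t s - kt t \<rho> = integral {\<rho>..s} (kx' t)" if s: "\<rho> \<le> s" for s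
  proof -
    have "((\<lambda>t. k t s - k t \<rho>) has_real_derivative kt t s - kt t \<rho>) (at t within {1..})"
      using \<rho> s t by (intro derivative_intros kt) auto
    moreover have "((\<lambda>t. k t s - k t \<rho>) has_real_derivative integral {\<rho>..s} (kx' t)) (at t within {1..})"
    proof (rule has_field_derivative_transform_within[OF _ zero_less_one])
      show "((\<lambda>t. integral {\<rho>..s} (kr t)) has_real_derivative integral {\<rho>..s} (kx' t)) (at t within {1..})"
      proof (rule leibniz_rule_field_derivative[of "{1..}" \<rho> s, simplified])
        show "((\<lambda>t. kr t y) has_real_derivative kx' t y) (at t within {1..})"
          if "1 \<le> t" "\<rho> \<le> y \<and> y \<le> s" for t y using that \<rho> by (intro kx') auto
        show "kr t integrable_on {\<rho>..s}" if "1 \<le> t" for t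
        proof (rule integrable_continuous_interval)
          have "continuous_on {\<rho>..s} (\<lambda>y. (\<lambda>(t, r). kr t r) (t, y))"
            by (rule continuous_on_compose2[OF c(1)]) (use that \<rho> in \<open>auto intro!: continuous_intros\<close>)
          then show "continuous_on {\<rho>..s} (kr t)" by simp
        qed
        show "continuous_on ({1..} \<times> {\<rho>..s}) (\<lambda>(t, y). kx' t y)"
          by (rule continuous_on_subset[OF c(2)]) (use \<rho> in auto)
      qed (use t in auto)
      fix t' :: real assume t': "t' \<in> {1..}"
      have "(kr t' has_integral (k t' s - k t' \<rho>)) {\<rho>..s}"
      proof (rule fundamental_theorem_of_calculus[OF s])
        show "(k t' has_vector_derivative kr t' y) (at y within {\<rho>..s})" if "y \<in> {\<rho>..s}" for y
          using DERIV_subset[OF kr[of t' y], of "{\<rho>..s}"] that \<rho> t'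
          by (simp add: has_real_derivative_iff_has_vector_derivative)
      qed
      then show "integral {\<rho>..s} (kr t') = k t' s - k t' \<rho>" by (simp add: integral_unique)
    qed (use t in auto)
    ultimately show ?thesis
      using vector_derivative_unique_within[OF at_within_atLeast_neq_bot[OF t]]
      by (simp add: has_real_derivative_iff_has_vector_derivative)
  qed
  have "continuous_on {\<rho>..2 * r} (\<lambda>y. (\<lambda>(t, r). kx' t r) (t, y))"
    by (rule continuous_on_compose2[OF c(2)]) (use t \<rho> in \<open>auto intro!: continuous_intros\<close>)
  then have "continuous_on {\<rho>..2 * r} (kx' t)" by simp
  then have "((\<lambda>s. integral {\<rho>..s} (kx' t)) has_real_derivative kx' t r) (at r within {\<rho>..2 * r})"
    using \<rho> r by (intro integral_has_real_derivative) auto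
  then have "((\<lambda>s. integral {\<rho>..s} (kx' t)) has_real_derivative kx' t r) (at r)"
    using \<rho> r by (simp add: at_within_Icc_at)
  then have "((\<lambda>s. kt t s - kt t \<rho>) has_real_derivative kx' t r) (at r)"
    by (rule has_field_derivative_transform_within_open[of _ _ _ "{\<rho><..}"]) (use \<rho> eq in auto)
  moreover have "((\<lambda>s. kt t s - kt t \<rho>) has_real_derivative kx t r) (at r)"
    by (auto intro!: derivative_eq_intros kx t r)
  ultimately show ?thesis by (metis DERIV_unique)
qed

text \<open>Let \<open>K\<close> be the maximum of \<open>exp (- (l * t)) * \<bar>X\<bar>\<close> on
  a backward triangle. Integrating along incoming and then outgoing characteristics gains a factor
  \<open>1 / l\<close> each time, so \<open>K \<le> C * K / l\<^sup>2\<close>, and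
  \<open>l = 2 * C + 1\<close> forces \<open>K = 0\<close>.\<close>

lemma wave_unique:
  fixes X Xt Xr Xtt Xx Xrr :: "real \<Rightarrow> real \<Rightarrow> real"
  assumes dX: "\<And>t r. 1 < t \<Longrightarrow> 0 < r \<Longrightarrow>
      ((\<lambda>(t, r). X t r) has_derivative (\<lambda>(dt, dr). Xt t r * dt + Xr t r * dr)) (at (t, r))"
    and dXt: "\<And>t r. 1 < t \<Longrightarrow> 0 < r \<Longrightarrow>
      ((\<lambda>(t, r). Xt t r) has_derivative (\<lambda>(dt, dr). Xtt t r * dt + Xx t r * dr)) (at (t, r))"
    and dXr: "\<And>t r. 1 < t \<Longrightarrow> 0 < r \<Longrightarrow>
      ((\<lambda>(t, r). Xr t r) has_derivative (\<lambda>(dt, dr). Xx t r * dt + Xrr t r * dr)) (at (t, r))"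
    and cX: "continuous_on ({1..} \<times> {0..}) (\<lambda>(t, r). X t r)"
    and cXt: "continuous_on ({1..} \<times> {0<..}) (\<lambda>(t, r). Xt t r)"
    and cXr: "continuous_on ({1..} \<times> {0<..}) (\<lambda>(t, r). Xr t r)"
    and X0: "\<And>t. 1 \<le> t \<Longrightarrow> X t 0 = 0" and X1: "\<And>r. 0 \<le> r \<Longrightarrow> X 1 r = 0"
    and Y1: "\<And>r. 0 < r \<Longrightarrow> Xt 1 r + Xr 1 r = 0"
    and bound: "\<And>T. \<exists>C. \<forall>t r. 1 < t \<and> 0 < r \<and> t + r \<le> T \<longrightarrow> \<bar>Xtt t r - Xrr t r\<bar> \<le> C * \<bar>X t r\<bar>"
    and t0: "1 \<le> t0" and r0: "0 \<le> r0"
  shows "X t0 r0 = 0"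
proof -
  define T where "T = t0 + r0"
  \<comment> \<open>Incoming lines keep \<open>t + r\<close> and outgoing lines traced back decrease
    it, so neither leaves \<open>D\<close>.\<close>
  define D where "D = {z \<in> {1..T} \<times> {0..T}. fst z + snd z \<le> T}"
  obtain C0 where C0: "\<And>t r. 1 < t \<Longrightarrow> 0 < r \<Longrightarrow> t + r \<le> T \<Longrightarrow> \<bar>Xtt t r - Xrr t r\<bar> \<le> C0 * \<bar>X t r\<bar>"
    using bound[of T] by blast
  define C l where "C = max C0 0" and "l = 2 * C + 1"
  have C: "\<bar>Xtt t r - Xrr t r\<bar> \<le> C * \<bar>X t r\<bar>" if "1 < t" "0 < r" "t + r \<le> T" for t r
    using C0[OF that] mult_right_mono[of C0 C "\<bar>X t r\<bar>"] by (simp add: C_def)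
  have C_pos: "0 \<le> C" and l: "1 \<le> l" by (auto simp: C_def l_def)
  have "D = ({1..T} \<times> {0..T}) \<inter> {z. fst z + snd z \<le> T}" by (auto simp: D_def)
  then have "compact D"
    by (auto intro!: compact_Int_closed compact_Times closed_Collect_le continuous_intros)
  moreover have "(t0, r0) \<in> D" using t0 r0 by (simp add: D_def T_def)
  then have "D \<noteq> {}" by auto
  moreover have "continuous_on D (\<lambda>z. exp (- (l * fst z)) * \<bar>X (fst z) (snd z)\<bar>)"
  proof -
    have "continuous_on D (\<lambda>(t, r). X t r)"
      by (rule continuous_on_subset[OF cX]) (auto simp: D_def)
    then show ?thesis by (intro continuous_intros) (simp add: case_prod_unfold)
  qed
  ultimately obtain z where z: "z \<in> D" and
    zmax: "\<forall>y\<in>D. exp (- (l * fst y)) * \<bar>X (fst y) (snd y)\<bar> \<le> exp (- (l * fst z)) * \<bar>X (fst z) (snd z)\<bar>"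
    by (rule continuous_attains_sup[THEN bexE])
  define K where "K = exp (- (l * fst z)) * \<bar>X (fst z) (snd z)\<bar>"
  have K: "0 \<le> K" by (simp add: K_def)
  have XK: "\<bar>X t r\<bar> \<le> K * exp (l * t)" if "1 \<le> t" "0 \<le> r" "t + r \<le> T" for t r
  proof -
    have *: "exp (- (l * t)) * \<bar>X t r\<bar> \<le> K" using bspec[OF zmax, of "(t, r)"] that by (auto simp: D_def K_def)
    have "\<bar>X t r\<bar> = exp (l * t) * (exp (- (l * t)) * \<bar>X t r\<bar>)" by (simp add: exp_minus)
    also have "\<dots> \<le> exp (l * t) * K" using * by (rule mult_left_mono) simp
    finally show ?thesis by (simp add: mult.commute)
  qed
  have Y: "\<bar>Xt t r + Xr t r\<bar> \<le> C * K / l * exp (l * t)" if t: "1 \<le> t" and r: "0 < r" and T: "t + r \<le> T" for t r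
  proof -
    define Y where "Y s r = Xt s r + Xr s r" for s r
    define a where "a = t + r"
    have cY: "continuous_on ({1..} \<times> {0<..}) (\<lambda>(t, r). Y t r)"
      unfolding Y_def using continuous_on_add[OF cXt cXr] by (simp add: case_prod_unfold)
    have "\<bar>Y t (a + (-1) * t)\<bar> \<le> C * K / l * exp (l * t)"
    proof (rule abs_le_along[OF t, where \<phi>' = "\<lambda>s. Xtt s (a + (-1) * s) - Xrr s (a + (-1) * s)"
          and \<psi>' = "\<lambda>s. C * K * exp (l * s)"])
      have "continuous_on {1..t} (\<lambda>s. (\<lambda>(t, r). Y t r) (s, a + (-1) * s))"
        by (rule continuous_on_compose2[OF cY]) (use r in \<open>auto simp: a_def intro!: continuous_intros\<close>)
      then show "continuous_on {1..t} (\<lambda>s. Y s (a + (-1) * s))" by simp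
      show "continuous_on {1..t} (\<lambda>s. C * K / l * exp (l * s))" by (intro continuous_intros) (use l in auto)
      show "((\<lambda>s. C * K / l * exp (l * s)) has_real_derivative C * K * exp (l * s)) (at s)" for s
        using l by (auto intro!: derivative_eq_intros)
      fix s assume s: "1 < s" "s < t"
      have r': "0 < a + (-1) * s" using s r by (simp add: a_def)
      show "((\<lambda>s. Y s (a + (-1) * s)) has_real_derivative Xtt s (a + (-1) * s) - Xrr s (a + (-1) * s)) (at s)"
        using DERIV_add[OF has_derivative_along_line[OF dXt[OF s(1) r']] has_derivative_along_line[OF dXr[OF s(1) r']]]
        unfolding Y_def by simp
      have "C * \<bar>X s (a + (-1) * s)\<bar> \<le> C * (K * exp (l * s))"
        using s r' T C_pos by (intro mult_left_mono XK) (auto simp: a_def)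
      then show "\<bar>Xtt s (a + (-1) * s) - Xrr s (a + (-1) * s)\<bar> \<le> C * K * exp (l * s)"
        using C[OF s(1) r'] s T by (simp add: a_def)
    next
      have "Y 1 (a + (-1) * 1) = 0" using Y1[of "a - 1"] t r by (simp add: Y_def a_def)
      then show "\<bar>Y 1 (a + (-1) * 1)\<bar> \<le> C * K / l * exp (l * 1)" using C_pos K l by simp
    qed
    then show ?thesis by (simp add: Y_def a_def)
  qed
  have X: "\<bar>X t r\<bar> \<le> C * K / l / l * exp (l * t)" if t: "1 \<le> t" and r: "0 \<le> r" and T: "t + r \<le> T" for t r
  proof -
    define b s1 where "b = t - r" and "s1 = max 1 b"
    have s1: "1 \<le> s1" "b \<le> s1" "s1 \<le> t" using t r by (auto simp: s1_def b_def)
    have "\<bar>X t (- b + 1 * t)\<bar> \<le> C * K / l / l * exp (l * t)"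
    proof (rule abs_le_along[OF s1(3), where \<phi>' = "\<lambda>s. Xt s (- b + 1 * s) + Xr s (- b + 1 * s)"
          and \<psi>' = "\<lambda>s. C * K / l * exp (l * s)"])
      have "continuous_on {s1..t} (\<lambda>s. (\<lambda>(t, r). X t r) (s, - b + 1 * s))"
        by (rule continuous_on_compose2[OF cX]) (use s1 in \<open>auto intro!: continuous_intros\<close>)
      then show "continuous_on {s1..t} (\<lambda>s. X s (- b + 1 * s))" by simp
      show "continuous_on {s1..t} (\<lambda>s. C * K / l / l * exp (l * s))" by (intro continuous_intros) (use l in auto)
      show "((\<lambda>s. C * K / l / l * exp (l * s)) has_real_derivative C * K / l * exp (l * s)) (at s)" for s
        using l by (auto intro!: derivative_eq_intros)
      fix s assume s: "s1 < s" "s < t"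
      have r': "1 < s" "0 < - b + 1 * s" using s s1 by auto
      show "((\<lambda>s. X s (- b + 1 * s)) has_real_derivative Xt s (- b + 1 * s) + Xr s (- b + 1 * s)) (at s)"
        using has_derivative_along_line[OF dX[OF r']] by simp
      show "\<bar>Xt s (- b + 1 * s) + Xr s (- b + 1 * s)\<bar> \<le> C * K / l * exp (l * s)"
        by (rule Y) (use r' s T in \<open>auto simp: b_def\<close>)
    next
      have "X s1 (- b + 1 * s1) = 0"
        using X0[of b] X1[of "1 - b"] by (auto simp: s1_def max_def)
      then show "\<bar>X s1 (- b + 1 * s1)\<bar> \<le> C * K / l / l * exp (l * s1)" using C_pos K l by simp
    qed
    then show ?thesis by (simp add: b_def)
  qed
  have "K \<le> C * K / l / l"
  proof -
    have "exp (- (l * fst z)) * \<bar>X (fst z) (snd z)\<bar> \<le> exp (- (l * fst z)) * (C * K / l / l * exp (l * fst z))"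
      using z by (intro mult_left_mono X) (auto simp: D_def)
    also have "\<dots> = C * K / l / l * (exp (- (l * fst z)) * exp (l * fst z))" by simp
    also have "\<dots> = C * K / l / l" by (simp flip: exp_add)
    finally show ?thesis by (simp add: K_def)
  qed
  also have "C * K / l / l \<le> K / 2"
  proof -
    have "C * K * 2 \<le> K * l" using K C_pos by (simp add: l_def algebra_simps)
    also have "\<dots> \<le> K * l * l" using mult_left_mono[OF l, of "K * l"] K l by simp
    finally show ?thesis using l by (simp add: field_simps)
  qed
  finally have "K = 0" using K by simp
  then show ?thesis using XK[OF t0 r0] by (simp add: T_def)
qed

section \<open>Restriction of a solution to a ray\<close>

abbreviation e1 :: "real^3" where "e1 \<equiv> axis 1 1"

abbreviation "quadrant \<equiv> {1::real..} \<times> {0::real<..}"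

lemma Ck_on_ray:
  assumes "Ck_on (Suc j) off_axis F"
  obtains Ft Fr where "Ck_on j off_axis Ft" "Ck_on j off_axis Fr"
    "\<And>t r. 1 \<le> t \<Longrightarrow> 0 < r \<Longrightarrow> ((\<lambda>(t, r). F (t, r *\<^sub>R e1)) has_derivative
        (\<lambda>(dt, dr). Ft (t, r *\<^sub>R e1) * dt + Fr (t, r *\<^sub>R e1) * dr)) (at (t, r) within quadrant)"
proof -
  obtain F' where F': "\<forall>z\<in>off_axis. (F has_derivative F' z) (at z within off_axis)"
    "\<forall>b\<in>Basis. Ck_on j off_axis (\<lambda>z. F' z b)" using assms by auto
  have basis: "(1, 0) \<in> (Basis :: (real \<times> (real^3)) set)" "(0, e1) \<in> (Basis :: (real \<times> (real^3)) set)"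
    by (auto simp: Basis_prod_def axis_in_Basis_iff)
  show ?thesis
  proof (rule that[of "\<lambda>z. F' z (1, 0)" "\<lambda>z. F' z (0, e1)"])
    fix t r :: real assume tr: "1 \<le> t" "0 < r"
    have z: "(t, r *\<^sub>R e1) \<in> off_axis" using tr by (simp add: axis_eq_0_iff)
    then have d: "(F has_derivative F' (t, r *\<^sub>R e1)) (at (t, r *\<^sub>R e1) within off_axis)" using F' by blast
    then interpret lin: bounded_linear "F' (t, r *\<^sub>R e1)" by (rule has_derivative_bounded_linear)
    have "((\<lambda>z. (fst z, snd z *\<^sub>R e1)) has_derivative (\<lambda>h. (fst h, snd h *\<^sub>R e1))) (at (t, r) within quadrant)"
      by (auto intro!: derivative_eq_intros)
    then have "((\<lambda>z. F (fst z, snd z *\<^sub>R e1)) has_derivative (\<lambda>h. F' (t, r *\<^sub>R e1) (fst h, snd h *\<^sub>R e1)))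
        (at (t, r) within quadrant)"
    proof (rule has_derivative_in_compose[where g = F])
      have "(\<lambda>z. (fst z, snd z *\<^sub>R e1)) ` quadrant \<subseteq> off_axis" by (auto simp: axis_eq_0_iff)
      from has_derivative_subset[OF d this]
      show "(F has_derivative F' (t, r *\<^sub>R e1)) (at (fst (t, r), snd (t, r) *\<^sub>R e1)
          within (\<lambda>z. (fst z, snd z *\<^sub>R e1)) ` quadrant)" by simp
    qed
    moreover have "F' (t, r *\<^sub>R e1) (a, b *\<^sub>R e1) = F' (t, r *\<^sub>R e1) (1, 0) * a + F' (t, r *\<^sub>R e1) (0, e1) * b" for a b
      using lin.add[of "a *\<^sub>R (1, 0)" "b *\<^sub>R (0, e1)"] unfolding lin.scaleR by (simp add: mult.commute)
    ultimately show "((\<lambda>(t, r). F (t, r *\<^sub>R e1)) has_derivative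
        (\<lambda>(dt, dr). F' (t, r *\<^sub>R e1) (1, 0) * dt + F' (t, r *\<^sub>R e1) (0, e1) * dr)) (at (t, r) within quadrant)"
      by (simp add: case_prod_unfold)
  qed (use F' basis in auto)
qed

lemma continuous_on_ray:
  assumes "continuous_on off_axis F"
  shows "continuous_on quadrant (\<lambda>(t, r). F (t, r *\<^sub>R e1))"
proof -
  have "continuous_on quadrant (\<lambda>z. F (fst z, snd z *\<^sub>R e1))"
    by (rule continuous_on_compose2[OF assms]) (auto intro!: continuous_intros simp: axis_eq_0_iff)
  then show ?thesis by (simp add: case_prod_unfold)
qed

text \<open>Radial symmetry lets the ray through \<open>e1\<close> carry all information. The same
  mixed derivative \<open>kx\<close> serves both first derivatives, which is what cancels when
  \<open>\<partial>\<^sub>t - \<partial>\<^sub>r\<close> acts on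
  \<open>X\<^sub>t + X\<^sub>r\<close>.\<close>

lemma solution_profile:
  assumes sol: "global_radial_solution \<mu> p f g u"
  defines "k \<equiv> \<lambda>t r. u t (r *\<^sub>R e1)"
  obtains kt kr ktt kx krr where
    "\<And>t r. 1 \<le> t \<Longrightarrow> 0 < r \<Longrightarrow> ((\<lambda>(t, r). k t r) has_derivative (\<lambda>(dt, dr). kt t r * dt + kr t r * dr)) (at (t, r) within quadrant)"
    "\<And>t r. 1 \<le> t \<Longrightarrow> 0 < r \<Longrightarrow> ((\<lambda>(t, r). kt t r) has_derivative (\<lambda>(dt, dr). ktt t r * dt + kx t r * dr)) (at (t, r) within quadrant)"
    "\<And>t r. 1 \<le> t \<Longrightarrow> 0 < r \<Longrightarrow> ((\<lambda>(t, r). kr t r) has_derivative (\<lambda>(dt, dr). kx t r * dt + krr t r * dr)) (at (t, r) within quadrant)"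
    "\<And>t r. 1 \<le> t \<Longrightarrow> 0 < r \<Longrightarrow> ktt t r - krr t r - 2 / r * kr t r + \<mu> / t * kt t r = \<bar>k t r\<bar> powr p"
    "\<And>r. 0 < r \<Longrightarrow> kt 1 r = g (r *\<^sub>R e1)"
proof -
  define U where "U = (\<lambda>(t, x). u t x)"
  have C2: "Ck_on (Suc (Suc 0)) off_axis U"
    using sol by (simp add: global_radial_solution_def U_def numeral_2_eq_2)
  obtain Ut Ur where C1: "Ck_on (Suc 0) off_axis Ut" "Ck_on (Suc 0) off_axis Ur"
    and dU: "\<And>t r. 1 \<le> t \<Longrightarrow> 0 < r \<Longrightarrow> ((\<lambda>(t, r). U (t, r *\<^sub>R e1)) has_derivative
        (\<lambda>(dt, dr). Ut (t, r *\<^sub>R e1) * dt + Ur (t, r *\<^sub>R e1) * dr)) (at (t, r) within quadrant)"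
    by (rule Ck_on_ray[OF C2, OF that])
  obtain Utt Utr where "Ck_on 0 off_axis Utt" "Ck_on 0 off_axis Utr"
    and dUt: "\<And>t r. 1 \<le> t \<Longrightarrow> 0 < r \<Longrightarrow> ((\<lambda>(t, r). Ut (t, r *\<^sub>R e1)) has_derivative
        (\<lambda>(dt, dr). Utt (t, r *\<^sub>R e1) * dt + Utr (t, r *\<^sub>R e1) * dr)) (at (t, r) within quadrant)"
    by (rule Ck_on_ray[OF C1(1), OF that])
  obtain Urt Urr where cU: "Ck_on 0 off_axis Urt" "Ck_on 0 off_axis Urr"
    and dUr: "\<And>t r. 1 \<le> t \<Longrightarrow> 0 < r \<Longrightarrow> ((\<lambda>(t, r). Ur (t, r *\<^sub>R e1)) has_derivative
        (\<lambda>(dt, dr). Urt (t, r *\<^sub>R e1) * dt + Urr (t, r *\<^sub>R e1) * dr)) (at (t, r) within quadrant)"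
    by (rule Ck_on_ray[OF C1(2), OF that])
  have k: "U (t, r *\<^sub>R e1) = k t r" for t r by (simp add: U_def k_def)
  note d1 = has_derivative_partials_within[OF dU] and d2 = has_derivative_partials_within[OF dUt]
    and d3 = has_derivative_partials_within[OF dUr]
  have at_pos: "at r within {0<..} = at r" if "0 < r" for r :: real
    using that by (intro at_within_open) auto
  have mixed: "Utr (t, r *\<^sub>R e1) = Urt (t, r *\<^sub>R e1)" if "1 \<le> t" "0 < r" for t r
  proof (rule mixed_partials_eq[of "\<lambda>t r. U (t, r *\<^sub>R e1)" "\<lambda>t r. Ut (t, r *\<^sub>R e1)" "\<lambda>t r. Ur (t, r *\<^sub>R e1)"
        "\<lambda>t r. Utr (t, r *\<^sub>R e1)" "\<lambda>t r. Urt (t, r *\<^sub>R e1)"])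
    show "continuous_on quadrant (\<lambda>(t, r). Ur (t, r *\<^sub>R e1))" "continuous_on quadrant (\<lambda>(t, r). Urt (t, r *\<^sub>R e1))"
      by (intro continuous_on_ray Ck_on_imp_continuous_on[OF C1(2)] Ck_on_imp_continuous_on[OF cU(1)])+
  qed (use that d1 d2 d3 at_pos in auto)
  have norm_e: "norm (r *\<^sub>R e1) = r" "r *\<^sub>R e1 \<noteq> 0" if "0 < r" for r
    using that by (auto simp: axis_eq_0_iff)
  have pt: "partial_t u t (r *\<^sub>R e1) = Ut (t, r *\<^sub>R e1)" if "1 \<le> t" "0 < r" for t r
    using d1(1)[of t r] that by (intro partial_t_eq) (auto simp: U_def)
  show ?thesis
  proof (rule that)
    fix t r :: real assume tr: "1 \<le> t" "0 < r"
    show "((\<lambda>(t, r). k t r) has_derivative (\<lambda>(dt, dr). Ut (t, r *\<^sub>R e1) * dt + Ur (t, r *\<^sub>R e1) * dr)) (at (t, r) within quadrant)"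
      using dU[OF tr] by (simp add: k)
    show "((\<lambda>(t, r). Ut (t, r *\<^sub>R e1)) has_derivative
        (\<lambda>(dt, dr). Utt (t, r *\<^sub>R e1) * dt + Utr (t, r *\<^sub>R e1) * dr)) (at (t, r) within quadrant)" by (rule dUt[OF tr])
    show "((\<lambda>(t, r). Ur (t, r *\<^sub>R e1)) has_derivative
        (\<lambda>(dt, dr). Utr (t, r *\<^sub>R e1) * dt + Urr (t, r *\<^sub>R e1) * dr)) (at (t, r) within quadrant)"
      unfolding mixed[OF tr] by (rule dUr[OF tr])
    have "partial_t (partial_t u) t (r *\<^sub>R e1) = Utt (t, r *\<^sub>R e1)"
    proof (rule partial_t_eq[OF tr(1)])
      show "((\<lambda>s. partial_t u s (r *\<^sub>R e1)) has_real_derivative Utt (t, r *\<^sub>R e1)) (at t within {1..})"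
        by (rule has_field_derivative_transform_within[OF d2(1)[OF tr] zero_less_one]) (use tr pt in auto)
    qed
    moreover have "laplacian (u t) (r *\<^sub>R e1) = Urr (t, norm (r *\<^sub>R e1) *\<^sub>R e1)
        + 2 / norm (r *\<^sub>R e1) * Ur (t, norm (r *\<^sub>R e1) *\<^sub>R e1)"
    proof (rule laplacian_radial[where h = "\<lambda>r. U (t, r *\<^sub>R e1)"])
      have "radial (u t)" using sol tr by (simp add: global_radial_solution_def)
      moreover have "norm y = norm (norm y *\<^sub>R e1)" for y :: "real^3" by simp
      ultimately show "u t y = U (t, norm y *\<^sub>R e1)" for y
        unfolding radial_def U_def case_prod_conv by blast
      show "((\<lambda>r. U (t, r *\<^sub>R e1)) has_real_derivative Ur (t, r *\<^sub>R e1)) (at r)"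
        "((\<lambda>r. Ur (t, r *\<^sub>R e1)) has_real_derivative Urr (t, r *\<^sub>R e1)) (at r)" if "0 < r" for r
        using d1(2)[OF tr(1) that] d3(2)[OF tr(1) that] at_pos[OF that] tr that by auto
    qed (use norm_e tr in auto)
    moreover have "partial_t (partial_t u) t (r *\<^sub>R e1) - laplacian (u t) (r *\<^sub>R e1) + \<mu> / t * partial_t u t (r *\<^sub>R e1)
        = \<bar>u t (r *\<^sub>R e1)\<bar> powr p"
      using sol tr norm_e[OF tr(2)] by (simp add: global_radial_solution_def)
    ultimately show "Utt (t, r *\<^sub>R e1) - Urr (t, r *\<^sub>R e1) - 2 / r * Ur (t, r *\<^sub>R e1) + \<mu> / t * Ut (t, r *\<^sub>R e1) = \<bar>k t r\<bar> powr p"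
      using tr by (simp add: pt norm_e k_def)
  next
    fix r :: real assume "0 < r"
    then show "Ut (1, r *\<^sub>R e1) = g (r *\<^sub>R e1)"
      using sol norm_e[of r] pt[of 1 r] by (simp add: global_radial_solution_def)
  qed
qed

lemma at_within_quadrant: "1 < t \<Longrightarrow> 0 < r \<Longrightarrow> at (t, r) within quadrant = at (t, r)"
  by (rule at_within_interior, rule interiorI[of "{1<..} \<times> {0<..}"]) (auto intro: open_Times)

text \<open>On compact sets reaching the axis both solutions are bounded by continuity, so the power
  is Lipschitz there whatever their size. Then \<open>X = t\<^sup>m * r * (u - v)\<close> satisfies
  a locally linear bound, and the factor \<open>r\<close> makes it vanish on the axis.\<close>

lemma global_radial_solution_unique:
  assumes p: "1 < p" and u: "global_radial_solution (2 * m) p f g u" and v: "global_radial_solution (2 * m) p f g v"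
    and t: "1 \<le> t"
  shows "v t x = u t x"
proof -
  define ku where "ku t r = u t (r *\<^sub>R e1)" for t r
  define kv where "kv t r = v t (r *\<^sub>R e1)" for t r
  define d where "d t r = ku t r - kv t r" for t r
  obtain ut ur utt ux urr where
    U: "\<And>t r. 1 \<le> t \<Longrightarrow> 0 < r \<Longrightarrow> ((\<lambda>(t, r). ku t r) has_derivative (\<lambda>(dt, dr). ut t r * dt + ur t r * dr)) (at (t, r) within quadrant)"
    "\<And>t r. 1 \<le> t \<Longrightarrow> 0 < r \<Longrightarrow> ((\<lambda>(t, r). ut t r) has_derivative (\<lambda>(dt, dr). utt t r * dt + ux t r * dr)) (at (t, r) within quadrant)"
    "\<And>t r. 1 \<le> t \<Longrightarrow> 0 < r \<Longrightarrow> ((\<lambda>(t, r). ur t r) has_derivative (\<lambda>(dt, dr). ux t r * dt + urr t r * dr)) (at (t, r) within quadrant)"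
    and Ueq: "\<And>t r. 1 \<le> t \<Longrightarrow> 0 < r \<Longrightarrow> utt t r - urr t r - 2 / r * ur t r + 2 * m / t * ut t r = \<bar>ku t r\<bar> powr p"
    and U1: "\<And>r. 0 < r \<Longrightarrow> ut 1 r = g (r *\<^sub>R e1)"
    by (rule solution_profile[OF u, folded ku_def, OF that])
  obtain vt vr vtt vx vrr where
    V: "\<And>t r. 1 \<le> t \<Longrightarrow> 0 < r \<Longrightarrow> ((\<lambda>(t, r). kv t r) has_derivative (\<lambda>(dt, dr). vt t r * dt + vr t r * dr)) (at (t, r) within quadrant)"
    "\<And>t r. 1 \<le> t \<Longrightarrow> 0 < r \<Longrightarrow> ((\<lambda>(t, r). vt t r) has_derivative (\<lambda>(dt, dr). vtt t r * dt + vx t r * dr)) (at (t, r) within quadrant)"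
    "\<And>t r. 1 \<le> t \<Longrightarrow> 0 < r \<Longrightarrow> ((\<lambda>(t, r). vr t r) has_derivative (\<lambda>(dt, dr). vx t r * dt + vrr t r * dr)) (at (t, r) within quadrant)"
    and Veq: "\<And>t r. 1 \<le> t \<Longrightarrow> 0 < r \<Longrightarrow> vtt t r - vrr t r - 2 / r * vr t r + 2 * m / t * vt t r = \<bar>kv t r\<bar> powr p"
    and V1: "\<And>r. 0 < r \<Longrightarrow> vt 1 r = g (r *\<^sub>R e1)"
    by (rule solution_profile[OF v, folded kv_def, OF that])
  define dt where "dt t r = ut t r - vt t r" for t r
  define dr where "dr t r = ur t r - vr t r" for t r
  define dtt where "dtt t r = utt t r - vtt t r" for t r
  define dx where "dx t r = ux t r - vx t r" for t r
  define drr where "drr t r = urr t r - vrr t r" for t r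
  have D: "((\<lambda>(t, r). d t r) has_derivative (\<lambda>(h, k). dt t r * h + dr t r * k)) (at (t, r) within quadrant)"
    "((\<lambda>(t, r). dt t r) has_derivative (\<lambda>(h, k). dtt t r * h + dx t r * k)) (at (t, r) within quadrant)"
    "((\<lambda>(t, r). dr t r) has_derivative (\<lambda>(h, k). dx t r * h + drr t r * k)) (at (t, r) within quadrant)"
    if "1 \<le> t" "0 < r" for t r
    using has_derivative_diff[OF U(1)[OF that] V(1)[OF that]] has_derivative_diff[OF U(2)[OF that] V(2)[OF that]]
      has_derivative_diff[OF U(3)[OF that] V(3)[OF that]]
    by (simp_all add: d_def dt_def dr_def dtt_def dx_def drr_def case_prod_unfold algebra_simps)
  have cont0: "continuous_on ({1..} \<times> {0..}) (\<lambda>z. w (fst z) (snd z *\<^sub>R e1))"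
    if "global_radial_solution (2 * m) p f g w" for w
  proof -
    have "continuous_on ({1..} \<times> UNIV) (\<lambda>(t, x). w t x)" using that by (simp add: global_radial_solution_def)
    then have "continuous_on ({1..} \<times> {0..}) (\<lambda>z. (\<lambda>(t, x). w t x) (fst z, snd z *\<^sub>R e1))"
      by (rule continuous_on_compose2) (auto intro!: continuous_intros)
    then show ?thesis by simp
  qed
  have cku: "continuous_on ({1..} \<times> {0..}) (\<lambda>z. ku (fst z) (snd z))"
    and ckv: "continuous_on ({1..} \<times> {0..}) (\<lambda>z. kv (fst z) (snd z))"
    unfolding ku_def kv_def by (intro cont0 u v)+
  have cd: "continuous_on ({1..} \<times> {0..}) (\<lambda>z. d (fst z) (snd z))"
    unfolding d_def by (intro continuous_intros cku ckv)
  have d1: "d 1 r = 0" for r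
    using u v by (simp add: d_def ku_def kv_def global_radial_solution_def)
  have dt1: "dt 1 r = 0" if "0 < r" for r using U1[OF that] V1[OF that] by (simp add: dt_def)
  have dr1: "dr 1 r = 0" if "0 < r" for r
  proof -
    have "(d 1 has_real_derivative dr 1 r) (at r within {0<..})"
      by (rule has_derivative_partials_within(2)[OF D(1)]) (use that in auto)
    moreover have "at r within {0<..} = at r" using that by (intro at_within_open) auto
    moreover have "d 1 = (\<lambda>_. 0)" by (intro ext d1)
    ultimately have "((\<lambda>_. 0) has_real_derivative dr 1 r) (at r)" by (simp only:)
    then show ?thesis by (rule DERIV_unique[OF _ DERIV_const])
  qed
  define X where "X t r = t powr m * r * d t r" for t r
  define Xt where "Xt t r = t powr m * r * (dt t r + m * d t r / t)" for t r
  define Xr where "Xr t r = t powr m * (d t r + r * dr t r)" for t r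
  define Xtt where "Xtt t r = t powr m * r * (dtt t r + 2 * m * dt t r / t + m * (m - 1) * d t r / t\<^sup>2)" for t r
  define Xx where "Xx t r = t powr m * (dt t r + m * d t r / t + r * dx t r + r * m * dr t r / t)" for t r
  define Xrr where "Xrr t r = t powr m * (2 * dr t r + r * drr t r)" for t r
  have X0: "X t r = 0" if tr: "1 \<le> t" "0 \<le> r" for t r
  proof (rule wave_unique[of X Xt Xr Xtt Xx Xrr])
    fix t r :: real assume tr: "1 < t" "0 < r"
    note D' = D[OF less_imp_le[OF tr(1)] tr(2), unfolded at_within_quadrant[OF tr] case_prod_unfold]
    show "((\<lambda>(t, r). X t r) has_derivative (\<lambda>(dt, dr). Xt t r * dt + Xr t r * dr)) (at (t, r))"
      unfolding X_def Xt_def Xr_def case_prod_unfold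
      apply (rule derivative_eq_intros D' refl | (use tr in simp; fail))+
      using tr by (auto simp: fun_eq_iff powr_diff field_simps)
    show "((\<lambda>(t, r). Xt t r) has_derivative (\<lambda>(dt, dr). Xtt t r * dt + Xx t r * dr)) (at (t, r))"
      unfolding Xt_def Xtt_def Xx_def case_prod_unfold
      apply (rule derivative_eq_intros D' refl | (use tr in simp; fail))+
      using tr by (auto simp: fun_eq_iff powr_diff field_simps power2_eq_square)
    show "((\<lambda>(t, r). Xr t r) has_derivative (\<lambda>(dt, dr). Xx t r * dt + Xrr t r * dr)) (at (t, r))"
      unfolding Xr_def Xrr_def Xx_def case_prod_unfold
      apply (rule derivative_eq_intros D' refl | (use tr in simp; fail))+
      using tr by (auto simp: fun_eq_iff powr_diff field_simps)
  next
    have cD: "continuous_on quadrant (\<lambda>(t, r). d t r)" "continuous_on quadrant (\<lambda>(t, r). dt t r)"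
      "continuous_on quadrant (\<lambda>(t, r). dr t r)"
      by (rule has_derivative_continuous_on[where f' = "\<lambda>(t, r) (h, k). dt t r * h + dr t r * k"], use D(1) in force)
         (rule has_derivative_continuous_on[where f' = "\<lambda>(t, r) (h, k). dtt t r * h + dx t r * k"], use D(2) in force,
          rule has_derivative_continuous_on[where f' = "\<lambda>(t, r) (h, k). dx t r * h + drr t r * k"], use D(3) in force)
    show "continuous_on ({1..} \<times> {0..}) (\<lambda>(t, r). X t r)"
      unfolding X_def case_prod_unfold by (intro continuous_intros cd) auto
    show "continuous_on quadrant (\<lambda>(t, r). Xt t r)" "continuous_on quadrant (\<lambda>(t, r). Xr t r)"
      unfolding Xt_def Xr_def case_prod_unfold
      by (intro continuous_intros cD[unfolded case_prod_unfold]; auto)+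
    show "X t 0 = 0" for t by (simp add: X_def)
    show "X 1 r = 0" for r by (simp add: X_def d1)
    show "Xt 1 r + Xr 1 r = 0" if "0 < r" for r by (simp add: Xt_def Xr_def d1 dt1 dr1 that)
    fix T :: real
    define B where "B = {1..T} \<times> {0..T}"
    have "compact ((\<lambda>z. ku (fst z) (snd z)) ` B)" "compact ((\<lambda>z. kv (fst z) (snd z)) ` B)"
      unfolding B_def
      by (intro compact_continuous_image continuous_on_subset[OF cku] continuous_on_subset[OF ckv] compact_Times; auto)+
    then have "bounded ((\<lambda>z. ku (fst z) (snd z)) ` B \<union> (\<lambda>z. kv (fst z) (snd z)) ` B)"
      by (simp add: compact_imp_bounded)
    then obtain M where M: "\<And>t r. (t, r) \<in> B \<Longrightarrow> \<bar>ku t r\<bar> \<le> M" "\<And>t r. (t, r) \<in> B \<Longrightarrow> \<bar>kv t r\<bar> \<le> M"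
      unfolding bounded_iff by (auto simp: ball_Un) force
    show "\<exists>C. \<forall>t r. 1 < t \<and> 0 < r \<and> t + r \<le> T \<longrightarrow> \<bar>Xtt t r - Xrr t r\<bar> \<le> C * \<bar>X t r\<bar>"
    proof (intro exI[of _ "p * M powr (p - 1) + \<bar>m * (m - 1)\<bar>"] allI impI, elim conjE)
      fix t r assume tr: "1 < t" "0 < r" "t + r \<le> T"
      have B: "(t, r) \<in> B" using tr by (simp add: B_def)
      have "dtt t r - drr t r - 2 / r * dr t r + 2 * m / t * dt t r = \<bar>ku t r\<bar> powr p - \<bar>kv t r\<bar> powr p"
        using Ueq[of t r] Veq[of t r] tr unfolding dtt_def drr_def dr_def dt_def by (simp add: algebra_simps diff_divide_distrib)
      then have eq: "dtt t r = drr t r + 2 / r * dr t r - 2 * m / t * dt t r + (\<bar>ku t r\<bar> powr p - \<bar>kv t r\<bar> powr p)"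
        by simp
      have "Xtt t r - Xrr t r = t powr m * r * ((\<bar>ku t r\<bar> powr p - \<bar>kv t r\<bar> powr p) + m * (m - 1) * d t r / t\<^sup>2)"
        unfolding Xtt_def Xrr_def eq using tr by (simp add: field_simps)
      then have "\<bar>Xtt t r - Xrr t r\<bar> = t powr m * r * \<bar>(\<bar>ku t r\<bar> powr p - \<bar>kv t r\<bar> powr p) + m * (m - 1) * d t r / t\<^sup>2\<bar>"
        using tr by (simp add: abs_mult)
      also have "\<bar>(\<bar>ku t r\<bar> powr p - \<bar>kv t r\<bar> powr p) + m * (m - 1) * d t r / t\<^sup>2\<bar> \<le>
          p * M powr (p - 1) * \<bar>d t r\<bar> + \<bar>m * (m - 1)\<bar> * \<bar>d t r\<bar>"
      proof -
        have "\<bar>m * (m - 1) * d t r / t\<^sup>2\<bar> = \<bar>m * (m - 1)\<bar> * \<bar>d t r\<bar> / t\<^sup>2" by (simp add: abs_mult)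
        also have "\<dots> \<le> \<bar>m * (m - 1)\<bar> * \<bar>d t r\<bar> / 1" using tr by (intro divide_left_mono) (auto simp: one_le_power)
        finally show ?thesis
          using abs_powr_lipschitz[OF p M(1)[OF B] M(2)[OF B]] unfolding d_def by linarith
      qed
      finally show "\<bar>Xtt t r - Xrr t r\<bar> \<le> (p * M powr (p - 1) + \<bar>m * (m - 1)\<bar>) * \<bar>X t r\<bar>"
        using tr by (simp add: X_def abs_mult algebra_simps)
    qed
  qed (use tr in auto)
  have d_pos: "d t r = 0" if "r \<in> {0<..}" for r
    using X0[OF t, of r] that t by (simp add: X_def)
  \<comment> \<open>At \<open>r = 0\<close> the vanishing of \<open>X\<close> says nothing about
    \<open>d\<close>; the value there comes from continuity.\<close>
  have "continuous_on (closure {0<..}) (\<lambda>r. d (fst (t, r)) (snd (t, r)))"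
    by (rule continuous_on_compose2[OF cd]) (use t in \<open>auto intro!: continuous_intros\<close>)
  then have "continuous_on (closure {0<..}) (d t)" by simp
  then have "d t (norm x) = 0"
    by (rule continuous_constant_on_closure[OF _ d_pos]) auto
  moreover have "radial (u t)" "radial (v t)" using u v t by (auto simp: global_radial_solution_def)
  then have "u t x = ku t (norm x)" "v t x = kv t (norm x)"
  proof -
    have "norm x = norm (norm x *\<^sub>R e1)" by simp
    then show "u t x = ku t (norm x)" "v t x = kv t (norm x)"
      using \<open>radial (u t)\<close> \<open>radial (v t)\<close> unfolding radial_def ku_def kv_def by blast+
  qed
  ultimately show ?thesis by (simp add: d_def)
qed

section \<open>Data and conclusion\<close>

text \<open>As \<open>p > 1\<close>, the left side of the first condition is of higher order in
  \<open>\<delta>\<close>; \<open>B\<close> is the threshold for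
  \<open>\<delta> powr (p - 1)\<close>.\<close>

lemma (in damping) exists_delta:
  "\<exists>\<delta>>0. (\<delta> * A) powr p * \<eta> powr (1 - \<nu> - (2 - m) * p) \<le> 4 * \<kappa> * \<nu> * \<delta> \<and> \<delta> * A * \<eta> powr (m - 2) \<le> 1"
proof -
  define c B where "c = A powr p * \<eta> powr (1 - \<nu> - (2 - m) * p)" and "B = 4 * \<kappa> * \<nu> / c"
  define \<delta> where "\<delta> = min (B powr (1 / (p - 1))) (1 / (A * \<eta> powr (m - 2)))"
  have c: "0 < c" and B: "0 < B" using A_pos eta kappa_pos nu_pos by (auto simp: c_def B_def)
  have \<delta>: "0 < \<delta>" using A_pos eta B by (simp add: \<delta>_def)
  have "\<delta> powr (p - 1) \<le> (B powr (1 / (p - 1))) powr (p - 1)"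
    using \<delta> p_gt by (intro powr_mono2) (auto simp: \<delta>_def)
  also have "\<dots> = B" using B p_gt by (simp add: powr_powr)
  finally have le: "\<delta> powr (p - 1) \<le> B" .
  have "(\<delta> * A) powr p * \<eta> powr (1 - \<nu> - (2 - m) * p) = \<delta> powr (1 + (p - 1)) * c"
    using \<delta> A_pos by (simp add: powr_mult c_def)
  also have "\<dots> = \<delta> * \<delta> powr (p - 1) * c" using \<delta> unfolding powr_add by simp
  also have "\<dots> \<le> \<delta> * B * c" using le \<delta> c by simp
  also have "\<dots> = 4 * \<kappa> * \<nu> * \<delta>" using c by (simp add: B_def)
  finally have 1: "(\<delta> * A) powr p * \<eta> powr (1 - \<nu> - (2 - m) * p) \<le> 4 * \<kappa> * \<nu> * \<delta>" .
  have "\<delta> * (A * \<eta> powr (m - 2)) \<le> 1 / (A * \<eta> powr (m - 2)) * (A * \<eta> powr (m - 2))"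
    using A_pos by (intro mult_right_mono) (auto simp: \<delta>_def)
  also have "\<dots> = 1" using A_pos eta by simp
  finally show ?thesis using 1 \<delta> by (auto simp: mult.assoc)
qed

lemma Ck_on_UNIV_ray:
  fixes u :: "real^3 \<Rightarrow> real"
  assumes "Ck_on (Suc k) UNIV u"
  shows "\<exists>d. Ck_on k UNIV d \<and> (\<forall>r. ((\<lambda>r. u (r *\<^sub>R e1)) has_real_derivative d (r *\<^sub>R e1)) (at r))"
proof -
  obtain u' where u': "\<forall>x. (u has_derivative u' x) (at x)" "\<forall>b\<in>Basis. Ck_on k UNIV (\<lambda>x. u' x b)"
    using assms by auto
  have "((\<lambda>r. u (r *\<^sub>R e1)) has_real_derivative u' (r *\<^sub>R e1) e1) (at r)" for r
  proof -
    have d: "(u has_derivative u' (r *\<^sub>R e1)) (at (r *\<^sub>R e1))" using u' by blast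
    then interpret lin: bounded_linear "u' (r *\<^sub>R e1)" by (rule has_derivative_bounded_linear)
    have "((\<lambda>r. r *\<^sub>R e1) has_derivative (\<lambda>h. h *\<^sub>R e1)) (at r)" by (auto intro!: derivative_eq_intros)
    from has_derivative_compose[OF this d]
    have "((\<lambda>r. u (r *\<^sub>R e1)) has_derivative (\<lambda>h. u' (r *\<^sub>R e1) e1 * h)) (at r)"
      by (simp add: lin.scaleR mult.commute)
    then show ?thesis by (simp only: has_field_derivative_def)
  qed
  moreover have "Ck_on k UNIV (\<lambda>x. u' x e1)" using u' by (simp add: axis_in_Basis_iff)
  ultimately show ?thesis by blast
qed

text \<open>Compactness turns support in the open ball into a radius strictly below one, which
  leaves room for \<open>\<eta>\<close>.\<close>

lemma support_radius:
  fixes u0 u1 :: "real^3 \<Rightarrow> real"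
  assumes "compact (supp u0)" "compact (supp u1)" "supp u0 \<union> supp u1 \<subseteq> ball 0 1"
  shows "\<exists>\<rho>. 0 \<le> \<rho> \<and> \<rho> < 1 \<and> (\<forall>x. \<rho> < norm x \<longrightarrow> u0 x = 0 \<and> u1 x = 0)"
proof (cases "supp u0 \<union> supp u1 = {}")
  case True
  then have "u0 x = 0 \<and> u1 x = 0" for x
    using closure_subset[of "{x. u0 x \<noteq> 0}"] closure_subset[of "{x. u1 x \<noteq> 0}"] by (auto simp: supp_def)
  then show ?thesis by (intro exI[of _ 0]) auto
next
  case False
  obtain z where z: "z \<in> supp u0 \<union> supp u1" "\<forall>y\<in>supp u0 \<union> supp u1. norm y \<le> norm z"
    using continuous_attains_sup[OF compact_Un[OF assms(1,2)] False continuous_on_norm_id] by blast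
  have "u0 x = 0 \<and> u1 x = 0" if "norm z < norm x" for x
  proof -
    have "x \<notin> supp u0" "x \<notin> supp u1" using that z(2) by force+
    then show ?thesis
      using closure_subset[of "{x. u0 x \<noteq> 0}"] closure_subset[of "{x. u1 x \<noteq> 0}"] by (auto simp: supp_def)
  qed
  moreover have "norm z < 1" using z(1) assms(3) by auto
  ultimately show ?thesis by (intro exI[of _ "norm z"]) auto
qed

theorem theorem1p1:
  fixes \<mu> p :: real and u0 u1 :: "real^3 \<Rightarrow> real"
  assumes "14 / 5 \<le> \<mu>" and "\<mu> < 3"
    and "5 / 3 < p" and "p \<le> 1 + 2 / \<mu>"
    and "Cinf_compact_support u0" and "Cinf_compact_support u1"
    and "radial u0" and "radial u1"
    and "supp u0 \<union> supp u1 \<subseteq> ball 0 1"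
  shows "\<exists>\<epsilon>0>0. \<forall>\<epsilon>. 0 < \<epsilon> \<and> \<epsilon> \<le> \<epsilon>0 \<longrightarrow>
    (\<exists>u. global_radial_solution \<mu> p (\<lambda>x. \<epsilon> * u0 x) (\<lambda>x. \<epsilon> * u1 x) u \<and>
         (\<forall>v. global_radial_solution \<mu> p (\<lambda>x. \<epsilon> * u0 x) (\<lambda>x. \<epsilon> * u1 x) v \<longrightarrow>
              (\<forall>t\<ge>1. \<forall>x. v t x = u t x)))"
proof -
  define m where "m = \<mu> / 2"
  obtain \<rho> where \<rho>: "0 \<le> \<rho>" "\<rho> < 1" "\<And>x. \<rho> < norm x \<Longrightarrow> u0 x = 0" "\<And>x. \<rho> < norm x \<Longrightarrow> u1 x = 0"
    using support_radius[of u0 u1] assms(5,6,9) by (auto simp: Cinf_compact_support_def)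
  define \<eta> where "\<eta> = (1 - \<rho>) / 2"
  have \<eta>: "0 < \<eta>" "\<eta> < 1" "\<rho> < 1 - \<eta>" using \<rho>(1,2) by (auto simp: \<eta>_def field_simps)
  interpret damping m p \<eta>
    using assms(1-4) \<eta> by unfold_locales (auto simp: m_def)
  obtain \<delta> where \<delta>: "0 < \<delta>" "(\<delta> * A) powr p * \<eta> powr (1 - \<nu> - (2 - m) * p) \<le> 4 * \<kappa> * \<nu> * \<delta>"
    "\<delta> * A * \<eta> powr (m - 2) \<le> 1" using exists_delta by blast
  define \<phi>0 where "\<phi>0 r = u0 (r *\<^sub>R e1)" for r
  define \<phi>1 where "\<phi>1 r = u1 (r *\<^sub>R e1)" for r
  have smooth: "Ck_on (Suc (Suc 0)) UNIV u0" "Ck_on (Suc 0) UNIV u1"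
    using assms(5,6) unfolding Cinf_compact_support_def by blast+
  obtain d0 where d0: "Ck_on (Suc 0) UNIV d0" "\<forall>r. (\<phi>0 has_real_derivative d0 (r *\<^sub>R e1)) (at r)"
    using Ck_on_UNIV_ray[OF smooth(1)] unfolding \<phi>0_def by blast
  obtain d00 where d00: "Ck_on 0 UNIV d00" "\<forall>r. ((\<lambda>r. d0 (r *\<^sub>R e1)) has_real_derivative d00 (r *\<^sub>R e1)) (at r)"
    using Ck_on_UNIV_ray[OF d0(1)] by blast
  obtain d1 where d1: "Ck_on 0 UNIV d1" "\<forall>r. (\<phi>1 has_real_derivative d1 (r *\<^sub>R e1)) (at r)"
    using Ck_on_UNIV_ray[OF smooth(2)] unfolding \<phi>1_def by blast
  define \<phi>0' where "\<phi>0' r = d0 (r *\<^sub>R e1)" for r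
  define \<phi>0'' where "\<phi>0'' r = d00 (r *\<^sub>R e1)" for r
  define \<phi>1' where "\<phi>1' r = d1 (r *\<^sub>R e1)" for r
  have D: "(\<phi>0 has_real_derivative \<phi>0' r) (at r)" "(\<phi>0' has_real_derivative \<phi>0'' r) (at r)"
    "(\<phi>1 has_real_derivative \<phi>1' r) (at r)" for r
    using d0(2) d00(2) d1(2) unfolding \<phi>0'_def \<phi>0''_def \<phi>1'_def by blast+
  have C: "continuous_on X \<phi>0" "continuous_on X \<phi>0'" "continuous_on X \<phi>1" for X
    by (rule DERIV_continuous_on[OF DERIV_subset[OF D(1)]], simp,
        rule DERIV_continuous_on[OF DERIV_subset[OF D(2)]], simp,
        rule DERIV_continuous_on[OF DERIV_subset[OF D(3)]], simp)
  have C': "continuous_on X \<phi>0''" "continuous_on X \<phi>1'" for X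
    unfolding \<phi>0''_def \<phi>1'_def using d00(1) d1(1)
    by (auto intro!: continuous_on_compose2[of UNIV d00] continuous_on_compose2[of UNIV d1] continuous_intros)
  have even: "\<phi>0 (- r) = \<phi>0 r" "\<phi>1 (- r) = \<phi>1 r" for r
    using assms(7,8) unfolding \<phi>0_def \<phi>1_def radial_def by (metis norm_minus_cancel scaleR_minus_left)+
  have odd': "\<phi>0' (- r) = - \<phi>0' r" for r
  proof -
    have "((\<lambda>x. \<phi>0 (- x)) has_real_derivative - \<phi>0' (- r)) (at r)" using D(1)[of "- r"] by (simp add: DERIV_mirror)
    then have "(\<phi>0 has_real_derivative - \<phi>0' (- r)) (at r)" by (simp add: even)
    from DERIV_unique[OF this D(1)] show ?thesis by simp
  qed
  have Z: "\<phi>0 r = 0" "\<phi>1 r = 0" if "\<rho> < \<bar>r\<bar>" for r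
    using that \<rho>(3,4) by (auto simp: \<phi>0_def \<phi>1_def)
  have Z': "\<phi>0' r = 0" if r: "\<rho> < \<bar>r\<bar>" for r
  proof -
    have "open {r. \<rho> < \<bar>r\<bar>}" by (intro open_Collect_less continuous_intros)
    then have "((\<lambda>_. 0) has_real_derivative \<phi>0' r) (at r)"
      by (rule has_field_derivative_transform_within_open[OF D(1)]) (use r Z in auto)
    then show ?thesis by (rule DERIV_unique[OF _ DERIV_const])
  qed
  \<comment> \<open>\<open>V\<^sub>t + V\<^sub>r\<close> at \<open>t = 1\<close> for
    \<open>V = t\<^sup>m * r * u\<close> and \<open>\<epsilon> = 1\<close>: the derivative of
    \<open>y * \<phi>0 y\<close> plus the odd part coming from \<open>V\<^sub>t\<close>.\<close>
  define q where "q y = \<phi>0 y + y * \<phi>0' y + m * y * \<phi>0 y + y * \<phi>1 y" for y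
  have q0: "q y = 0" if "\<rho> < \<bar>y\<bar>" for y using Z[OF that] Z'[OF that] by (simp add: q_def)
  have "bounded (q ` {-1..1})"
    unfolding q_def by (intro compact_imp_bounded compact_continuous_image continuous_intros C) auto
  then obtain Q where Q: "\<And>y. y \<in> {-1..1} \<Longrightarrow> \<bar>q y\<bar> \<le> Q" by (fastforce simp: bounded_iff)
  have Q0: "0 \<le> Q" using Q[of 0] by auto
  have qQ: "\<bar>q y\<bar> \<le> Q" for y using Q[of y] q0[of y] Q0 \<rho>(1,2) by (cases "y \<in> {-1..1}") auto
  \<comment> \<open>Chosen so that \<open>\<epsilon> * Q\<close> meets the bound
    \<open>\<delta> * \<eta> / 2\<close> on \<open>P0\<close>; the \<open>+ 1\<close> covers
    \<open>Q = 0\<close>.\<close>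
  define \<epsilon>0 where "\<epsilon>0 = \<delta> * \<eta> / 2 / (Q + 1)"
  show ?thesis
  proof (intro exI[of _ \<epsilon>0] conjI allI impI)
    show "0 < \<epsilon>0" using \<delta> \<eta> Q0 by (simp add: \<epsilon>0_def)
    fix \<epsilon> assume \<epsilon>: "0 < \<epsilon> \<and> \<epsilon> \<le> \<epsilon>0"
    have "\<epsilon> * Q \<le> \<epsilon>0 * (Q + 1)" using \<epsilon> Q0 by (intro mult_mono) auto
    also have "\<dots> = \<delta> * \<eta> / 2"
      unfolding \<epsilon>0_def by (rule nonzero_eq_divide_eq[THEN iffD1, OF _ refl]) (use Q0 in simp)
    finally have \<epsilon>Q: "\<epsilon> * Q \<le> \<delta> * \<eta> / 2" .
    define P0 where "P0 y = \<epsilon> * q (y - 1)" for y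
    define P0' where "P0' y = \<epsilon> * (2 * \<phi>0' (y - 1) + (y - 1) * \<phi>0'' (y - 1) + m * \<phi>0 (y - 1)
       + m * (y - 1) * \<phi>0' (y - 1) + \<phi>1 (y - 1) + (y - 1) * \<phi>1' (y - 1))" for y
    have shift: "((\<lambda>y. y - 1) has_real_derivative 1) (at y)" for y :: real by (auto intro!: derivative_eq_intros)
    note Ds = D[THEN DERIV_chain2, OF shift]
    have P0_deriv: "(P0 has_real_derivative P0' y) (at y)" for y
      unfolding P0_def P0'_def q_def
      by (rule derivative_eq_intros Ds refl)+ (simp add: algebra_simps)
    have cP0: "continuous_on UNIV P0"
      by (rule DERIV_continuous_on[OF DERIV_subset[OF P0_deriv]]) auto
    \<comment> \<open>A primitive of the odd part of \<open>q\<close>. It is even, so it drops out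
      of the mean over a symmetric interval and only the initial value
      \<open>\<epsilon> * \<phi>0\<close> remains.\<close>
    define G where "G y = sint 0 y (\<lambda>s. m * s * \<phi>0 s + s * \<phi>1 s)" for y
    have cG: "continuous_on UNIV (\<lambda>s. m * s * \<phi>0 s + s * \<phi>1 s)" by (intro continuous_intros C)
    have dG: "(G has_real_derivative m * y * \<phi>0 y + y * \<phi>1 y) (at y)" for y
      unfolding G_def by (rule sint_has_real_derivative[OF cG])
    have G_even: "G (- y) = G y" for y
      unfolding G_def by (rule sint_odd[OF cG]) (simp add: even algebra_simps)
    have mean_P0: "mean 1 r P0 = \<epsilon> * \<phi>0 r" for r
    proof (cases "r = 0")
      case True
      then show ?thesis by (simp add: mean_def P0_def q_def)
    next
      case False
      define H where "H y = \<epsilon> * ((y - 1) * \<phi>0 (y - 1) + G (y - 1))" for y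
      have dH: "(H has_real_derivative P0 y) (at y)" for y
        unfolding H_def P0_def q_def
        by (rule derivative_eq_intros Ds DERIV_chain2[OF dG shift] refl)+ (simp add: algebra_simps)
      have "r * mean 1 r P0 = (H (1 + r) - H 0 - (H (1 - r) - H 0)) / 2"
        unfolding mean_eq_sint[OF cP0] sint_eq_diff[OF dH] ..
      also have "\<dots> = r * (\<epsilon> * \<phi>0 r)" by (simp add: H_def even G_even algebra_simps)
      finally show ?thesis using False by simp
    qed
    interpret cauchy_problem m p \<eta> \<delta> P0 P0'
    proof
      show "continuous_on UNIV P0'"
        unfolding P0'_def
        by (intro continuous_intros continuous_on_compose2[OF C(1)[of UNIV]] continuous_on_compose2[OF C(2)[of UNIV]] continuous_on_compose2[OF C(3)[of UNIV]]
            continuous_on_compose2[OF C'(1)[of UNIV]] continuous_on_compose2[OF C'(2)[of UNIV]] subset_UNIV)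
      show "P0 y = 0" if "1 - \<eta> \<le> \<bar>y - 1\<bar>" for y using that q0[of "y - 1"] \<eta> by (simp add: P0_def)
      show "\<bar>P0 y\<bar> \<le> \<delta> * \<eta> / 2" for y
      proof -
        have "\<epsilon> * \<bar>q (y - 1)\<bar> \<le> \<epsilon> * Q" using qQ \<epsilon> by simp
        moreover have "\<bar>P0 y\<bar> = \<epsilon> * \<bar>q (y - 1)\<bar>" using \<epsilon> by (simp add: P0_def abs_mult)
        ultimately show ?thesis using \<epsilon>Q by linarith
      qed
      show "mean 1 r P0 = 0" if "1 - \<eta> \<le> r" for r using that Z(1)[of r] \<eta> \<rho> by (simp add: mean_P0)
    qed (use \<delta> P0_deriv in auto)
    have rad: "u0 x = \<phi>0 (norm x)" "u1 x = \<phi>1 (norm x)" for x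
    proof -
      have "norm x = norm (norm x *\<^sub>R e1)" by simp
      then show "u0 x = \<phi>0 (norm x)" "u1 x = \<phi>1 (norm x)"
        using assms(7,8) unfolding radial_def \<phi>0_def \<phi>1_def by blast+
    qed
    have "\<exists>u. global_radial_solution (2 * m) p (\<lambda>x. \<epsilon> * u0 x) (\<lambda>x. \<epsilon> * u1 x) u"
    proof (rule radial_solution)
      show "mean 1 (norm x) P0 = \<epsilon> * u0 x" for x by (simp add: mean_P0 rad)
      show "(P0 (1 + norm x) - P0 (1 - norm x)) / 2 = norm x * (m * (\<epsilon> * u0 x) + \<epsilon> * u1 x)" for x
        by (simp add: P0_def q_def rad even odd' field_simps)
    qed
    then obtain u where u: "global_radial_solution (2 * m) p (\<lambda>x. \<epsilon> * u0 x) (\<lambda>x. \<epsilon> * u1 x) u" by blast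
    show "\<exists>u. global_radial_solution \<mu> p (\<lambda>x. \<epsilon> * u0 x) (\<lambda>x. \<epsilon> * u1 x) u \<and>
         (\<forall>v. global_radial_solution \<mu> p (\<lambda>x. \<epsilon> * u0 x) (\<lambda>x. \<epsilon> * u1 x) v \<longrightarrow>
              (\<forall>t\<ge>1. \<forall>x. v t x = u t x))"
    proof (intro exI[of _ u] conjI allI impI)
      have m: "2 * m = \<mu>" by (simp add: m_def)
      show "global_radial_solution \<mu> p (\<lambda>x. \<epsilon> * u0 x) (\<lambda>x. \<epsilon> * u1 x) u" using u by (simp add: m)
      fix v t x assume "global_radial_solution \<mu> p (\<lambda>x. \<epsilon> * u0 x) (\<lambda>x. \<epsilon> * u1 x) v" "1 \<le> (t::real)"
      then show "v t x = u t x"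
        using global_radial_solution_unique[OF _ u, of v t x] p_gt by (simp add: m)
    qed
  qed
qed

end
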